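(* Let $g:\mathbf{R}\to\mathbf{R}$ be bounded and measurable and let $t>0$. For distinct $x_1,\dots,x_n\in\mathbf{R}$ define the product moments for annihilating Brownian motions by $$m^{(n)}_t(x_1,\ldots,x_n)=E^A_{(x_1,\ldots,x_n)}\Big[\prod_{i\in I_t} g(X^i_t)\Big],$$ where $(x_1,\ldots,x_n)$ lists the initial positions of the annihilating Brownian motions on $\mathbf{R}$, $(X^i_t:i\in I_t)$ lists the positions of any particles that remain at time $t$, and an empty product has value $1$. Then for every $n\ge 1$ and all $x_1<x_2<\dots<x_{2n}$, $$m^{(2n)}_t(x_1,\ldots,x_{2n})=\mathrm{Pf}\big(m^{(2)}_t(x_i,x_j):1\le i<j\le 2n\big),$$ where the right hand side is the Pfaffian of the $2n\times2n$ anti-symmetric matrix with entries $m^{(2)}_t(x_i,x_j)$ ($i<j$) above the diagonal.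
   Context: Annihilating Brownian motions on $\mathbf{R}$: particles move as independent standard Brownian motions, and whenever two particles meet both are instantly removed. $E^A_{(x_1,\dots,x_n)}$ is expectation for this system started from one particle at each of $x_1,\dots,x_n$. $\mathrm{Pf}$ denotes the Pfaffian, with the sign convention $\mathrm{Pf}\begin{pmatrix}0&a\\-a&0\end{pmatrix}=a$. *)

theory Defs
  imports "HOL-Probability.Probability" "HOL-Combinatorics.Permutations"
begin

definition brownian_motion :: "'a measure \<Rightarrow> real \<Rightarrow> (real \<Rightarrow> 'a \<Rightarrow> real) \<Rightarrow> bool" where
  "brownian_motion M x B \<longleftrightarrow>
     (\<forall>t\<ge>0. B t \<in> borel_measurable M) \<and>
     (\<forall>\<omega>\<in>space M. B 0 \<omega> = x) \<and>
     (\<forall>\<omega>\<in>space M. continuous_on {0..} (\<lambda>t. B t \<omega>)) \<and>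
     (\<forall>s t. 0 \<le> s \<longrightarrow> s < t \<longrightarrow>
        distributed M lborel (\<lambda>\<omega>. B t \<omega> - B s \<omega>) (normal_density 0 (sqrt (t - s)))) \<and>
     (\<forall>(k::nat) \<tau>. 0 \<le> \<tau> 0 \<longrightarrow> (\<forall>i<k. \<tau> i < \<tau> (Suc i)) \<longrightarrow>
        prob_space.indep_vars M (\<lambda>_. borel) (\<lambda>i \<omega>. B (\<tau> (Suc i)) \<omega> - B (\<tau> i) \<omega>) {..<k})"

text \<open>Independence is between whole processes, i.e. between random elements of the product
  space of functions on the time axis.\<close>

definition independent_brownian_motions ::
    "'a measure \<Rightarrow> real list \<Rightarrow> (nat \<Rightarrow> real \<Rightarrow> 'a \<Rightarrow> real) \<Rightarrow> bool" where
  "independent_brownian_motions M xs B \<longleftrightarrow>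
     prob_space M \<and>
     (\<forall>i<length xs. brownian_motion M (xs ! i) (B i)) \<and>
     prob_space.indep_vars M (\<lambda>_. \<Pi>\<^sub>M t\<in>{0..}. borel)
       (\<lambda>i \<omega>. \<lambda>t\<in>{0..}. B i t \<omega>) {..<length xs}"

definition meet_times :: "(nat \<Rightarrow> real \<Rightarrow> real) \<Rightarrow> real \<Rightarrow> nat set \<Rightarrow> real set" where
  "meet_times w t A = {s \<in> {0..t}. \<exists>i\<in>A. \<exists>j\<in>A. i \<noteq> j \<and> w i s = w j s}"

text \<open>One round of annihilation, for particles with labels in \<open>A\<close> moving along the paths \<open>w\<close>:
  if some of them meet by time \<open>t\<close>, all particles involved in a meeting at the first meeting time
  are removed. (Three Brownian particles almost surely never meet simultaneously, so the
  convention in that case is irrelevant.)\<close>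

definition annihilate :: "(nat \<Rightarrow> real \<Rightarrow> real) \<Rightarrow> real \<Rightarrow> nat set \<Rightarrow> nat set" where
  "annihilate w t A =
     (if meet_times w t A = {} then A
      else {i \<in> A. \<forall>j\<in>A. j \<noteq> i \<longrightarrow> w j (Inf (meet_times w t A)) \<noteq> w i (Inf (meet_times w t A))})"

text \<open>Labels of the particles, among those starting with labels \<open>0, \<dots>, n - 1\<close>, that remain at
  time \<open>t\<close>. A round in which a meeting occurs removes at least two particles, so \<open>n\<close> rounds
  exhaust all meetings up to time \<open>t\<close>; see \<open>survivors_no_meeting\<close>.\<close>

definition survivors :: "(nat \<Rightarrow> real \<Rightarrow> real) \<Rightarrow> nat \<Rightarrow> real \<Rightarrow> nat set" where
  "survivors w n t = (annihilate w t ^^ n) {..<n}"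

lemma annihilate_subset: "annihilate w t A \<subseteq> A"
  by (auto simp: annihilate_def)

lemma Inf_meet_times:
  assumes fin: "finite A" and cont: "\<And>i. i \<in> A \<Longrightarrow> continuous_on {0..} (w i)"
    and ne: "meet_times w t A \<noteq> {}"
  shows "Inf (meet_times w t A) \<in> meet_times w t A"
proof -
  have eq: "meet_times w t A =
      (\<Union>i\<in>A. \<Union>j\<in>A - {i}. {s \<in> {0..t}. w i s = w j s})"
  proof (intro set_eqI iffI)
    fix s assume "s \<in> meet_times w t A"
    then obtain i j where "i \<in> A" "j \<in> A - {i}" "s \<in> {s \<in> {0..t}. w i s = w j s}"
      by (auto simp: meet_times_def)
    then show "s \<in> (\<Union>i\<in>A. \<Union>j\<in>A - {i}. {s \<in> {0..t}. w i s = w j s})"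
      by blast
  next
    fix s assume "s \<in> (\<Union>i\<in>A. \<Union>j\<in>A - {i}. {s \<in> {0..t}. w i s = w j s})"
    then obtain i j where "i \<in> A" "j \<in> A" "i \<noteq> j" "s \<in> {0..t}" "w i s = w j s"
      by auto
    then show "s \<in> meet_times w t A"
      unfolding meet_times_def by blast
  qed
  have "closed {s \<in> {0..t}. w i s = w j s}" if "i \<in> A" "j \<in> A" for i j
  proof -
    have "continuous_on {0..t} (\<lambda>s. w i s - w j s)"
      using that by (intro continuous_intros continuous_on_subset[OF cont]) auto
    then have "closed ({0..t} \<inter> (\<lambda>s. w i s - w j s) -` {0})"
      by (intro continuous_closed_preimage) auto
    also have "{0..t} \<inter> (\<lambda>s. w i s - w j s) -` {0} = {s \<in> {0..t}. w i s = w j s}"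
      by auto
    finally show ?thesis .
  qed
  then have "closed (meet_times w t A)"
    unfolding eq using fin by (intro closed_UN) auto
  moreover have "bdd_below (meet_times w t A)"
    by (rule bdd_belowI[of _ 0]) (auto simp: meet_times_def)
  ultimately show ?thesis
    using ne by (intro closed_contains_Inf)
qed

lemma survivors_no_meeting:
  assumes cont: "\<And>i. i < n \<Longrightarrow> continuous_on {0..} (w i)"
  shows "meet_times w t (survivors w n t) = {}"
proof -
  define S where "S k = (annihilate w t ^^ k) {..<n}" for k
  have step: "S (Suc k) = annihilate w t (S k)" for k
    by (simp add: S_def)
  have sub: "S k \<subseteq> {..<n}" for k
  proof (induction k)
    case (Suc k)
    then show ?case using annihilate_subset[of w t "S k"] by (simp add: step)
  qed (simp add: S_def)
  have fin: "finite (S k)" for k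
    using sub finite_subset by blast
  have "meet_times w t (S k) = {} \<or> card (S k) + k \<le> n" for k
  proof (induction k)
    case 0
    then show ?case by (simp add: S_def)
  next
    case (Suc k)
    show ?case
    proof (cases "meet_times w t (S k) = {}")
      case True
      then show ?thesis by (simp add: step annihilate_def)
    next
      case False
      have "Inf (meet_times w t (S k)) \<in> meet_times w t (S k)"
        using False sub cont by (intro Inf_meet_times fin) auto
      then have "S (Suc k) \<noteq> S k"
        using False unfolding step annihilate_def by (auto simp: meet_times_def)
      then have "S (Suc k) \<subset> S k"
        using annihilate_subset step by blast
      then have "card (S (Suc k)) < card (S k)"
        using fin psubset_card_mono by blast
      then show ?thesis using Suc False by simp
    qed
  qed
  from this[of n] have "meet_times w t (S n) = {}"
    using fin[of n] by (auto simp: meet_times_def)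
  then show ?thesis by (simp add: S_def survivors_def)
qed

text \<open>\<open>M xs\<close> and \<open>B xs\<close> are the probability space and the driving Brownian motions of the
  annihilating system started from \<open>xs\<close>: particle \<open>i\<close> follows \<open>B xs i\<close> until it is removed.\<close>

definition product_moment ::
    "(real list \<Rightarrow> 'a measure) \<Rightarrow> (real list \<Rightarrow> nat \<Rightarrow> real \<Rightarrow> 'a \<Rightarrow> real) \<Rightarrow>
     (real \<Rightarrow> real) \<Rightarrow> real \<Rightarrow> real list \<Rightarrow> real" where
  "product_moment M B g t xs =
     (\<integral>\<omega>. (\<Prod>i\<in>survivors (\<lambda>i s. B xs i s \<omega>) (length xs) t. g (B xs i t \<omega>)) \<partial>M xs)"

definition skew_matrix :: "(nat \<Rightarrow> nat \<Rightarrow> real) \<Rightarrow> nat \<Rightarrow> nat \<Rightarrow> real" where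
  "skew_matrix f i j = (if i < j then f i j else if j < i then - f j i else 0)"

text \<open>The Pfaffian of the \<open>2 n \<times> 2 n\<close> matrix \<open>A\<close>, with indices starting at \<open>0\<close>.\<close>

definition pfaffian :: "nat \<Rightarrow> (nat \<Rightarrow> nat \<Rightarrow> real) \<Rightarrow> real" where
  "pfaffian n A =
     (\<Sum>p | p permutes {..<2 * n}. of_int (sign p) * (\<Prod>i<n. A (p (2 * i)) (p (2 * i + 1))))
       / (2 ^ n * fact n)"

lemma pfaffian_2x2: "pfaffian 1 (skew_matrix f) = f 0 1"
proof -
  have "{..<2 * 1} = {0, 1::nat}" by auto
  then have "{p. p permutes {..<2 * 1::nat}} = {id, Transposition.transpose 0 1}"
    using permutes_doubleton_iff[of _ 0 "1::nat"] by auto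
  moreover have "id \<noteq> Transposition.transpose 0 (1::nat)"
    by (metis id_apply transpose_apply_first zero_neq_one)
  ultimately show ?thesis
    by (simp add: pfaffian_def skew_matrix_def sign_swap_id)
qed

end

theory Submission imports Defs begin

text \<open>
  Let \<open>W\<^sub>1, \<dots>, W\<^sub>2\<^sub>n\<close> be the independent driving motions and put \<open>h\<^sub>i\<^sub>j = 1\<close> if \<open>W\<^sub>i\<close> and \<open>W\<^sub>j\<close> meet
  by time \<open>t\<close> and \<open>h\<^sub>i\<^sub>j = g (W\<^sub>i t) g (W\<^sub>j t)\<close> otherwise. By independence the Pfaffian of the two-point
  moments is the expectation of the signed sum over perfect matchings of the products of the \<open>h\<^sub>i\<^sub>j\<close>.
  Almost surely exactly one pair \<open>a, b\<close>, adjacent among the living particles, takes part in the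
  first meeting. Exchanging \<open>W\<^sub>a\<close> and \<open>W\<^sub>b\<close> after that time preserves the law of the system, by the
  strong Markov property, and exchanges the partners of \<open>a\<close> and \<open>b\<close>; so the matchings that do not
  pair \<open>a\<close> with \<open>b\<close> cancel, while in the others the factor \<open>h\<^sub>a\<^sub>b = 1\<close> drops out. This removes the
  annihilated pairs one after the other. Once no further meeting occurs, \<open>h\<^sub>i\<^sub>j\<close> factorises and the
  Pfaffian of the matrix with all entries \<open>1\<close> above the diagonal is \<open>1\<close>.
\<close>

section \<open>Laws of systems of Brownian motions\<close>

text \<open>Two points shape the exchange argument. The sign of a term has to flip exactly once:
  transposing \<open>a\<close> and \<open>b\<close> reverses the sign of the permutation, and the
  matrix entries must not contribute another sign. Adjacency ensures this, since a transposition of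
  neighbours keeps the order of every other pair of living labels; adjacency in turn comes from
  continuity and the ordered start. Moreover the exchange takes place at a random time and only on
  the event that a particular history has occurred, so this history must be known when the pair
  meets; that is the invariant of the induction over annihilated pairs. The product space of
  trajectories does not see continuity. Meetings are therefore described there through rational
  times, and the exchange time is approximated from above by grid times. Each starting configuration
  has its own probability space, so the two-point moments can be related to the large system only
  through laws of trajectories.\<close>

lemma prod_inter_vimage:
  assumes "I \<noteq> {}"
  shows "(\<Inter>i\<in>I. X i -` A i \<inter> S) = {\<omega>\<in>S. \<forall>i\<in>I. X i \<omega> \<in> A i}"
  using assms by auto

lemma (in prob_space) indep_vars_empty: "indep_vars M' X {}"
  by (simp add: indep_vars_def2 indep_sets_def)

section \<open>Joint independence of the increments of all particles\<close>

lemma brownian_motion_measurable: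
  "brownian_motion M x W \<Longrightarrow> 0 \<le> s \<Longrightarrow> W s \<in> borel_measurable M"
  by (simp add: brownian_motion_def)

lemma grid_mono:
  fixes \<tau> :: "nat \<Rightarrow> real"
  assumes "\<And>l. l < k \<Longrightarrow> \<tau> l < \<tau> (Suc l)" "m \<le> n" "n \<le> k"
  shows "\<tau> m \<le> \<tau> n"
  using assms(2,3)
proof (induction n)
  case (Suc n)
  then show ?case using assms(1)[of n] by (cases "m = Suc n") auto
qed simp

text \<open>Independence is given in two layers: between whole processes, as elements of a function
  space, and between the increments of one process. An event about all increments is an intersection
  over particles of cylinder events in that function space, so its probability factorises over
  particles, and each factor over time intervals.\<close>

lemma indep_increments:
  assumes ibm: "independent_brownian_motions M xs W"
    and \<tau>0: "0 \<le> \<tau> 0" and \<tau>: "\<And>l. l < k \<Longrightarrow> \<tau> l < \<tau> (Suc l)"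
  shows "prob_space.indep_vars M (\<lambda>_. borel)
    (\<lambda>p \<omega>. W (fst p) (\<tau> (Suc (snd p))) \<omega> - W (fst p) (\<tau> (snd p)) \<omega>) ({..<length xs} \<times> {..<k})"
proof -
  interpret prob_space M using ibm by (simp add: independent_brownian_motions_def)
  define N where "N = length xs"
  have bm: "brownian_motion M (xs ! i) (W i)" if "i < N" for i
    using ibm that by (simp add: independent_brownian_motions_def N_def)
  have ind: "indep_vars (\<lambda>_. \<Pi>\<^sub>M t\<in>{0..}. borel) (\<lambda>i \<omega>. \<lambda>t\<in>{0..}. W i t \<omega>) {..<N}"
    using ibm by (simp add: independent_brownian_motions_def N_def)
  have pos: "0 \<le> \<tau> l" if "l \<le> k" for l
    using grid_mono[of k \<tau> 0 l] \<tau> \<tau>0 that by auto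
  show ?thesis
  proof (cases "N = 0 \<or> k = 0")
    case True
    then have "{..<length xs} \<times> {..<k} = {}" by (auto simp: N_def)
    then show ?thesis by (simp only: indep_vars_empty)
  next
    case False
    let ?D = "\<lambda>p \<omega>. W (fst p) (\<tau> (Suc (snd p))) \<omega> - W (fst p) (\<tau> (snd p)) \<omega>"
    let ?I = "{..<N} \<times> {..<k}"
    have ne: "?I \<noteq> {}" using False by auto
    have meas: "W i (\<tau> l) \<in> borel_measurable M" if "i < N" "l \<le> k" for i l
      using bm[OF that(1)] pos[OF that(2)] by (simp add: brownian_motion_def)
    have "indep_vars (\<lambda>_. borel) ?D ?I"
    proof (subst indep_vars_finite[where E="\<lambda>_. sets borel"])
      show "random_variable borel (?D p)" if "p \<in> ?I" for p
        using that by (intro borel_measurable_diff meas) auto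
      show "\<forall>A\<in>?I \<rightarrow> sets borel. prob (\<Inter>j\<in>?I. ?D j -` A j \<inter> space M) =
          (\<Prod>j\<in>?I. prob (?D j -` A j \<inter> space M))"
      proof
        fix A :: "nat \<times> nat \<Rightarrow> real set" assume "A \<in> ?I \<rightarrow> sets borel"
        then have A: "A (i, l) \<in> sets borel" if "i < N" "l < k" for i l using that by auto
        define P where "P = (\<Pi>\<^sub>M t\<in>{0::real..}. (borel :: real measure))"
        \<comment> \<open>The condition on all increments of particle \<open>i\<close> as a set of
          paths rather than of outcomes, so that independence of the processes applies to
          it.\<close>
        define S where "S i = {w \<in> space P. \<forall>l<k. w (\<tau> (Suc l)) - w (\<tau> l) \<in> A (i, l)}" for i
        have S: "S i \<in> sets P" if "i < N" for i
        proof -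
          have "(\<lambda>w. w s) \<in> borel_measurable P" if "0 \<le> s" for s
            unfolding P_def using that by (intro measurable_component_singleton) auto
          then have m: "(\<lambda>w. w (\<tau> (Suc l)) - w (\<tau> l)) \<in> borel_measurable P" if "l < k" for l
            using pos[of l] pos[of "Suc l"] that by (intro borel_measurable_diff) auto
          have "{w \<in> space P. w (\<tau> (Suc l)) - w (\<tau> l) \<in> A (i, l)} \<in> sets P" if "l < k" for l
            using measurable_sets[OF m[OF that] A[OF \<open>i < N\<close> that]]
            by (simp add: vimage_def Int_def conj_commute)
          then have "(\<Inter>l\<in>{..<k}. {w \<in> space P. w (\<tau> (Suc l)) - w (\<tau> l) \<in> A (i, l)}) \<in> sets P"
            using False by (intro sets.finite_INT) auto
          moreover have "(\<Inter>l\<in>{..<k}. {w \<in> space P. w (\<tau> (Suc l)) - w (\<tau> l) \<in> A (i, l)}) = S i"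
            using False by (auto simp: S_def)
          ultimately show ?thesis by simp
        qed
        have Sv: "(\<lambda>\<omega>. \<lambda>t\<in>{0..}. W i t \<omega>) -` S i \<inter> space M =
            {\<omega>\<in>space M. \<forall>l<k. ?D (i, l) \<omega> \<in> A (i, l)}" if "i < N" for i
          using pos by (auto simp: S_def P_def space_PiM)
        have "prob (\<Inter>j\<in>?I. ?D j -` A j \<inter> space M) =
            prob {\<omega>\<in>space M. \<forall>i<N. \<forall>l<k. ?D (i, l) \<omega> \<in> A (i, l)}"
          using ne by (intro arg_cong[where f=prob]) (subst prod_inter_vimage, auto)
        also have "{\<omega>\<in>space M. \<forall>i<N. \<forall>l<k. ?D (i, l) \<omega> \<in> A (i, l)} =
            (\<Inter>i\<in>{..<N}. (\<lambda>\<omega>. \<lambda>t\<in>{0..}. W i t \<omega>) -` S i \<inter> space M)"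
          using False by (auto simp: Sv)
        also have "prob \<dots> = (\<Prod>i<N. prob ((\<lambda>\<omega>. \<lambda>t\<in>{0..}. W i t \<omega>) -` S i \<inter> space M))"
          using S False unfolding P_def by (intro indep_varsD[OF ind]) auto
        also have "\<dots> = (\<Prod>i<N. \<Prod>l<k. prob (?D (i, l) -` A (i, l) \<inter> space M))"
        proof (rule prod.cong)
          fix i assume i: "i \<in> {..<N}"
          have ii: "indep_vars (\<lambda>_. borel) (\<lambda>l \<omega>. W i (\<tau> (Suc l)) \<omega> - W i (\<tau> l) \<omega>) {..<k}"
            using bm[of i] i \<tau>0 \<tau> by (auto simp: brownian_motion_def)
          have "prob ((\<lambda>\<omega>. \<lambda>t\<in>{0..}. W i t \<omega>) -` S i \<inter> space M) =
              prob (\<Inter>l\<in>{..<k}. (\<lambda>\<omega>. W i (\<tau> (Suc l)) \<omega> - W i (\<tau> l) \<omega>) -` A (i, l) \<inter> space M)"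
            using i False by (subst Sv) (auto intro!: arg_cong[where f=prob])
          also have "\<dots> = (\<Prod>l<k. prob ((\<lambda>\<omega>. W i (\<tau> (Suc l)) \<omega> - W i (\<tau> l) \<omega>) -` A (i, l) \<inter> space M))"
            using A i False by (intro indep_varsD[OF ii]) auto
          finally show "prob ((\<lambda>\<omega>. \<lambda>t\<in>{0..}. W i t \<omega>) -` S i \<inter> space M) =
              (\<Prod>l<k. prob (?D (i, l) -` A (i, l) \<inter> space M))" by simp
        qed simp
        also have "\<dots> = (\<Prod>j\<in>?I. prob (?D j -` A j \<inter> space M))"
          by (simp add: prod.cartesian_product case_prod_beta)
        finally show "prob (\<Inter>j\<in>?I. ?D j -` A j \<inter> space M) =
            (\<Prod>j\<in>?I. prob (?D j -` A j \<inter> space M))" .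
      qed
    qed (use ne in \<open>auto simp: Int_stable_def sets.sigma_sets_eq[of borel, simplified]\<close>)
    then show ?thesis by (simp add: N_def)
  qed
qed

text \<open>The parameter is the variance, whereas \<open>normal_density\<close> expects the
  standard deviation.\<close>

definition normal_law :: "real \<Rightarrow> real measure" where
  "normal_law v = density lborel (normal_density 0 (sqrt v))"

lemma sets_normal_law [simp, measurable_cong]: "sets (normal_law v) = sets borel"
  by (simp add: normal_law_def)

lemma space_normal_law [simp]: "space (normal_law v) = UNIV"
  by (simp add: normal_law_def)

lemma distr_increment:
  assumes "brownian_motion M x W" "0 \<le> s" "s < u"
  shows "distr M borel (\<lambda>\<omega>. W u \<omega> - W s \<omega>) = normal_law (u - s)"
proof -
  have "distributed M lborel (\<lambda>\<omega>. W u \<omega> - W s \<omega>) (normal_density 0 (sqrt (u - s)))"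
    using assms by (simp add: brownian_motion_def)
  then have "distr M lborel (\<lambda>\<omega>. W u \<omega> - W s \<omega>) = normal_law (u - s)"
    by (simp add: distributed_def normal_law_def)
  moreover have "distr M lborel (\<lambda>\<omega>. W u \<omega> - W s \<omega>) = distr M borel (\<lambda>\<omega>. W u \<omega> - W s \<omega>)"
    by (intro distr_cong) auto
  ultimately show ?thesis by simp
qed

text \<open>The right-hand side involves only the lengths of the time intervals. Hence it is the
  same for every system with the same number of particles and is unchanged when particles are
  relabelled separately in each interval. Uniqueness of the law and its invariance under exchanges
  both come from this formula.\<close>

lemma emeasure_increments:
  assumes ibm: "independent_brownian_motions M xs W"
    and \<tau>0: "0 \<le> \<tau> 0" and \<tau>: "\<And>l. l < k \<Longrightarrow> \<tau> l < \<tau> (Suc l)"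
    and A: "\<And>p. p \<in> {..<length xs} \<times> {..<k} \<Longrightarrow> A p \<in> sets borel"
  shows "emeasure M {\<omega>\<in>space M. \<forall>p\<in>{..<length xs} \<times> {..<k}.
            W (fst p) (\<tau> (Suc (snd p))) \<omega> - W (fst p) (\<tau> (snd p)) \<omega> \<in> A p}
       = (\<Prod>p\<in>{..<length xs} \<times> {..<k}. emeasure (normal_law (\<tau> (Suc (snd p)) - \<tau> (snd p))) (A p))"
proof -
  interpret prob_space M using ibm by (simp add: independent_brownian_motions_def)
  let ?I = "{..<length xs} \<times> {..<k}"
  let ?D = "\<lambda>p \<omega>. W (fst p) (\<tau> (Suc (snd p))) \<omega> - W (fst p) (\<tau> (snd p)) \<omega>"
  have pos: "0 \<le> \<tau> l" if "l \<le> k" for l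
    using grid_mono[of k \<tau> 0 l] \<tau> \<tau>0 that by auto
  have bm: "brownian_motion M (xs ! i) (W i)" if "i < length xs" for i
    using ibm that by (simp add: independent_brownian_motions_def)
  show ?thesis
  proof (cases "?I = {}")
    case True
    have "{\<omega>\<in>space M. \<forall>p\<in>?I. ?D p \<omega> \<in> A p} = space M" unfolding True by auto
    then show ?thesis unfolding True by (simp add: emeasure_space_1)
  next
    case False
    have D: "random_variable borel (?D p)" if "p \<in> ?I" for p
      using that pos by (intro borel_measurable_diff brownian_motion_measurable[OF bm]) auto
    have "emeasure M {\<omega>\<in>space M. \<forall>p\<in>?I. ?D p \<omega> \<in> A p} =
        ennreal (prob (\<Inter>p\<in>?I. ?D p -` A p \<inter> space M))"
      using False by (subst prod_inter_vimage) (auto simp: emeasure_eq_measure)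
    also have "\<dots> = ennreal (\<Prod>p\<in>?I. prob (?D p -` A p \<inter> space M))"
      using indep_varsD[OF indep_increments[OF ibm \<tau>0 \<tau>] False, of k A] A by simp
    also have "\<dots> = (\<Prod>p\<in>?I. emeasure M (?D p -` A p \<inter> space M))"
      by (subst prod_ennreal[symmetric]) (auto simp: emeasure_eq_measure)
    also have "\<dots> = (\<Prod>p\<in>?I. emeasure (normal_law (\<tau> (Suc (snd p)) - \<tau> (snd p))) (A p))"
    proof (rule prod.cong)
      fix p assume p: "p \<in> ?I"
      have "emeasure M (?D p -` A p \<inter> space M) = emeasure (distr M borel (?D p)) (A p)"
        using D[OF p] A[OF p] by (simp add: emeasure_distr)
      also have "distr M borel (?D p) = normal_law (\<tau> (Suc (snd p)) - \<tau> (snd p))"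
        using p pos \<tau>[of "snd p"] by (intro distr_increment[OF bm]) auto
      finally show "emeasure M (?D p -` A p \<inter> space M) = emeasure (normal_law (\<tau> (Suc (snd p)) - \<tau> (snd p))) (A p)" .
    qed simp
    finally show ?thesis .
  qed
qed

section \<open>Trajectories and their finite-dimensional laws\<close>

lemma finite_grid:
  fixes F :: "real set"
  assumes "finite F" "0 \<in> F" "\<And>s. s \<in> F \<Longrightarrow> 0 \<le> s"
  obtains k :: nat and \<tau> :: "nat \<Rightarrow> real"
  where "\<tau> 0 = 0" "\<And>l. l < k \<Longrightarrow> \<tau> l < \<tau> (Suc l)" "F = \<tau> ` {..k}"
proof -
  define L where "L = sorted_list_of_set F"
  have L: "set L = F" "sorted_wrt (<) L" "L \<noteq> []"
    using assms by (auto simp: L_def)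
  define k where "k = length L - 1"
  define \<tau> where "\<tau> l = L ! l" for l
  have len: "length L = Suc k" using L(3) by (simp add: k_def)
  have mono: "\<tau> l < \<tau> (Suc l)" if "l < k" for l
    using L(2) that len by (simp add: \<tau>_def sorted_wrt_iff_nth_less)
  have F: "F = \<tau> ` {..k}"
    using L(1) len by (auto simp: \<tau>_def set_conv_nth less_Suc_eq_le)
  have "\<tau> 0 \<le> \<tau> l" if "l \<le> k" for l
    using grid_mono[of k \<tau> 0 l] mono that by auto
  then have "\<tau> 0 \<le> 0" using assms(2) F by (metis atMost_iff imageE)
  moreover have "0 \<le> \<tau> 0" using assms(3) F by auto
  ultimately have "\<tau> 0 = 0" by simp
  then show thesis using that mono F by blast
qed

text \<open>One flat product over pairs of particle and time, so that cylinder sets over finite sets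
  of such pairs determine laws. As the time axis is uncountable, continuity of the paths is not an
  event of this space.\<close>

definition traj_space :: "nat \<Rightarrow> (nat \<times> real \<Rightarrow> real) measure" where
  "traj_space N = (\<Pi>\<^sub>M p\<in>{..<N} \<times> {0..}. borel)"

definition traj :: "nat \<Rightarrow> (nat \<Rightarrow> real \<Rightarrow> real) \<Rightarrow> nat \<times> real \<Rightarrow> real" where
  "traj N w = (\<lambda>p\<in>{..<N} \<times> {0..}. w (fst p) (snd p))"

lemma traj_apply [simp]: "i < N \<Longrightarrow> 0 \<le> s \<Longrightarrow> traj N w (i, s) = w i s"
  by (simp add: traj_def)

lemma measurable_traj:
  assumes "\<And>i s. i < N \<Longrightarrow> 0 \<le> s \<Longrightarrow> W i s \<in> borel_measurable M"
  shows "(\<lambda>\<omega>. traj N (\<lambda>i s. W i s \<omega>)) \<in> measurable M (traj_space N)"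
  unfolding traj_def traj_space_def using assms by (intro measurable_restrict) auto

lemma measurable_traj_component [measurable]:
  "i < N \<Longrightarrow> 0 \<le> s \<Longrightarrow> (\<lambda>w. w (i, s)) \<in> borel_measurable (traj_space N)"
  unfolding traj_space_def by (intro measurable_component_singleton) auto

lemma restrict_vimage_prod_emb:
  fixes C :: "'i \<Rightarrow> real set"
  assumes "L \<subseteq> K"
  shows "(\<lambda>\<omega>. \<lambda>p\<in>K. f p \<omega>) -` prod_emb K (\<lambda>_. borel :: real measure) L (Pi\<^sub>E L C) \<inter> S =
    {\<omega>\<in>S. \<forall>p\<in>L. f p \<omega> \<in> C p}"
proof -
  have "(\<lambda>p\<in>K. f p \<omega>) \<in> prod_emb K (\<lambda>_. borel :: real measure) L (Pi\<^sub>E L C) \<longleftrightarrow> (\<forall>p\<in>L. f p \<omega> \<in> C p)" for \<omega>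
  proof -
    have "restrict (\<lambda>p\<in>K. f p \<omega>) L = restrict (\<lambda>p. f p \<omega>) L"
      using assms by (auto simp: restrict_def fun_eq_iff)
    then show ?thesis by (simp add: prod_emb_def Pi_iff)
  qed
  then show ?thesis by auto
qed

abbreviation inc :: "(nat \<Rightarrow> real \<Rightarrow> 'a \<Rightarrow> real) \<Rightarrow> (nat \<Rightarrow> real) \<Rightarrow> nat \<times> nat \<Rightarrow> 'a \<Rightarrow> real" where
  "inc W \<tau> p \<omega> \<equiv> W (fst p) (\<tau> (Suc (snd p))) \<omega> - W (fst p) (\<tau> (snd p)) \<omega>"

text \<open>Both systems start from the same deterministic points, so positions at finitely many
  times are sums of increments along a grid. The law of the increments therefore fixes all
  finite-dimensional laws, and these fix the law on \<open>traj_space N\<close>. The instant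
  \<open>q\<close> belongs to every grid considered, which lets intervals before and after an
  exchange at time \<open>q\<close> be treated separately.\<close>

lemma traj_law_eqI:
  fixes X :: "nat \<Rightarrow> real \<Rightarrow> 'a \<Rightarrow> real" and Y :: "nat \<Rightarrow> real \<Rightarrow> 'b \<Rightarrow> real" and q :: real
  assumes M: "prob_space M" and M': "prob_space M'"
    and X: "\<And>i s. i < N \<Longrightarrow> 0 \<le> s \<Longrightarrow> X i s \<in> borel_measurable M"
    and Y: "\<And>i s. i < N \<Longrightarrow> 0 \<le> s \<Longrightarrow> Y i s \<in> borel_measurable M'"
    and X0: "\<And>i \<omega>. i < N \<Longrightarrow> \<omega> \<in> space M \<Longrightarrow> X i 0 \<omega> = x i"
    and Y0: "\<And>i \<omega>. i < N \<Longrightarrow> \<omega> \<in> space M' \<Longrightarrow> Y i 0 \<omega> = x i"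
    and q: "0 \<le> q"
    and eq: "\<And>k \<tau> A. \<tau> 0 = 0 \<Longrightarrow> (\<And>l. l < k \<Longrightarrow> \<tau> l < \<tau> (Suc l)) \<Longrightarrow> q \<in> \<tau> ` {..k} \<Longrightarrow>
        (\<And>p. p \<in> {..<N} \<times> {..<k} \<Longrightarrow> A p \<in> sets borel) \<Longrightarrow>
        emeasure M {\<omega>\<in>space M. \<forall>p\<in>{..<N} \<times> {..<k}. inc X \<tau> p \<omega> \<in> A p} =
        emeasure M' {\<omega>\<in>space M'. \<forall>p\<in>{..<N} \<times> {..<k}. inc Y \<tau> p \<omega> \<in> A p}"
  shows "distr M (traj_space N) (\<lambda>\<omega>. traj N (\<lambda>i s. X i s \<omega>)) =
    distr M' (traj_space N) (\<lambda>\<omega>. traj N (\<lambda>i s. Y i s \<omega>))"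
proof -
  interpret M: prob_space M by fact
  interpret M': prob_space M' by fact
  note mX = measurable_traj[of N X, OF X] and mY = measurable_traj[of N Y, OF Y]
  interpret D: prob_space "distr M (traj_space N) (\<lambda>\<omega>. traj N (\<lambda>i s. X i s \<omega>))"
    by (rule M.prob_space_distr[OF mX])
  show ?thesis
  proof (rule measure_eqI_PiM_infinite[where I="{..<N} \<times> {0..}" and M="\<lambda>_. borel"])
    fix A and J :: "(nat \<times> real) set"
    assume J: "finite J" "J \<subseteq> {..<N} \<times> {0..}" and A: "\<And>i. i \<in> J \<Longrightarrow> A i \<in> sets (borel :: real measure)"
    let ?E = "prod_emb ({..<N} \<times> {0..}) (\<lambda>_. borel) J (Pi\<^sub>E J A)"
    have E: "?E \<in> sets (traj_space N)"
      unfolding traj_space_def using J A by (intro sets_PiM_I) auto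
    \<comment> \<open>The times of \<open>J\<close> together with 0, where the telescoping sums
      start, and \<open>q\<close>, which the assumption \<open>eq\<close> wants in the grid.\<close>
    define F where "F = insert 0 (insert q (snd ` J))"
    have F: "finite F" "0 \<in> F" "\<And>s. s \<in> F \<Longrightarrow> 0 \<le> s"
      using J q by (auto simp: F_def)
    obtain k \<tau> where \<tau>: "\<tau> 0 = 0" "\<And>l. l < k \<Longrightarrow> \<tau> l < \<tau> (Suc l)" "F = \<tau> ` {..k}"
      using finite_grid[OF F] by metis
    have \<tau>pos: "0 \<le> \<tau> l" if "l \<le> k" for l
      using F(3)[of "\<tau> l"] \<tau>(3) that by auto
    have "\<forall>j\<in>J. \<exists>l\<le>k. snd j = \<tau> l"
    proof
      fix j assume "j \<in> J"
      then have "snd j \<in> F" by (simp add: F_def)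
      then show "\<exists>l\<le>k. snd j = \<tau> l" using \<tau>(3) by auto
    qed
    then obtain idx where idx: "\<And>j. j \<in> J \<Longrightarrow> idx j \<le> k" "\<And>j. j \<in> J \<Longrightarrow> snd j = \<tau> (idx j)"
      by metis
    define K where "K = {..<N} \<times> {..<k}"
    define P where "P = (\<Pi>\<^sub>M p\<in>K. (borel :: real measure))"
    have comp: "(\<lambda>d. d p) \<in> borel_measurable P" if "p \<in> K" for p
      unfolding P_def using that by (rule measurable_component_singleton)
    have sX: "(\<lambda>\<omega>. \<lambda>p\<in>K. inc X \<tau> p \<omega>) \<in> measurable M P"
      unfolding P_def K_def using \<tau>pos by (intro measurable_restrict borel_measurable_diff X) auto
    have sY: "(\<lambda>\<omega>. \<lambda>p\<in>K. inc Y \<tau> p \<omega>) \<in> measurable M' P"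
      unfolding P_def K_def using \<tau>pos by (intro measurable_restrict borel_measurable_diff Y) auto
    have "finite K" by (simp add: K_def)
    have law: "distr M P (\<lambda>\<omega>. \<lambda>p\<in>K. inc X \<tau> p \<omega>) = distr M' P (\<lambda>\<omega>. \<lambda>p\<in>K. inc Y \<tau> p \<omega>)"
    proof (rule measure_eqI_PiM_infinite[where I=K and M="\<lambda>_. borel"])
      fix C and L :: "(nat \<times> nat) set"
      assume L: "finite L" "L \<subseteq> K" and C: "\<And>i. i \<in> L \<Longrightarrow> C i \<in> sets (borel :: real measure)"
      let ?G = "prod_emb K (\<lambda>_. borel) L (Pi\<^sub>E L C)"
      have G: "?G \<in> sets P" unfolding P_def using L C by (intro sets_PiM_I) auto
      \<comment> \<open>Coordinates outside \<open>L\<close> are left unrestricted, so that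
        \<open>eq\<close> for the full index set applies.\<close>
      define C' where "C' p = (if p \<in> L then C p else UNIV)" for p
      have 1: "(\<lambda>\<omega>. \<lambda>p\<in>K. inc X \<tau> p \<omega>) -` ?G \<inter> space M = {\<omega>\<in>space M. \<forall>p\<in>K. inc X \<tau> p \<omega> \<in> C' p}"
        using L by (subst restrict_vimage_prod_emb) (auto simp: C'_def split: if_splits)
      have 2: "(\<lambda>\<omega>. \<lambda>p\<in>K. inc Y \<tau> p \<omega>) -` ?G \<inter> space M' = {\<omega>\<in>space M'. \<forall>p\<in>K. inc Y \<tau> p \<omega> \<in> C' p}"
        using L by (subst restrict_vimage_prod_emb) (auto simp: C'_def split: if_splits)
      have "emeasure M {\<omega>\<in>space M. \<forall>p\<in>K. inc X \<tau> p \<omega> \<in> C' p} =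
          emeasure M' {\<omega>\<in>space M'. \<forall>p\<in>K. inc Y \<tau> p \<omega> \<in> C' p}"
        unfolding K_def
      proof (rule eq)
        show "\<tau> 0 = 0" "\<And>l. l < k \<Longrightarrow> \<tau> l < \<tau> (Suc l)" by fact+
        show "q \<in> \<tau> ` {..k}" using \<tau>(3) by (auto simp: F_def)
        show "C' p \<in> sets borel" for p using C by (simp add: C'_def)
      qed
      then show "emeasure (distr M P (\<lambda>\<omega>. \<lambda>p\<in>K. inc X \<tau> p \<omega>)) ?G =
          emeasure (distr M' P (\<lambda>\<omega>. \<lambda>p\<in>K. inc Y \<tau> p \<omega>)) ?G"
        by (simp only: emeasure_distr[OF sX G] emeasure_distr[OF sY G] 1 2)
    next
      show "finite_measure (distr M P (\<lambda>\<omega>. \<lambda>p\<in>K. inc X \<tau> p \<omega>))"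
        using M.prob_space_distr[OF sX] by (simp add: prob_space_def)
    qed (simp_all add: P_def)
    \<comment> \<open>The cylinder event in terms of increments alone: a position is the start plus
      the increments up to the grid index of its time.\<close>
    define Q where "Q = {d\<in>space P. \<forall>j\<in>J. x (fst j) + (\<Sum>l<idx j. d (fst j, l)) \<in> A j}"
    have Q: "Q \<in> sets P"
    proof -
      have m: "(\<lambda>d. x (fst j) + (\<Sum>l<idx j. d (fst j, l))) \<in> borel_measurable P" if "j \<in> J" for j
        using that J idx(1)[OF that] comp
        by (intro borel_measurable_add borel_measurable_const borel_measurable_sum) (auto simp: K_def)
      have "Measurable.pred P (\<lambda>d. x (fst j) + (\<Sum>l<idx j. d (fst j, l)) \<in> A j)" if "j \<in> J" for j
        using measurable_sets[OF m[OF that] A[OF that]]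
        by (simp add: pred_def vimage_def Int_def conj_commute)
      then have "Measurable.pred P (\<lambda>d. \<forall>j\<in>J. x (fst j) + (\<Sum>l<idx j. d (fst j, l)) \<in> A j)"
        using J(1) by (intro pred_intros_finite) auto
      then show ?thesis by (simp add: Q_def pred_def)
    qed
    have sumX: "x (fst j) + (\<Sum>l<idx j. inc X \<tau> (fst j, l) \<omega>) = X (fst j) (snd j) \<omega>"
      if "j \<in> J" "\<omega> \<in> space M" for j \<omega>
    proof -
      have "fst j < N" using J(2) that(1) by auto
      then show ?thesis
        using sum_lessThan_telescope[of "\<lambda>l. X (fst j) (\<tau> l) \<omega>" "idx j"] X0[of "fst j" \<omega>] that idx(2)
        by (simp add: \<tau>(1))
    qed
    have sumY: "x (fst j) + (\<Sum>l<idx j. inc Y \<tau> (fst j, l) \<omega>) = Y (fst j) (snd j) \<omega>"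
      if "j \<in> J" "\<omega> \<in> space M'" for j \<omega>
    proof -
      have "fst j < N" using J(2) that(1) by auto
      then show ?thesis
        using sum_lessThan_telescope[of "\<lambda>l. Y (fst j) (\<tau> l) \<omega>" "idx j"] Y0[of "fst j" \<omega>] that idx(2)
        by (simp add: \<tau>(1))
    qed
    have inK: "(fst j, l) \<in> K" if "j \<in> J" "l < idx j" for j l
      using that J(2) idx(1)[of j] by (auto simp: K_def)
    have eX: "(\<lambda>\<omega>. traj N (\<lambda>i s. X i s \<omega>)) -` ?E \<inter> space M = {\<omega>\<in>space M. \<forall>j\<in>J. X (fst j) (snd j) \<omega> \<in> A j}"
      unfolding traj_def by (rule restrict_vimage_prod_emb[OF J(2)])
    have eX': "(\<lambda>\<omega>. \<lambda>p\<in>K. inc X \<tau> p \<omega>) -` Q \<inter> space M = {\<omega>\<in>space M. \<forall>j\<in>J. X (fst j) (snd j) \<omega> \<in> A j}"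
      using inK by (auto simp: Q_def P_def space_PiM sumX[symmetric] simp del: fst_conv snd_conv)
    have eY: "(\<lambda>\<omega>. traj N (\<lambda>i s. Y i s \<omega>)) -` ?E \<inter> space M' = {\<omega>\<in>space M'. \<forall>j\<in>J. Y (fst j) (snd j) \<omega> \<in> A j}"
      unfolding traj_def by (rule restrict_vimage_prod_emb[OF J(2)])
    have eY': "(\<lambda>\<omega>. \<lambda>p\<in>K. inc Y \<tau> p \<omega>) -` Q \<inter> space M' = {\<omega>\<in>space M'. \<forall>j\<in>J. Y (fst j) (snd j) \<omega> \<in> A j}"
      using inK by (auto simp: Q_def P_def space_PiM sumY[symmetric] simp del: fst_conv snd_conv)
    have "emeasure (distr M (traj_space N) (\<lambda>\<omega>. traj N (\<lambda>i s. X i s \<omega>))) ?E =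
        emeasure (distr M P (\<lambda>\<omega>. \<lambda>p\<in>K. inc X \<tau> p \<omega>)) Q"
      by (simp only: emeasure_distr[OF mX E] emeasure_distr[OF sX Q] eX eX')
    also have "\<dots> = emeasure (distr M' (traj_space N) (\<lambda>\<omega>. traj N (\<lambda>i s. Y i s \<omega>))) ?E"
      by (simp only: law emeasure_distr[OF mY E] emeasure_distr[OF sY Q] eY eY')
    finally show "emeasure (distr M (traj_space N) (\<lambda>\<omega>. traj N (\<lambda>i s. X i s \<omega>))) ?E =
        emeasure (distr M' (traj_space N) (\<lambda>\<omega>. traj N (\<lambda>i s. Y i s \<omega>))) ?E" .
  next
    show "finite_measure (distr M (traj_space N) (\<lambda>\<omega>. traj N (\<lambda>i s. X i s \<omega>)))"
      by unfold_locales
  qed (simp_all add: traj_space_def)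
qed

lemma ibm_prob_space: "independent_brownian_motions M xs W \<Longrightarrow> prob_space M"
  by (simp add: independent_brownian_motions_def)

lemma ibm_brownian:
  "independent_brownian_motions M xs W \<Longrightarrow> i < length xs \<Longrightarrow> brownian_motion M (xs ! i) (W i)"
  by (simp add: independent_brownian_motions_def)

lemma ibm_measurable:
  "independent_brownian_motions M xs W \<Longrightarrow> i < length xs \<Longrightarrow> 0 \<le> s \<Longrightarrow> W i s \<in> borel_measurable M"
  using ibm_brownian brownian_motion_measurable by blast

lemma ibm_start:
  "independent_brownian_motions M xs W \<Longrightarrow> i < length xs \<Longrightarrow> \<omega> \<in> space M \<Longrightarrow> W i 0 \<omega> = xs ! i"
  using ibm_brownian by (fastforce simp: brownian_motion_def)

lemma ibm_continuous:
  "independent_brownian_motions M xs W \<Longrightarrow> i < length xs \<Longrightarrow> \<omega> \<in> space M \<Longrightarrow>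
    continuous_on {0..} (\<lambda>s. W i s \<omega>)"
  using ibm_brownian by (fastforce simp: brownian_motion_def)

text \<open>Equality of laws is the only link between systems living on different probability
  spaces; it will carry the two-point moments over to the large system.\<close>

lemma ibm_law_unique:
  assumes "independent_brownian_motions M xs W" "independent_brownian_motions M' xs W'"
  shows "distr M (traj_space (length xs)) (\<lambda>\<omega>. traj (length xs) (\<lambda>i s. W i s \<omega>)) =
    distr M' (traj_space (length xs)) (\<lambda>\<omega>. traj (length xs) (\<lambda>i s. W' i s \<omega>))"
proof (rule traj_law_eqI[where x="\<lambda>i. xs ! i" and q=0])
  fix k \<tau> and A :: "nat \<times> nat \<Rightarrow> real set" assume *: "\<tau> (0::nat) = (0::real)" "\<And>l. l < k \<Longrightarrow> \<tau> l < \<tau> (Suc l)"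
    "\<And>p. p \<in> {..<length xs} \<times> {..<k} \<Longrightarrow> A p \<in> sets borel"
  show "emeasure M {\<omega>\<in>space M. \<forall>p\<in>{..<length xs} \<times> {..<k}. inc W \<tau> p \<omega> \<in> A p} =
        emeasure M' {\<omega>\<in>space M'. \<forall>p\<in>{..<length xs} \<times> {..<k}. inc W' \<tau> p \<omega> \<in> A p}"
    using emeasure_increments[OF assms(1), of \<tau> k A] emeasure_increments[OF assms(2), of \<tau> k A] * by simp
qed (use assms in \<open>auto intro: ibm_prob_space ibm_measurable ibm_start\<close>)

text \<open>After time \<open>q\<close> particle \<open>i\<close> keeps its own position and follows
  the increments of particle \<open>\<sigma> i\<close>. When the two sit at the same point at time
  \<open>q\<close> this is the literal exchange of their paths. At other times the formula still
  produces a continuous path from continuous paths, without a jump at \<open>q\<close>.\<close>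

definition swap_after :: "(nat \<Rightarrow> nat) \<Rightarrow> real \<Rightarrow> (nat \<Rightarrow> real \<Rightarrow> real) \<Rightarrow> nat \<Rightarrow> real \<Rightarrow> real" where
  "swap_after \<sigma> q w i s = (if s \<le> q then w i s else w i q + w (\<sigma> i) s - w (\<sigma> i) q)"

text \<open>Relative to a time grid containing \<open>q\<close> the exchange merely permutes identically distributed
  independent increments.\<close>

lemma swap_after_law:
  assumes ibm: "independent_brownian_motions M xs W" and q: "0 \<le> q"
    and \<sigma>: "\<And>i. i < length xs \<Longrightarrow> \<sigma> i < length xs" "\<And>i. \<sigma> (\<sigma> i) = i"
  shows "distr M (traj_space (length xs)) (\<lambda>\<omega>. traj (length xs) (swap_after \<sigma> q (\<lambda>i s. W i s \<omega>))) =
    distr M (traj_space (length xs)) (\<lambda>\<omega>. traj (length xs) (\<lambda>i s. W i s \<omega>))"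
proof (rule traj_law_eqI[where x="\<lambda>i. xs ! i" and q=q])
  let ?Y = "\<lambda>i s \<omega>. swap_after \<sigma> q (\<lambda>i s. W i s \<omega>) i s"
  show "?Y i s \<in> borel_measurable M" if "i < length xs" "0 \<le> s" for i s
    using that ibm_measurable[OF ibm] q \<sigma>(1) unfolding swap_after_def
    by (cases "s \<le> q") auto
  show "?Y i 0 \<omega> = xs ! i" if "i < length xs" "\<omega> \<in> space M" for i \<omega>
    using that ibm_start[OF ibm] q by (simp add: swap_after_def)
  fix k \<tau> and A :: "nat \<times> nat \<Rightarrow> real set"
  assume \<tau>: "\<tau> (0::nat) = (0::real)" "\<And>l. l < k \<Longrightarrow> \<tau> l < \<tau> (Suc l)" "q \<in> \<tau> ` {..k}"
    and A: "\<And>p. p \<in> {..<length xs} \<times> {..<k} \<Longrightarrow> A p \<in> sets borel"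
  obtain m where m: "m \<le> k" "q = \<tau> m" using \<tau>(3) by auto
  let ?K = "{..<length xs} \<times> {..<k}"
  \<comment> \<open>\<open>m\<close> is the grid index of \<open>q\<close>. Increments over
    intervals before \<open>q\<close> stay with their particle, later ones are relabelled by
    \<open>\<sigma>\<close>; thus \<open>\<rho>\<close> is an involution that preserves interval
    lengths.\<close>
  define \<rho> where "\<rho> p = (if snd p < m then p else (\<sigma> (fst p), snd p))" for p :: "nat \<times> nat"
  have \<rho>K: "\<rho> p \<in> ?K" if "p \<in> ?K" for p using that \<sigma>(1) by (auto simp: \<rho>_def)
  have \<rho>\<rho>: "\<rho> (\<rho> p) = p" for p using \<sigma>(2) by (simp add: \<rho>_def)
  have inc: "inc ?Y \<tau> p \<omega> = inc W \<tau> (\<rho> p) \<omega>" if p: "p \<in> ?K" for p \<omega>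
  proof (cases "snd p < m")
    case True
    have "\<tau> (snd p) \<le> q" "\<tau> (Suc (snd p)) \<le> q"
      unfolding m(2) using True m(1) by (auto intro!: grid_mono[of k] \<tau>(2))
    then show ?thesis using True by (simp add: swap_after_def \<rho>_def)
  next
    case False
    have *: "q \<le> \<tau> (snd p)" "\<tau> (snd p) < \<tau> (Suc (snd p))"
      unfolding m(2) using False m(1) p by (auto intro!: grid_mono[of k] \<tau>(2))
    show ?thesis
    proof (cases "\<tau> (snd p) = q")
      case True
      then show ?thesis using * False by (simp add: swap_after_def \<rho>_def)
    next
      case False2: False
      then have "\<not> \<tau> (snd p) \<le> q" "\<not> \<tau> (Suc (snd p)) \<le> q" using * by auto
      then show ?thesis using False by (simp add: swap_after_def \<rho>_def)
    qed
  qed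
  have "{\<omega>\<in>space M. \<forall>p\<in>?K. inc ?Y \<tau> p \<omega> \<in> A p} = {\<omega>\<in>space M. \<forall>p\<in>?K. inc W \<tau> (\<rho> p) \<omega> \<in> A p}"
    using inc by auto
  also have "\<dots> = {\<omega>\<in>space M. \<forall>p\<in>?K. inc W \<tau> p \<omega> \<in> A (\<rho> p)}"
  proof -
    have "(\<forall>p\<in>?K. inc W \<tau> (\<rho> p) \<omega> \<in> A p) \<longleftrightarrow> (\<forall>p\<in>?K. inc W \<tau> p \<omega> \<in> A (\<rho> p))" for \<omega>
      using \<rho>K \<rho>\<rho> by metis
    then show ?thesis by simp
  qed
  finally have "emeasure M {\<omega>\<in>space M. \<forall>p\<in>?K. inc ?Y \<tau> p \<omega> \<in> A p} =
      (\<Prod>p\<in>?K. emeasure (normal_law (\<tau> (Suc (snd p)) - \<tau> (snd p))) (A (\<rho> p)))"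
    using emeasure_increments[OF ibm, of \<tau> k "\<lambda>p. A (\<rho> p)"] \<tau> A \<rho>K by simp
  also have "\<dots> = (\<Prod>p\<in>?K. emeasure (normal_law (\<tau> (Suc (snd p)) - \<tau> (snd p))) (A p))"
    by (rule prod.reindex_bij_witness[where i=\<rho> and j=\<rho>]) (use \<rho>K \<rho>\<rho> in \<open>auto simp: \<rho>_def\<close>)
  also have "\<dots> = emeasure M {\<omega>\<in>space M. \<forall>p\<in>?K. inc W \<tau> p \<omega> \<in> A p}"
    using emeasure_increments[OF ibm, of \<tau> k A] \<tau> A by simp
  finally show "emeasure M {\<omega>\<in>space M. \<forall>p\<in>?K. inc ?Y \<tau> p \<omega> \<in> A p} =
      emeasure M {\<omega>\<in>space M. \<forall>p\<in>?K. inc W \<tau> p \<omega> \<in> A p}" .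
qed (use ibm q in \<open>auto intro: ibm_prob_space ibm_measurable ibm_start\<close>)

section \<open>The strong Markov property for exchanging particles\<close>

text \<open>The natural filtration, neither completed nor made right-continuous. The hypotheses on
  random times below accordingly speak of the events \<open>T < q\<close>, which is what an
  approximation of \<open>T\<close> from above by grid times asks for.\<close>

definition past :: "'a measure \<Rightarrow> nat \<Rightarrow> (nat \<Rightarrow> real \<Rightarrow> 'a \<Rightarrow> real) \<Rightarrow> real \<Rightarrow> 'a measure" where
  "past M N W q = vimage_algebra (space M)
     (\<lambda>\<omega>. \<lambda>p\<in>{..<N} \<times> {0..q}. W (fst p) (snd p) \<omega>) (\<Pi>\<^sub>M p\<in>{..<N} \<times> {0..q}. borel)"

lemma space_past [simp]: "space (past M N W q) = space M"
  by (simp add: past_def)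

lemma past_component:
  assumes "i < N" "0 \<le> s" "s \<le> q"
  shows "W i s \<in> borel_measurable (past M N W q)"
proof -
  let ?I = "{..<N} \<times> {0..q}"
  have "(\<lambda>\<omega>. \<lambda>p\<in>?I. W (fst p) (snd p) \<omega>) \<in> measurable (past M N W q) (\<Pi>\<^sub>M p\<in>?I. borel)"
    unfolding past_def by (rule measurable_vimage_algebra1) (auto simp: space_PiM)
  then have "(\<lambda>\<omega>. (\<lambda>p\<in>?I. W (fst p) (snd p) \<omega>) (i, s)) \<in> borel_measurable (past M N W q)"
    by (rule measurable_compose) (use assms in \<open>auto intro: measurable_component_singleton\<close>)
  then show ?thesis using assms by simp
qed

lemma past_mono:
  assumes "q \<le> q'"
  shows "sets (past M N W q) \<subseteq> sets (past M N W q')"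
  unfolding past_def[of M N W q]
proof (rule sets_image_in_sets)
  show "(\<lambda>\<omega>. \<lambda>p\<in>{..<N} \<times> {0..q}. W (fst p) (snd p) \<omega>) \<in> measurable (past M N W q') (\<Pi>\<^sub>M p\<in>{..<N} \<times> {0..q}. borel)"
    using assms by (intro measurable_restrict past_component) auto
qed simp

lemma past_subset:
  assumes "\<And>i s. i < N \<Longrightarrow> 0 \<le> s \<Longrightarrow> W i s \<in> borel_measurable M"
  shows "sets (past M N W q) \<subseteq> sets M"
  unfolding past_def
  by (intro sets_image_in_sets measurable_restrict) (auto intro: assms)

lemma past_vimage:
  assumes "E \<in> sets (past M N W q)"
  obtains S where "S \<in> sets (\<Pi>\<^sub>M p\<in>{..<N} \<times> {0..q}. borel)"
    "E = {\<omega>\<in>space M. (\<lambda>p\<in>{..<N} \<times> {0..q}. W (fst p) (snd p) \<omega>) \<in> S}"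
proof -
  have "(\<lambda>\<omega>. \<lambda>p\<in>{..<N} \<times> {0..q}. W (fst p) (snd p) \<omega>) \<in> space M \<rightarrow> space (\<Pi>\<^sub>M p\<in>{..<N} \<times> {0..q}. borel)"
    by (auto simp: space_PiM)
  from sets_vimage_algebra2[OF this] assms show thesis
    unfolding past_def by (auto simp: vimage_def Int_def conj_commute intro: that)
qed

section \<open>Exchange at fixed times, at grid-valued times and at random times\<close>

lemma swap_after_measurable:
  assumes "\<And>i s. i < N \<Longrightarrow> 0 \<le> s \<Longrightarrow> W i s \<in> borel_measurable M" "\<And>i. i < N \<Longrightarrow> \<sigma> i < N"
    "0 \<le> q" "i < N" "0 \<le> s"
  shows "(\<lambda>\<omega>. swap_after \<sigma> q (\<lambda>i s. W i s \<omega>) i s) \<in> borel_measurable M"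
  unfolding swap_after_def using assms by (cases "s \<le> q") auto

text \<open>An event of the past is a condition on the paths up to \<open>q\<close>, which the
  exchange leaves untouched. Its indicator can therefore be absorbed into the functional, and
  invariance of the law applies.\<close>

lemma simple_markov_swap:
  assumes ibm: "independent_brownian_motions M xs W" and N: "N = length xs" and q: "0 \<le> q"
    and \<sigma>: "\<And>i. i < N \<Longrightarrow> \<sigma> i < N" "\<And>i. \<sigma> (\<sigma> i) = i"
    and E: "E \<in> sets (past M N W q)"
    and F: "F \<in> borel_measurable (traj_space N)"
  shows "(\<integral>\<omega>. indicator E \<omega> * F (traj N (swap_after \<sigma> q (\<lambda>i s. W i s \<omega>))) \<partial>M) =
    (\<integral>\<omega>. indicator E \<omega> * F (traj N (\<lambda>i s. W i s \<omega>)) \<partial>M :: real)"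
proof -
  note m = ibm_measurable[OF ibm, folded N]
  let ?I = "{..<N} \<times> {0..q}"
  obtain S where S: "S \<in> sets (\<Pi>\<^sub>M p\<in>?I. (borel :: real measure))"
    "E = {\<omega>\<in>space M. (\<lambda>p\<in>?I. W (fst p) (snd p) \<omega>) \<in> S}"
    using past_vimage[OF E] by blast
  define G where "G w = indicator S (restrict w ?I) * F w" for w
  have r: "(\<lambda>w. restrict w ?I) \<in> measurable (traj_space N) (\<Pi>\<^sub>M p\<in>?I. (borel :: real measure))"
    unfolding traj_space_def by (rule measurable_restrict_subset) auto
  have G: "G \<in> borel_measurable (traj_space N)"
    unfolding G_def using F measurable_compose[OF r borel_measurable_indicator[OF S(1)]]
    by (intro borel_measurable_times) auto
  have r1: "restrict (traj N w) ?I = (\<lambda>p\<in>?I. w (fst p) (snd p))" for w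
    by (auto simp: traj_def restrict_def fun_eq_iff)
  have r2: "(\<lambda>p\<in>?I. swap_after \<sigma> q w (fst p) (snd p)) = (\<lambda>p\<in>?I. w (fst p) (snd p))" for w
    by (auto simp: restrict_def fun_eq_iff swap_after_def)
  have G1: "G (traj N (\<lambda>i s. W i s \<omega>)) = indicator E \<omega> * F (traj N (\<lambda>i s. W i s \<omega>))" if "\<omega> \<in> space M" for \<omega>
    unfolding G_def r1 using that S(2) by (simp add: indicator_def)
  have G2: "G (traj N (swap_after \<sigma> q (\<lambda>i s. W i s \<omega>))) =
      indicator E \<omega> * F (traj N (swap_after \<sigma> q (\<lambda>i s. W i s \<omega>)))" if "\<omega> \<in> space M" for \<omega>
    unfolding G_def r1 r2 using that S(2) by (simp add: indicator_def)
  have mX: "(\<lambda>\<omega>. traj N (\<lambda>i s. W i s \<omega>)) \<in> measurable M (traj_space N)"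
    by (rule measurable_traj) (rule m)
  have mY: "(\<lambda>\<omega>. traj N (swap_after \<sigma> q (\<lambda>i s. W i s \<omega>))) \<in> measurable M (traj_space N)"
    by (rule measurable_traj[of N "\<lambda>i s \<omega>. swap_after \<sigma> q (\<lambda>i s. W i s \<omega>) i s"])
       (rule swap_after_measurable[of N W M \<sigma>, OF m \<sigma>(1) q])
  have "(\<integral>\<omega>. G (traj N (swap_after \<sigma> q (\<lambda>i s. W i s \<omega>))) \<partial>M) = (\<integral>\<omega>. G (traj N (\<lambda>i s. W i s \<omega>)) \<partial>M)"
    using integral_distr[OF mX G] integral_distr[OF mY G] swap_after_law[OF ibm q, of \<sigma>] \<sigma> N by simp
  then show ?thesis by (simp add: G1 G2 cong: Bochner_Integration.integral_cong)
qed

text \<open>The smallest multiple of \<open>1 / (k + 1)\<close> strictly above \<open>x\<close>. By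
  strictness, the event that it equals a grid point \<open>q\<close> is a difference of two events
  of the form \<open>x < c\<close> with \<open>c \<le> q\<close>.\<close>

definition grid_above :: "nat \<Rightarrow> real \<Rightarrow> real" where
  "grid_above k x = (of_int \<lfloor>real (Suc k) * x\<rfloor> + 1) / real (Suc k)"

lemma grid_above_gt: "x < grid_above k x"
proof -
  have "real (Suc k) * x < of_int \<lfloor>real (Suc k) * x\<rfloor> + 1" by linarith
  then show ?thesis by (simp add: grid_above_def field_simps)
qed

lemma grid_above_le: "grid_above k x \<le> x + 1 / real (Suc k)"
proof -
  have "of_int \<lfloor>real (Suc k) * x\<rfloor> \<le> real (Suc k) * x" by linarith
  then have "grid_above k x \<le> (real (Suc k) * x + 1) / real (Suc k)"
    unfolding grid_above_def by (intro divide_right_mono) auto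
  then show ?thesis by (simp add: add_divide_distrib)
qed

lemma grid_above_tendsto: "(\<lambda>k. grid_above k x) \<longlonglongrightarrow> x"
proof (rule tendsto_sandwich[where f="\<lambda>_. x" and h="\<lambda>k. x + 1 / real (Suc k)"])
  show "(\<lambda>k. x + 1 / real (Suc k)) \<longlonglongrightarrow> x"
    using tendsto_add[OF tendsto_const[of x] LIMSEQ_inverse_real_of_nat] by (simp add: inverse_eq_divide)
  show "\<forall>\<^sub>F k in sequentially. x \<le> grid_above k x"
    using grid_above_gt by (intro always_eventually) (auto intro: less_imp_le)
qed (use grid_above_le in auto)

text \<open>Approximation from above suits both cases: up to \<open>T\<close> the approximating
  exchanges have not happened yet either, and after \<open>T\<close> they have eventually happened,
  at times converging to \<open>T\<close>, where the paths are continuous.\<close>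

lemma swap_after_tendsto:
  assumes c: "\<And>i. i < N \<Longrightarrow> continuous_on {0..} (w i)" and \<sigma>: "\<And>i. i < N \<Longrightarrow> \<sigma> i < N"
    and T: "0 \<le> T" and i: "i < N" and s: "0 \<le> s"
  shows "(\<lambda>k. swap_after \<sigma> (grid_above k T) w i s) \<longlonglongrightarrow> swap_after \<sigma> T w i s"
proof (cases "s \<le> T")
  case True
  then have "s \<le> grid_above k T" for k using grid_above_gt[of T k] by linarith
  then show ?thesis using True by (simp add: swap_after_def)
next
  case False
  have pos: "0 \<le> grid_above k T" for k using grid_above_gt[of T k] T by linarith
  have lim: "(\<lambda>k. w j (grid_above k T)) \<longlonglongrightarrow> w j T" if "j < N" for j
    using c[OF that] T pos
    by (intro continuous_on_tendsto_compose[OF _ grid_above_tendsto]) (auto intro: always_eventually)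
  have "\<forall>\<^sub>F k in sequentially. grid_above k T < s"
    using False by (intro order_tendstoD(2)[OF grid_above_tendsto]) auto
  then have "\<forall>\<^sub>F k in sequentially. w i (grid_above k T) + w (\<sigma> i) s - w (\<sigma> i) (grid_above k T) =
      swap_after \<sigma> (grid_above k T) w i s"
    by eventually_elim (simp add: swap_after_def)
  moreover have "(\<lambda>k. w i (grid_above k T) + w (\<sigma> i) s - w (\<sigma> i) (grid_above k T)) \<longlonglongrightarrow>
      w i T + w (\<sigma> i) s - w (\<sigma> i) T"
    using i \<sigma> by (intro tendsto_intros lim) auto
  ultimately show ?thesis using False by (auto simp: swap_after_def intro: Lim_transform_eventually)
qed

text \<open>A grid-valued time has countably many values, and for each fixed value the exchanged
  position is measurable.\<close>

lemma swap_after_grid_measurable: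
  assumes "\<And>i s. i < N \<Longrightarrow> 0 \<le> s \<Longrightarrow> W i s \<in> borel_measurable M" "\<And>i. i < N \<Longrightarrow> \<sigma> i < N"
    and T: "T \<in> borel_measurable M" "\<And>\<omega>. \<omega> \<in> space M \<Longrightarrow> 0 \<le> T \<omega>" and i: "i < N" "0 \<le> s"
  shows "(\<lambda>\<omega>. swap_after \<sigma> (grid_above k (T \<omega>)) (\<lambda>i s. W i s \<omega>) i s) \<in> borel_measurable M"
proof -
  let ?f = "\<lambda>m \<omega>. swap_after \<sigma> ((real m + 1) / real (Suc k)) (\<lambda>i s. W i s \<omega>) i s"
  have "(\<lambda>\<omega>. ?f (nat \<lfloor>real (Suc k) * T \<omega>\<rfloor>) \<omega>) \<in> borel_measurable M"
  proof (rule measurable_compose_countable[where f="?f" and g="\<lambda>\<omega>. nat \<lfloor>real (Suc k) * T \<omega>\<rfloor>"])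
    show "?f m \<in> borel_measurable M" for m
      by (rule swap_after_measurable[of N W M \<sigma>, OF assms(1,2)]) (use i in simp_all)
    show "(\<lambda>\<omega>. nat \<lfloor>real (Suc k) * T \<omega>\<rfloor>) \<in> measurable M (count_space UNIV)"
      using T(1) by measurable
  qed
  moreover have "real (nat \<lfloor>real (Suc k) * T \<omega>\<rfloor>) = of_int \<lfloor>real (Suc k) * T \<omega>\<rfloor>" if "\<omega> \<in> space M" for \<omega>
    using T(2)[OF that] by (simp add: zero_le_mult_iff)
  ultimately show ?thesis
    by (subst measurable_cong[where g="\<lambda>\<omega>. ?f (nat \<lfloor>real (Suc k) * T \<omega>\<rfloor>) \<omega>"])
       (simp_all only: grid_above_def)
qed

text \<open>\<open>E\<close> is split according to the value \<open>q j\<close> of the grid time. On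
  each piece the exchange time is deterministic and the piece belongs to the past at
  \<open>q j\<close>, so the fixed-time statement applies and the pieces add up.\<close>

lemma markov_swap_grid:
  assumes ibm: "independent_brownian_motions M xs W" and N: "N = length xs"
    and \<sigma>: "\<And>i. i < N \<Longrightarrow> \<sigma> i < N" "\<And>i. \<sigma> (\<sigma> i) = i"
    and T: "\<And>\<omega>. \<omega> \<in> E \<Longrightarrow> 0 \<le> T \<omega>" "\<And>\<omega>. \<omega> \<in> E \<Longrightarrow> T \<omega> \<le> b"
    and E: "E \<subseteq> space M" "\<And>q. 0 \<le> q \<Longrightarrow> {\<omega>\<in>E. T \<omega> < q} \<in> sets (past M N W q)"
    and F: "F \<in> borel_measurable (traj_space N)" "\<And>w. \<bar>F w\<bar> \<le> C"
  shows "(\<integral>\<omega>. indicator E \<omega> * F (traj N (swap_after \<sigma> (grid_above k (T \<omega>)) (\<lambda>i s. W i s \<omega>))) \<partial>M) =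
    (\<integral>\<omega>. indicator E \<omega> * F (traj N (\<lambda>i s. W i s \<omega>)) \<partial>M :: real)"
proof -
  interpret prob_space M using ibm by (rule ibm_prob_space)
  note m = ibm_measurable[OF ibm, folded N]
  define q where "q j = (real j + 1) / real (Suc k)" for j
  have q: "0 \<le> q j" for j by (simp add: q_def)
  define EE where "EE j = {\<omega>\<in>E. T \<omega> < q j} - {\<omega>\<in>E. T \<omega> < q j - 1 / real (Suc k)}" for j
  have EEp: "EE j \<in> sets (past M N W (q j))" for j
  proof -
    have "0 \<le> q j - 1 / real (Suc k)" "q j - 1 / real (Suc k) \<le> q j" by (simp_all add: q_def add_divide_distrib)
    then show ?thesis
      unfolding EE_def using E(2)[OF q[of j]] E(2)[of "q j - 1 / real (Suc k)"] past_mono[of _ "q j" M N W]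
      by (intro sets.Diff) blast+
  qed
  have EEm: "EE j \<in> sets M" for j using EEp past_subset[of N W M] m by blast
  \<comment> \<open>Since \<open>T\<close> is at most \<open>b\<close> on \<open>E\<close>, only
    pieces with index up to \<open>L\<close> are nonempty, and the decomposition is a finite
    sum.\<close>
  define L where "L = nat \<lfloor>real (Suc k) * b\<rfloor>"
  have EEiff: "\<omega> \<in> EE j \<longleftrightarrow> \<omega> \<in> E \<and> j = nat \<lfloor>real (Suc k) * T \<omega>\<rfloor>" for \<omega> j
  proof -
    have "q j - 1 / real (Suc k) = real j / real (Suc k)" by (simp add: q_def add_divide_distrib)
    then have "\<omega> \<in> EE j \<longleftrightarrow> \<omega> \<in> E \<and> real j \<le> real (Suc k) * T \<omega> \<and> real (Suc k) * T \<omega> < real j + 1"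
      by (auto simp: EE_def q_def pos_less_divide_eq pos_divide_le_eq not_less mult.commute)
    also have "\<dots> \<longleftrightarrow> \<omega> \<in> E \<and> \<lfloor>real (Suc k) * T \<omega>\<rfloor> = int j"
      by (simp add: floor_eq_iff)
    also have "\<dots> \<longleftrightarrow> \<omega> \<in> E \<and> j = nat \<lfloor>real (Suc k) * T \<omega>\<rfloor>"
    proof (cases "\<omega> \<in> E")
      case True
      then have "0 \<le> \<lfloor>real (Suc k) * T \<omega>\<rfloor>" using T(1) by simp
      then show ?thesis by linarith
    qed simp
    finally show ?thesis .
  qed
  have gE: "grid_above k (T \<omega>) = q j" if "\<omega> \<in> EE j" for j \<omega>
    using that T(1)[of \<omega>] unfolding EEiff by (simp add: grid_above_def q_def)
  have ind: "indicator E \<omega> * H (grid_above k (T \<omega>)) = (\<Sum>j\<le>L. indicator (EE j) \<omega> * H (q j))" for \<omega> and H :: "real \<Rightarrow> real"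
  proof (cases "\<omega> \<in> E")
    case True
    define j where "j = nat \<lfloor>real (Suc k) * T \<omega>\<rfloor>"
    have jL: "j \<le> L" unfolding j_def L_def using T(2)[OF True]
      by (intro nat_mono floor_mono mult_left_mono) auto
    have j: "\<omega> \<in> EE j" using True by (simp add: EEiff j_def)
    have "(\<Sum>j\<le>L. indicator (EE j) \<omega> * H (q j)) = (\<Sum>i\<le>L. if i = j then H (q j) else 0)"
      by (intro sum.cong) (auto simp: EEiff j_def indicator_def True)
    also have "\<dots> = H (q j)" using jL by simp
    finally show ?thesis using True gE[OF j] by simp
  next
    case False
    then show ?thesis by (simp add: EE_def)
  qed
  have mY: "(\<lambda>\<omega>. traj N (swap_after \<sigma> (q j) (\<lambda>i s. W i s \<omega>))) \<in> measurable M (traj_space N)" for j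
    by (rule measurable_traj[of N "\<lambda>i s \<omega>. swap_after \<sigma> (q j) (\<lambda>i s. W i s \<omega>) i s"])
       (rule swap_after_measurable[of N W M \<sigma>, OF m \<sigma>(1) q])
  have mX: "(\<lambda>\<omega>. traj N (\<lambda>i s. W i s \<omega>)) \<in> measurable M (traj_space N)"
    by (rule measurable_traj) (rule m)
  have iY: "integrable M (\<lambda>\<omega>. indicator (EE j) \<omega> * F (traj N (swap_after \<sigma> (q j) (\<lambda>i s. W i s \<omega>))))" for j
    using F EEm[of j] measurable_compose[OF mY F(1)]
    by (intro integrable_const_bound[where B=C]) (auto simp: indicator_def intro: order_trans[OF abs_ge_zero])
  have iX: "integrable M (\<lambda>\<omega>. indicator (EE j) \<omega> * F (traj N (\<lambda>i s. W i s \<omega>)))" for j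
    using F EEm[of j] measurable_compose[OF mX F(1)]
    by (intro integrable_const_bound[where B=C]) (auto simp: indicator_def intro: order_trans[OF abs_ge_zero])
  have "(\<integral>\<omega>. indicator E \<omega> * F (traj N (swap_after \<sigma> (grid_above k (T \<omega>)) (\<lambda>i s. W i s \<omega>))) \<partial>M) =
     (\<integral>\<omega>. (\<Sum>j\<le>L. indicator (EE j) \<omega> * F (traj N (swap_after \<sigma> (q j) (\<lambda>i s. W i s \<omega>)))) \<partial>M)"
    using ind[of _ "\<lambda>r. F (traj N (swap_after \<sigma> r (\<lambda>i s. W i s _)))"]
    by (intro Bochner_Integration.integral_cong) auto
  also have "\<dots> = (\<Sum>j\<le>L. \<integral>\<omega>. indicator (EE j) \<omega> * F (traj N (swap_after \<sigma> (q j) (\<lambda>i s. W i s \<omega>))) \<partial>M)"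
    using iY by (intro Bochner_Integration.integral_sum) auto
  also have "\<dots> = (\<Sum>j\<le>L. \<integral>\<omega>. indicator (EE j) \<omega> * F (traj N (\<lambda>i s. W i s \<omega>)) \<partial>M)"
    by (intro sum.cong refl simple_markov_swap[OF ibm N q \<sigma> EEp F(1)]) auto
  also have "\<dots> = (\<integral>\<omega>. (\<Sum>j\<le>L. indicator (EE j) \<omega> * F (traj N (\<lambda>i s. W i s \<omega>))) \<partial>M)"
    using iX by (intro Bochner_Integration.integral_sum[symmetric]) auto
  also have "\<dots> = (\<integral>\<omega>. indicator E \<omega> * F (traj N (\<lambda>i s. W i s \<omega>)) \<partial>M)"
    by (intro Bochner_Integration.integral_cong refl) (simp add: ind[of _ "\<lambda>_. F (traj N (\<lambda>i s. W i s _))", symmetric])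
  finally show ?thesis .
qed

text \<open>A limit in the exchange time yields identities only for continuous functions of the
  positions. The indicator of an open half-line is a limit of continuous functions with values
  between 0 and 1, which turns such identities into identities of measures.\<close>

lemma finite_dim_eq_halflines:
  fixes X Y :: "'j \<Rightarrow> 'a \<Rightarrow> real"
  assumes M: "finite_measure M" and J: "finite J"
    and X: "\<And>j. j \<in> J \<Longrightarrow> X j \<in> borel_measurable M" and Y: "\<And>j. j \<in> J \<Longrightarrow> Y j \<in> borel_measurable M"
    and eq: "\<And>\<phi>. (\<And>j. continuous_on UNIV (\<phi> j :: real \<Rightarrow> real)) \<Longrightarrow> (\<And>j x. 0 \<le> \<phi> j x \<and> \<phi> j x \<le> 1) \<Longrightarrow>
      (\<integral>\<omega>. (\<Prod>j\<in>J. \<phi> j (X j \<omega>)) \<partial>M) = (\<integral>\<omega>. (\<Prod>j\<in>J. \<phi> j (Y j \<omega>)) \<partial>M)"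
  shows "emeasure M {\<omega>\<in>space M. \<forall>j\<in>J. c j < X j \<omega>} = emeasure M {\<omega>\<in>space M. \<forall>j\<in>J. c j < Y j \<omega>}"
proof -
  interpret finite_measure M by fact
  \<comment> \<open>For \<open>m > 0\<close>, a ramp from 0 at \<open>c j\<close> to 1 at
    \<open>c j + 1 / m\<close>.\<close>
  define \<phi> where "\<phi> m j x = min 1 (max 0 (real m * (x - c j)))" for m :: nat and j x
  have cont: "continuous_on UNIV (\<phi> m j)" for m j
    unfolding \<phi>_def by (intro continuous_intros)
  have bd: "0 \<le> \<phi> m j x \<and> \<phi> m j x \<le> 1" for m j x by (simp add: \<phi>_def)
  have lim: "(\<lambda>m. \<phi> m j x) \<longlonglongrightarrow> (if c j < x then 1 else 0)" for j x
  proof (cases "c j < x")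
    case True
    obtain m0 where m0: "1 < real m0 * (x - c j)" using True reals_Archimedean3[of "x - c j"] by auto
    have "\<phi> m j x = 1" if "m0 \<le> m" for m
    proof -
      have "real m0 * (x - c j) \<le> real m * (x - c j)" using that True by (intro mult_right_mono) auto
      then show ?thesis using m0 by (simp add: \<phi>_def)
    qed
    then have "\<forall>\<^sub>F m in sequentially. \<phi> m j x = 1" by (auto simp: eventually_sequentially)
    then show ?thesis using True by (simp add: tendsto_eventually)
  next
    case False
    then have "real m * (x - c j) \<le> 0" for m by (intro mult_nonneg_nonpos) auto
    then have "\<phi> m j x = 0" for m by (simp add: \<phi>_def max_absorb1)
    then show ?thesis using False by simp
  qed
  have main: "(\<lambda>m. \<integral>\<omega>. (\<Prod>j\<in>J. \<phi> m j (Z j \<omega>)) \<partial>M) \<longlonglongrightarrow> measure M {\<omega>\<in>space M. \<forall>j\<in>J. c j < Z j \<omega>}"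
    and ms: "{\<omega>\<in>space M. \<forall>j\<in>J. c j < Z j \<omega>} \<in> sets M"
    if Z: "\<And>j. j \<in> J \<Longrightarrow> Z j \<in> borel_measurable M" for Z
  proof -
    show ms: "{\<omega>\<in>space M. \<forall>j\<in>J. c j < Z j \<omega>} \<in> sets M"
    proof -
      have "Measurable.pred M (\<lambda>\<omega>. \<forall>j\<in>J. c j < Z j \<omega>)"
        using J Z by (intro pred_intros_finite borel_measurable_pred_less) auto
      then show ?thesis by (simp add: pred_def)
    qed
    have "(\<lambda>m. \<integral>\<omega>. (\<Prod>j\<in>J. \<phi> m j (Z j \<omega>)) \<partial>M) \<longlonglongrightarrow>
        (\<integral>\<omega>. (\<Prod>j\<in>J. (if c j < Z j \<omega> then 1 else 0)) \<partial>M)"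
    proof (rule integral_dominated_convergence[where w="\<lambda>_. 1"])
      show "(\<lambda>\<omega>. \<Prod>j\<in>J. if c j < Z j \<omega> then 1 else 0 :: real) \<in> borel_measurable M"
        using Z by (intro borel_measurable_prod measurable_If borel_measurable_pred_less) auto
      show "(\<lambda>\<omega>. \<Prod>j\<in>J. \<phi> m j (Z j \<omega>)) \<in> borel_measurable M" for m
        by (intro borel_measurable_prod borel_measurable_continuous_on[OF cont] Z)
      show "AE \<omega> in M. (\<lambda>m. \<Prod>j\<in>J. \<phi> m j (Z j \<omega>)) \<longlonglongrightarrow> (\<Prod>j\<in>J. if c j < Z j \<omega> then 1 else 0)"
        by (intro AE_I2 tendsto_prod lim)
      show "AE \<omega> in M. norm (\<Prod>j\<in>J. \<phi> m j (Z j \<omega>)) \<le> 1" for m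
        using bd by (intro AE_I2) (auto simp: abs_prod intro!: prod_le_1)
    qed simp
    also have "(\<integral>\<omega>. (\<Prod>j\<in>J. (if c j < Z j \<omega> then 1 else 0)) \<partial>M) =
        (\<integral>\<omega>. indicator {\<omega>\<in>space M. \<forall>j\<in>J. c j < Z j \<omega>} \<omega> \<partial>M :: real)"
    proof (rule Bochner_Integration.integral_cong[OF refl])
      fix \<omega> assume "\<omega> \<in> space M"
      then show "(\<Prod>j\<in>J. (if c j < Z j \<omega> then 1 else 0)) = (indicator {\<omega>\<in>space M. \<forall>j\<in>J. c j < Z j \<omega>} \<omega> :: real)"
        using J by (auto simp: indicator_def intro!: prod.neutral)
    qed
    also have "\<dots> = measure M {\<omega>\<in>space M. \<forall>j\<in>J. c j < Z j \<omega>}" using ms by simp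
    finally show "(\<lambda>m. \<integral>\<omega>. (\<Prod>j\<in>J. \<phi> m j (Z j \<omega>)) \<partial>M) \<longlonglongrightarrow> measure M {\<omega>\<in>space M. \<forall>j\<in>J. c j < Z j \<omega>}" .
  qed
  have "measure M {\<omega>\<in>space M. \<forall>j\<in>J. c j < X j \<omega>} = measure M {\<omega>\<in>space M. \<forall>j\<in>J. c j < Y j \<omega>}"
  proof (rule LIMSEQ_unique[OF main[of X, OF X]])
    show "(\<lambda>m. \<integral>\<omega>. (\<Prod>j\<in>J. \<phi> m j (X j \<omega>)) \<partial>M) \<longlonglongrightarrow> measure M {\<omega>\<in>space M. \<forall>j\<in>J. c j < Y j \<omega>}"
      unfolding eq[of "\<phi> _", OF cont bd] by (rule main[of Y, OF Y])
  qed
  then show ?thesis by (simp add: emeasure_eq_measure)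
qed

text \<open>Half-lines are replaced by Borel sets one coordinate at a time: with the other
  coordinates constrained, both sides are finite measures of the set at the chosen coordinate, and
  finite measures on the line that agree on all \<open>{x<..}\<close> coincide.\<close>

lemma finite_dim_eq:
  fixes X Y :: "'j \<Rightarrow> 'a \<Rightarrow> real"
  assumes M: "finite_measure M" and J: "finite J"
    and X: "\<And>j. j \<in> J \<Longrightarrow> X j \<in> borel_measurable M" and Y: "\<And>j. j \<in> J \<Longrightarrow> Y j \<in> borel_measurable M"
    and half: "\<And>c. emeasure M {\<omega>\<in>space M. \<forall>j\<in>J. c j < X j \<omega>} = emeasure M {\<omega>\<in>space M. \<forall>j\<in>J. c j < Y j \<omega>}"
    and A: "\<And>j. j \<in> J \<Longrightarrow> A j \<in> sets borel"
  shows "emeasure M {\<omega>\<in>space M. \<forall>j\<in>J. X j \<omega> \<in> A j} = emeasure M {\<omega>\<in>space M. \<forall>j\<in>J. Y j \<omega> \<in> A j}"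
proof -
  interpret finite_measure M by fact
  have ms: "{\<omega>\<in>space M. \<forall>j\<in>L. Z j \<omega> \<in> B j} \<in> sets M"
    if "L \<subseteq> J" "\<And>j. j \<in> J \<Longrightarrow> Z j \<in> borel_measurable M" "\<And>j. j \<in> L \<Longrightarrow> B j \<in> sets borel" for Z B L
  proof -
    have "Measurable.pred M (\<lambda>\<omega>. Z j \<omega> \<in> B j)" if "j \<in> L" for j
      using measurable_sets[of "Z j" M borel "B j"] that \<open>L \<subseteq> J\<close> \<open>\<And>j. j \<in> J \<Longrightarrow> Z j \<in> borel_measurable M\<close>
        \<open>\<And>j. j \<in> L \<Longrightarrow> B j \<in> sets borel\<close>
      by (auto simp: pred_def vimage_def Int_def conj_commute)
    then have "Measurable.pred M (\<lambda>\<omega>. \<forall>j\<in>L. Z j \<omega> \<in> B j)"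
      using J finite_subset[OF \<open>L \<subseteq> J\<close>] by (intro pred_intros_finite) auto
    then show ?thesis by (simp add: pred_def)
  qed
  have "emeasure M {\<omega>\<in>space M. \<forall>j\<in>J. X j \<omega> \<in> B j} = emeasure M {\<omega>\<in>space M. \<forall>j\<in>J. Y j \<omega> \<in> B j}"
    if "finite K" "K \<subseteq> J" "\<And>j. j \<in> K \<Longrightarrow> B j \<in> sets borel" "\<And>j. j \<in> J - K \<Longrightarrow> B j \<in> range greaterThan" for K B
    using that
  proof (induction K arbitrary: B)
    case empty
    then have "\<forall>j. \<exists>c. j \<in> J \<longrightarrow> B j = {c<..}" by auto
    then obtain c where c: "\<And>j. j \<in> J \<Longrightarrow> B j = {c j<..}" by metis
    show ?case using half[of c] by (simp add: c cong: ball_cong)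
  next
    case (insert k K)
    have Bb: "B j \<in> sets borel" if "j \<in> J" for j
    proof (cases "j \<in> insert k K")
      case True
      then show ?thesis by (rule insert.prems(2))
    next
      case False
      with that have "B j \<in> range greaterThan" by (intro insert.prems(3)) blast
      then obtain c where "B j = {c<..}" by (rule imageE)
      then show ?thesis by simp
    qed
    define R where "R Z = {\<omega>\<in>space M. \<forall>j\<in>J - {k}. Z j \<omega> \<in> B j}" for Z :: "'j \<Rightarrow> 'a \<Rightarrow> real"
    define \<mu> where "\<mu> Z = distr (density M (indicator (R Z))) borel (Z k)" for Z :: "'j \<Rightarrow> 'a \<Rightarrow> real"
    have k: "k \<in> J" using insert.prems by auto
    have \<mu>: "emeasure (\<mu> Z) S = emeasure M {\<omega>\<in>space M. \<forall>j\<in>J. Z j \<omega> \<in> (B(k := S)) j}"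
      if Z: "\<And>j. j \<in> J \<Longrightarrow> Z j \<in> borel_measurable M" and S: "S \<in> sets borel" for Z S
    proof -
      have R: "R Z \<in> sets M" unfolding R_def by (rule ms[OF Diff_subset Z]) (simp_all add: Bb)
      have Zk: "Z k -` S \<inter> space M \<in> sets M" using measurable_sets[OF Z[OF k] S] .
      have "emeasure (\<mu> Z) S = emeasure (density M (indicator (R Z))) (Z k -` S \<inter> space M)"
        unfolding \<mu>_def using Z[OF k] S by (subst emeasure_distr) auto
      also have "\<dots> = (\<integral>\<^sup>+\<omega>. indicator (R Z) \<omega> * indicator (Z k -` S \<inter> space M) \<omega> \<partial>M)"
        using R Zk by (subst emeasure_density) auto
      also have "\<dots> = (\<integral>\<^sup>+\<omega>. indicator (R Z \<inter> (Z k -` S \<inter> space M)) \<omega> \<partial>M)"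
        by (simp add: indicator_inter_arith)
      also have "\<dots> = emeasure M (R Z \<inter> (Z k -` S \<inter> space M))"
        using R Zk by (intro nn_integral_indicator) auto
      also have "R Z \<inter> (Z k -` S \<inter> space M) = {\<omega>\<in>space M. \<forall>j\<in>J. Z j \<omega> \<in> (B(k := S)) j}"
        using k by (auto simp: R_def)
      finally show ?thesis .
    qed
    have "\<mu> X = \<mu> Y"
    proof (rule measure_eqI_lessThan)
      fix x
      show "emeasure (\<mu> X) {x<..} < \<infinity>"
        by (subst \<mu>[OF X]) (auto simp: emeasure_eq_measure)
      have "emeasure M {\<omega>\<in>space M. \<forall>j\<in>J. X j \<omega> \<in> (B(k := {x<..})) j} =
          emeasure M {\<omega>\<in>space M. \<forall>j\<in>J. Y j \<omega> \<in> (B(k := {x<..})) j}"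
      proof (rule insert.IH)
        show "K \<subseteq> J" using insert.prems by auto
        show "(B(k := {x<..})) j \<in> sets borel" if "j \<in> K" for j
          using that insert.prems(2)[of j] by simp
        show "(B(k := {x<..})) j \<in> range greaterThan" if "j \<in> J - K" for j
          using that insert.prems(3)[of j] by auto
      qed
      then show "emeasure (\<mu> X) {x<..} = emeasure (\<mu> Y) {x<..}"
        by (simp only: \<mu>[OF X] \<mu>[OF Y] borel_open open_greaterThan)
    qed (simp_all add: \<mu>_def)
    then have "emeasure (\<mu> X) (B k) = emeasure (\<mu> Y) (B k)" by simp
    then show ?case using Bb[OF k] by (simp only: \<mu>[OF X] \<mu>[OF Y] fun_upd_triv)
  qed
  from this[of J A] show ?thesis using J A by auto
qed

text \<open>The grid identity passes to the limit for products of continuous functions of finitely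
  many positions. These identify the law of the exchanged trajectory under the restriction of the
  measure to \<open>E\<close>, and equality of laws covers every measurable \<open>F\<close>,
  including functionals such as the occurrence of a meeting, which are not continuous in finitely
  many positions.\<close>

lemma strong_markov_swap:
  assumes ibm: "independent_brownian_motions M xs W" and N: "N = length xs"
    and \<sigma>: "\<And>i. i < N \<Longrightarrow> \<sigma> i < N" "\<And>i. \<sigma> (\<sigma> i) = i"
    and T: "T \<in> borel_measurable M" "\<And>\<omega>. \<omega> \<in> space M \<Longrightarrow> 0 \<le> T \<omega>" "\<And>\<omega>. \<omega> \<in> space M \<Longrightarrow> T \<omega> \<le> b"
    and E: "E \<subseteq> space M" "\<And>q. 0 \<le> q \<Longrightarrow> {\<omega>\<in>E. T \<omega> < q} \<in> sets (past M N W q)"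
    and F: "F \<in> borel_measurable (traj_space N)"
  shows "(\<integral>\<omega>. indicator E \<omega> * F (traj N (swap_after \<sigma> (T \<omega>) (\<lambda>i s. W i s \<omega>))) \<partial>M) =
    (\<integral>\<omega>. indicator E \<omega> * F (traj N (\<lambda>i s. W i s \<omega>)) \<partial>M :: real)"
proof -
  interpret prob_space M using ibm by (rule ibm_prob_space)
  note m = ibm_measurable[OF ibm, folded N]
  have Em: "E \<in> sets M"
  proof (cases "space M = {}")
    case True
    then show ?thesis using E(1) by auto
  next
    case False
    then have "0 \<le> b" using T(2,3) by force
    have "{\<omega>\<in>E. T \<omega> < b + 1} = E" using T(3) E(1) by force
    then show ?thesis using E(2)[of "b + 1"] \<open>0 \<le> b\<close> past_subset[of N W M] m by auto
  qed
  let ?Y = "\<lambda>i s \<omega>. swap_after \<sigma> (T \<omega>) (\<lambda>i s. W i s \<omega>) i s"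
  have lim: "(\<lambda>k. swap_after \<sigma> (grid_above k (T \<omega>)) (\<lambda>i s. W i s \<omega>) i s) \<longlonglongrightarrow> ?Y i s \<omega>"
    if "\<omega> \<in> space M" "i < N" "0 \<le> s" for \<omega> i s
    using ibm_continuous[OF ibm] that N \<sigma>(1) T(2) by (intro swap_after_tendsto[of N]) auto
  have mk: "(\<lambda>\<omega>. swap_after \<sigma> (grid_above k (T \<omega>)) (\<lambda>i s. W i s \<omega>) i s) \<in> borel_measurable M"
    if "i < N" "0 \<le> s" for k i s
    by (rule swap_after_grid_measurable[OF m \<sigma>(1) T(1,2) that])
  have mY: "?Y i s \<in> borel_measurable M" if "i < N" "0 \<le> s" for i s
    using borel_measurable_LIMSEQ_real[OF lim mk] that by blast
  have tX: "(\<lambda>\<omega>. traj N (\<lambda>i s. W i s \<omega>)) \<in> measurable M (traj_space N)"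
    by (rule measurable_traj) (rule m)
  have tY: "(\<lambda>\<omega>. traj N (swap_after \<sigma> (T \<omega>) (\<lambda>i s. W i s \<omega>))) \<in> measurable M (traj_space N)"
    by (rule measurable_traj[of N ?Y]) (rule mY)
  define MM where "MM = density M (indicator E)"
  have sMM[measurable_cong, simp]: "sets MM = sets M" "space MM = space M" by (simp_all add: MM_def)
  have fin: "finite_measure MM"
  proof
    have "emeasure MM (space MM) = emeasure M E"
      using Em by (simp add: MM_def emeasure_density)
    then show "emeasure MM (space MM) \<noteq> \<infinity>" by simp
  qed
  have int: "(\<integral>\<omega>. f \<omega> \<partial>MM) = (\<integral>\<omega>. indicator E \<omega> * f \<omega> \<partial>M)" if "f \<in> borel_measurable M" for f :: "'a \<Rightarrow> real"
  proof -
    have "MM = density M (\<lambda>\<omega>. ennreal (indicator E \<omega>))" by (simp add: MM_def ennreal_indicator)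
    then show ?thesis using that Em by (simp add: integral_density)
  qed
  have tX': "(\<lambda>\<omega>. traj N (\<lambda>i s. W i s \<omega>)) \<in> measurable MM (traj_space N)"
    and tY': "(\<lambda>\<omega>. traj N (swap_after \<sigma> (T \<omega>) (\<lambda>i s. W i s \<omega>))) \<in> measurable MM (traj_space N)"
    using tX tY by (simp_all cong: measurable_cong_sets)
  have law: "distr MM (traj_space N) (\<lambda>\<omega>. traj N (swap_after \<sigma> (T \<omega>) (\<lambda>i s. W i s \<omega>))) =
      distr MM (traj_space N) (\<lambda>\<omega>. traj N (\<lambda>i s. W i s \<omega>))"
  proof (rule measure_eqI_PiM_infinite[where I="{..<N} \<times> {0..}" and M="\<lambda>_. borel"])
    show "finite_measure (distr MM (traj_space N) (\<lambda>\<omega>. traj N (swap_after \<sigma> (T \<omega>) (\<lambda>i s. W i s \<omega>))))"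
      by (rule finite_measure.finite_measure_distr[OF fin tY'])
    fix A and J :: "(nat \<times> real) set"
    assume J: "finite J" "J \<subseteq> {..<N} \<times> {0..}" and A: "\<And>i. i \<in> J \<Longrightarrow> A i \<in> sets (borel :: real measure)"
    let ?E = "prod_emb ({..<N} \<times> {0..}) (\<lambda>_. borel) J (Pi\<^sub>E J A)"
    have sE: "?E \<in> sets (traj_space N)"
      unfolding traj_space_def using J A by (intro sets_PiM_I) auto
    have Jb: "fst j < N" "0 \<le> snd j" if "j \<in> J" for j using J(2) that by auto
    have mYJ: "?Y (fst j) (snd j) \<in> borel_measurable MM" if "j \<in> J" for j
      using mY[OF Jb[OF that]] by (simp cong: measurable_cong_sets)
    have mXJ: "W (fst j) (snd j) \<in> borel_measurable MM" if "j \<in> J" for j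
      using m[OF Jb[OF that]] by (simp cong: measurable_cong_sets)
    have "emeasure MM {\<omega>\<in>space MM. \<forall>j\<in>J. ?Y (fst j) (snd j) \<omega> \<in> A j} =
        emeasure MM {\<omega>\<in>space MM. \<forall>j\<in>J. W (fst j) (snd j) \<omega> \<in> A j}"
    proof (rule finite_dim_eq[where X="\<lambda>j. ?Y (fst j) (snd j)" and Y="\<lambda>j. W (fst j) (snd j)",
          OF fin J(1) mYJ mXJ finite_dim_eq_halflines[where X="\<lambda>j. ?Y (fst j) (snd j)"
            and Y="\<lambda>j. W (fst j) (snd j)", OF fin J(1) mYJ mXJ] A])
      fix \<phi> :: "nat \<times> real \<Rightarrow> real \<Rightarrow> real"
      assume cont: "\<And>j. continuous_on UNIV (\<phi> j)" and bd: "\<And>j x. 0 \<le> \<phi> j x \<and> \<phi> j x \<le> 1"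
      define H where "H w = (\<Prod>j\<in>J. \<phi> j (w j))" for w :: "nat \<times> real \<Rightarrow> real"
      have Hm: "H \<in> borel_measurable (traj_space N)"
        unfolding H_def
      proof (intro borel_measurable_prod borel_measurable_continuous_on[OF cont])
        show "(\<lambda>w. w j) \<in> borel_measurable (traj_space N)" if "j \<in> J" for j
          using measurable_traj_component[OF Jb[OF that]] by simp
      qed
      have Hb: "\<bar>H w\<bar> \<le> 1" for w
        unfolding H_def abs_prod using bd by (intro prod_le_1) auto
      have HY: "H (traj N w) = (\<Prod>j\<in>J. \<phi> j (w (fst j) (snd j)))" for w
        unfolding H_def using J(2) by (intro prod.cong) (auto simp: traj_def)
      have grid: "(\<integral>\<omega>. indicator E \<omega> * H (traj N (swap_after \<sigma> (grid_above k (T \<omega>)) (\<lambda>i s. W i s \<omega>))) \<partial>M) =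
          (\<integral>\<omega>. indicator E \<omega> * H (traj N (\<lambda>i s. W i s \<omega>)) \<partial>M)" for k
        using E T by (intro markov_swap_grid[OF ibm N \<sigma> _ _ E Hm Hb]) auto
      have "(\<lambda>k. \<integral>\<omega>. indicator E \<omega> * H (traj N (swap_after \<sigma> (grid_above k (T \<omega>)) (\<lambda>i s. W i s \<omega>))) \<partial>M)
          \<longlonglongrightarrow> (\<integral>\<omega>. indicator E \<omega> * H (traj N (swap_after \<sigma> (T \<omega>) (\<lambda>i s. W i s \<omega>))) \<partial>M)"
      proof (rule integral_dominated_convergence[where w="\<lambda>_. 1"])
        show "(\<lambda>\<omega>. indicator E \<omega> * H (traj N (swap_after \<sigma> (T \<omega>) (\<lambda>i s. W i s \<omega>)))) \<in> borel_measurable M"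
          using measurable_compose[OF tY Hm] Em by (intro borel_measurable_times) auto
        show "(\<lambda>\<omega>. indicator E \<omega> * H (traj N (swap_after \<sigma> (grid_above k (T \<omega>)) (\<lambda>i s. W i s \<omega>)))) \<in> borel_measurable M" for k
        proof -
          have "(\<lambda>\<omega>. traj N (swap_after \<sigma> (grid_above k (T \<omega>)) (\<lambda>i s. W i s \<omega>))) \<in> measurable M (traj_space N)"
            by (rule measurable_traj[of N "\<lambda>i s \<omega>. swap_after \<sigma> (grid_above k (T \<omega>)) (\<lambda>i s. W i s \<omega>) i s"]) (rule mk)
          from measurable_compose[OF this Hm] show ?thesis using Em by (intro borel_measurable_times) auto
        qed
        show "AE \<omega> in M. (\<lambda>k. indicator E \<omega> * H (traj N (swap_after \<sigma> (grid_above k (T \<omega>)) (\<lambda>i s. W i s \<omega>))))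
            \<longlonglongrightarrow> indicator E \<omega> * H (traj N (swap_after \<sigma> (T \<omega>) (\<lambda>i s. W i s \<omega>)))"
        proof (rule AE_I2)
          fix \<omega> assume \<omega>: "\<omega> \<in> space M"
          have "(\<lambda>k. \<phi> j (swap_after \<sigma> (grid_above k (T \<omega>)) (\<lambda>i s. W i s \<omega>) (fst j) (snd j)))
              \<longlonglongrightarrow> \<phi> j (?Y (fst j) (snd j) \<omega>)" if "j \<in> J" for j
            by (rule continuous_on_tendsto_compose[OF cont lim[OF \<omega> Jb[OF that]]]) auto
          then show "(\<lambda>k. indicator E \<omega> * H (traj N (swap_after \<sigma> (grid_above k (T \<omega>)) (\<lambda>i s. W i s \<omega>))))
            \<longlonglongrightarrow> indicator E \<omega> * H (traj N (swap_after \<sigma> (T \<omega>) (\<lambda>i s. W i s \<omega>)))"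
            unfolding HY by (intro tendsto_mult_left tendsto_prod) auto
        qed
        show "AE \<omega> in M. norm (indicator E \<omega> * H (traj N (swap_after \<sigma> (grid_above k (T \<omega>)) (\<lambda>i s. W i s \<omega>)))) \<le> 1" for k
          using Hb by (intro AE_I2) (auto simp: indicator_def)
      qed simp
      then have "(\<integral>\<omega>. indicator E \<omega> * H (traj N (swap_after \<sigma> (T \<omega>) (\<lambda>i s. W i s \<omega>))) \<partial>M) =
          (\<integral>\<omega>. indicator E \<omega> * H (traj N (\<lambda>i s. W i s \<omega>)) \<partial>M)"
        unfolding grid by (simp add: LIMSEQ_const_iff)
      then show "(\<integral>\<omega>. (\<Prod>j\<in>J. \<phi> j (?Y (fst j) (snd j) \<omega>)) \<partial>MM) = (\<integral>\<omega>. (\<Prod>j\<in>J. \<phi> j (W (fst j) (snd j) \<omega>)) \<partial>MM)"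
        using int[OF measurable_compose[OF tY Hm]] int[OF measurable_compose[OF tX Hm]] by (simp add: HY)
    qed
    then show "emeasure (distr MM (traj_space N) (\<lambda>\<omega>. traj N (swap_after \<sigma> (T \<omega>) (\<lambda>i s. W i s \<omega>)))) ?E =
        emeasure (distr MM (traj_space N) (\<lambda>\<omega>. traj N (\<lambda>i s. W i s \<omega>))) ?E"
      unfolding emeasure_distr[OF tX' sE] emeasure_distr[OF tY' sE]
      unfolding traj_def restrict_vimage_prod_emb[OF J(2)] .
  qed (simp_all add: traj_space_def)
  have "(\<integral>\<omega>. F (traj N (swap_after \<sigma> (T \<omega>) (\<lambda>i s. W i s \<omega>))) \<partial>MM) = (\<integral>\<omega>. F (traj N (\<lambda>i s. W i s \<omega>)) \<partial>MM)"
    using integral_distr[OF tX' F] integral_distr[OF tY' F] law by simp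
  then show ?thesis
    using int[OF measurable_compose[OF tY F]] int[OF measurable_compose[OF tX F]] by simp
qed

section \<open>Absence of simultaneous meetings\<close>

lemma pred_le_real:
  fixes f g :: "'a \<Rightarrow> real"
  assumes "f \<in> borel_measurable M" "g \<in> borel_measurable M"
  shows "Measurable.pred M (\<lambda>x. f x \<le> g x)"
  using assms by measurable

text \<open>Fubini for the joint law of \<open>X j\<close> and the remaining variables:
  \<open>X j\<close> keeps its Gaussian law once the others are fixed, while \<open>G\<close> and
  \<open>f\<close> depend on the others only.\<close>

lemma (in prob_space) emeasure_indep_slice:
  fixes X :: "'i \<Rightarrow> 'a \<Rightarrow> real"
  assumes ind: "indep_vars (\<lambda>_. borel) X I" and j: "j \<in> I"
    and law: "distr M borel (X j) = normal_law v"
    and G: "G \<in> sets (\<Pi>\<^sub>M i\<in>I - {j}. borel)" and f: "f \<in> borel_measurable (\<Pi>\<^sub>M i\<in>I - {j}. borel)"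
  shows "emeasure M {\<omega>\<in>space M. (\<lambda>i\<in>I - {j}. X i \<omega>) \<in> G \<and> \<bar>X j \<omega> + f (\<lambda>i\<in>I - {j}. X i \<omega>)\<bar> \<le> r} =
    (\<integral>\<^sup>+\<omega>. indicator G (\<lambda>i\<in>I - {j}. X i \<omega>) *
      emeasure (normal_law v) {y. \<bar>y + f (\<lambda>i\<in>I - {j}. X i \<omega>)\<bar> \<le> r} \<partial>M)"
proof -
  let ?K = "\<Pi>\<^sub>M i\<in>I - {j}. (borel :: real measure)"
  let ?J = "\<Pi>\<^sub>M i\<in>{j}. (borel :: real measure)"
  define Z where "Z \<omega> = (\<lambda>i\<in>I - {j}. X i \<omega>)" for \<omega>
  define X' where "X' \<omega> = (\<lambda>i\<in>{j}. X i \<omega>)" for \<omega>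
  have Xj: "X j \<in> borel_measurable M" using ind j by (auto simp: indep_vars_def)
  have "indep_var ?K Z (\<Pi>\<^sub>M i\<in>{j}. borel) (\<lambda>\<omega>. \<lambda>i\<in>{j}. X i \<omega>)"
    unfolding Z_def using j by (intro indep_var_restrict[OF ind]) auto
  then have iv: "indep_var ?K Z ?J X'" by (simp add: X'_def[abs_def])
  then have Z: "Z \<in> measurable M ?K" by (rule indep_var_rv1)
  have X': "X' \<in> measurable M ?J" using iv by (rule indep_var_rv2)
  have pair: "distr M ?K Z \<Otimes>\<^sub>M distr M ?J X' = distr M (?K \<Otimes>\<^sub>M ?J) (\<lambda>\<omega>. (Z \<omega>, X' \<omega>))"
    using iv unfolding indep_var_distribution_eq by simp
  have cj: "(\<lambda>w. w j) \<in> borel_measurable ?J" by (intro measurable_component_singleton) auto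
  define S where "S = {p \<in> space (?K \<Otimes>\<^sub>M ?J). fst p \<in> G \<and> \<bar>snd p j + f (fst p)\<bar> \<le> r}"
  have S: "S \<in> sets (?K \<Otimes>\<^sub>M ?J)"
  proof -
    have 1: "(\<lambda>p. \<bar>snd p j + f (fst p)\<bar>) \<in> borel_measurable (?K \<Otimes>\<^sub>M ?J)"
      by (intro borel_measurable_abs borel_measurable_add measurable_compose[OF measurable_fst f]
          measurable_compose[OF measurable_snd cj])
    have "Measurable.pred (?K \<Otimes>\<^sub>M ?J) (\<lambda>p. fst p \<in> G)"
      using measurable_sets[OF measurable_fst G] by (simp add: pred_def vimage_def Int_def conj_commute)
    then have "Measurable.pred (?K \<Otimes>\<^sub>M ?J) (\<lambda>p. fst p \<in> G \<and> \<bar>snd p j + f (fst p)\<bar> \<le> r)"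
      by (intro pred_intros_logic pred_le_real 1 borel_measurable_const)
    then show ?thesis by (simp add: S_def pred_def)
  qed
  have ZX: "(\<lambda>\<omega>. (Z \<omega>, X' \<omega>)) \<in> measurable M (?K \<Otimes>\<^sub>M ?J)"
    using Z X' by (rule measurable_Pair)
  have Zs: "Z \<omega> \<in> space ?K" for \<omega> by (simp add: Z_def space_PiM)
  have X's: "X' \<omega> \<in> space ?J" for \<omega> by (simp add: X'_def space_PiM)
  interpret nl: prob_space "distr M ?J X'" using X' by (rule prob_space_distr)
  have S': "S \<in> sets (?K \<Otimes>\<^sub>M distr M ?J X')" "S \<in> sets (distr M ?K Z \<Otimes>\<^sub>M distr M ?J X')"
    using S by (simp_all cong: sets_pair_measure_cong)
  have "emeasure M {\<omega>\<in>space M. Z \<omega> \<in> G \<and> \<bar>X j \<omega> + f (Z \<omega>)\<bar> \<le> r} =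
      emeasure (distr M (?K \<Otimes>\<^sub>M ?J) (\<lambda>\<omega>. (Z \<omega>, X' \<omega>))) S"
    unfolding emeasure_distr[OF ZX S] using Zs X's
    by (intro arg_cong[where f="emeasure M"]) (auto simp: S_def space_pair_measure, auto simp: X'_def)
  also have "\<dots> = (\<integral>\<^sup>+z. emeasure (distr M ?J X') (Pair z -` S) \<partial>distr M ?K Z)"
    unfolding pair[symmetric] by (rule nl.emeasure_pair_measure_alt[OF S'(2)])
  also have "\<dots> = (\<integral>\<^sup>+\<omega>. emeasure (distr M ?J X') (Pair (Z \<omega>) -` S) \<partial>M)"
    by (rule nn_integral_distr[OF Z]) (use nl.measurable_emeasure_Pair[OF S'(1)] in simp)
  also have "\<dots> = (\<integral>\<^sup>+\<omega>. indicator G (Z \<omega>) * emeasure (normal_law v) {y. \<bar>y + f (Z \<omega>)\<bar> \<le> r} \<partial>M)"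
  proof (rule nn_integral_cong)
    fix \<omega>
    have Pm: "Pair (Z \<omega>) -` S \<in> sets ?J" by (rule sets_Pair1[OF S])
    have iv: "{y. \<bar>y + f (Z \<omega>)\<bar> \<le> r} \<in> sets borel"
      by (intro borel_closed closed_Collect_le continuous_intros)
    have "X' -` (Pair (Z \<omega>) -` S) \<inter> space M = (if Z \<omega> \<in> G then X j -` {y. \<bar>y + f (Z \<omega>)\<bar> \<le> r} \<inter> space M else {})"
      using Zs[of \<omega>] X's by (auto simp: S_def space_pair_measure, auto simp: X'_def)
    then have "emeasure (distr M ?J X') (Pair (Z \<omega>) -` S) =
        indicator G (Z \<omega>) * emeasure (distr M borel (X j)) {y. \<bar>y + f (Z \<omega>)\<bar> \<le> r}"
      unfolding emeasure_distr[OF X' Pm] emeasure_distr[OF Xj iv] by simp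
    then show "emeasure (distr M ?J X') (Pair (Z \<omega>) -` S) =
        indicator G (Z \<omega>) * emeasure (normal_law v) {y. \<bar>y + f (Z \<omega>)\<bar> \<le> r}" by (simp add: law)
  qed
  finally show ?thesis by (simp add: Z_def)
qed

text \<open>The interval has length \<open>2 * r\<close>. From
  \<open>2 \<le> sqrt (2 * pi) \<le> 4\<close> the density is at most
  \<open>1 / (2 * sqrt v)\<close> everywhere and at least
  \<open>exp (- 9 / 2) / (4 * sqrt v)\<close> within three standard deviations of 0, where the
  interval lies if \<open>\<bar>z\<bar> \<le> 2 * sqrt v\<close> and
  \<open>r \<le> sqrt v\<close>.\<close>

lemma normal_law_interval:
  assumes v: "0 < v" and r: "0 \<le> r"
  shows "emeasure (normal_law v) {y. \<bar>y + z\<bar> \<le> r} \<le> ennreal (r / sqrt v)"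
    and "\<bar>z\<bar> \<le> 2 * sqrt v \<Longrightarrow> r \<le> sqrt v \<Longrightarrow>
      ennreal (exp (- 9 / 2) / 2 * (r / sqrt v)) \<le> emeasure (normal_law v) {y. \<bar>y + z\<bar> \<le> r}"
proof -
  have set: "{y. \<bar>y + z\<bar> \<le> r} = {- z - r..- z + r}" by auto
  have eq: "emeasure (normal_law v) {y. \<bar>y + z\<bar> \<le> r} =
      (\<integral>\<^sup>+y. ennreal (normal_density 0 (sqrt v) y) * indicator {- z - r..- z + r} y \<partial>lborel)"
    unfolding set normal_law_def by (subst emeasure_density) auto
  have len: "emeasure lborel {- z - r..- z + r} = ennreal (2 * r)" using r by simp
  have pi4: "sqrt (2 * pi * v) \<le> 4 * sqrt v" "2 * sqrt v \<le> sqrt (2 * pi * v)"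
  proof -
    have "sqrt (2 * pi * v) \<le> sqrt (16 * v)" using v pi_less_4 by (intro real_sqrt_le_mono mult_right_mono) auto
    then show "sqrt (2 * pi * v) \<le> 4 * sqrt v" by (simp add: real_sqrt_mult)
    have "sqrt (4 * v) \<le> sqrt (2 * pi * v)" using v pi_gt3 by (intro real_sqrt_le_mono mult_right_mono) auto
    then show "2 * sqrt v \<le> sqrt (2 * pi * v)" by (simp add: real_sqrt_mult)
  qed
  have sv: "0 < sqrt v" using v by simp
  have dens: "normal_density 0 (sqrt v) y = exp (- y\<^sup>2 / (2 * v)) / sqrt (2 * pi * v)" for y
    using v by (simp add: normal_density_def)
  have "emeasure (normal_law v) {y. \<bar>y + z\<bar> \<le> r} \<le>
      (\<integral>\<^sup>+y. ennreal (1 / (2 * sqrt v)) * indicator {- z - r..- z + r} y \<partial>lborel)"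
    unfolding eq
  proof (intro nn_integral_mono mult_right_mono)
    fix y
    have "exp (- y\<^sup>2 / (2 * v)) \<le> 1" using v by simp
    then have "normal_density 0 (sqrt v) y \<le> 1 / (2 * sqrt v)"
      unfolding dens using pi4(2) sv by (intro frac_le) auto
    then show "ennreal (normal_density 0 (sqrt v) y) \<le> ennreal (1 / (2 * sqrt v))" by (rule ennreal_leI)
  qed simp
  also have "\<dots> = ennreal (1 / (2 * sqrt v)) * ennreal (2 * r)"
    by (subst nn_integral_cmult_indicator) (simp_all only: len, simp)
  also have "\<dots> = ennreal (r / sqrt v)"
    using r sv by (subst ennreal_mult[symmetric]) auto
  finally show "emeasure (normal_law v) {y. \<bar>y + z\<bar> \<le> r} \<le> ennreal (r / sqrt v)" .
  assume z: "\<bar>z\<bar> \<le> 2 * sqrt v" and rv: "r \<le> sqrt v"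
  have "ennreal (exp (- 9 / 2) / 2 * (r / sqrt v)) = ennreal (exp (- 9 / 2) / (4 * sqrt v)) * ennreal (2 * r)"
    using r sv by (subst ennreal_mult[symmetric]) (auto simp: field_simps)
  also have "\<dots> = (\<integral>\<^sup>+y. ennreal (exp (- 9 / 2) / (4 * sqrt v)) * indicator {- z - r..- z + r} y \<partial>lborel)"
    by (subst nn_integral_cmult_indicator) (simp_all only: len, simp)
  also have "\<dots> \<le> (\<integral>\<^sup>+y. ennreal (normal_density 0 (sqrt v) y) * indicator {- z - r..- z + r} y \<partial>lborel)"
  proof (intro nn_integral_mono)
    fix y
    show "ennreal (exp (- 9 / 2) / (4 * sqrt v)) * indicator {- z - r..- z + r} y \<le>
        ennreal (normal_density 0 (sqrt v) y) * indicator {- z - r..- z + r} y"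
    proof (cases "y \<in> {- z - r..- z + r}")
      case True
      then have "\<bar>y\<bar> \<le> 3 * sqrt v" using z rv by auto
      then have "y\<^sup>2 \<le> (3 * sqrt v)\<^sup>2" by (metis abs_le_square_iff abs_mult abs_numeral abs_of_pos sv)
      then have "y\<^sup>2 \<le> 9 * v" using v by (simp add: power_mult_distrib)
      then have "y\<^sup>2 / (2 * v) \<le> 9 / 2" using v by (simp add: field_simps)
      then have "exp (- 9 / 2) \<le> exp (- y\<^sup>2 / (2 * v))" by simp
      then have "exp (- 9 / 2) / (4 * sqrt v) \<le> normal_density 0 (sqrt v) y"
        unfolding dens using pi4 sv v by (intro frac_le) auto
      then show ?thesis using True by (simp add: ennreal_leI)
    qed simp
  qed
  finally show "ennreal (exp (- 9 / 2) / 2 * (r / sqrt v)) \<le> emeasure (normal_law v) {y. \<bar>y + z\<bar> \<le> r}"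
    unfolding eq .
qed

text \<open>The assumptions \<open>dep\<close> translate conditions on the restricted family into
  conditions \<open>G'\<close> and \<open>f'\<close> on outcomes, so that applications can be
  written without restrictions.\<close>

lemma (in prob_space) indep_slice_bounds:
  fixes X :: "'i \<Rightarrow> 'a \<Rightarrow> real"
  assumes ind: "indep_vars (\<lambda>_. borel) X I" and j: "j \<in> I" and v: "0 < v" and r: "0 \<le> r"
    and law: "distr M borel (X j) = normal_law v"
    and G: "Measurable.pred (\<Pi>\<^sub>M i\<in>I - {j}. borel) G" and f: "f \<in> borel_measurable (\<Pi>\<^sub>M i\<in>I - {j}. borel)"
    and dep: "\<And>\<omega>. G (\<lambda>i\<in>I - {j}. X i \<omega>) = G' \<omega>" "\<And>\<omega>. f (\<lambda>i\<in>I - {j}. X i \<omega>) = f' \<omega>"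
  shows "prob {\<omega>\<in>space M. G' \<omega> \<and> \<bar>X j \<omega> + f' \<omega>\<bar> \<le> r} \<le> r / sqrt v * prob {\<omega>\<in>space M. G' \<omega>}"
    and "(\<And>\<omega>. G' \<omega> \<Longrightarrow> \<bar>f' \<omega>\<bar> \<le> 2 * sqrt v) \<Longrightarrow> r \<le> sqrt v \<Longrightarrow>
      exp (- 9 / 2) / 2 * (r / sqrt v) * prob {\<omega>\<in>space M. G' \<omega>} \<le>
        prob {\<omega>\<in>space M. G' \<omega> \<and> \<bar>X j \<omega> + f' \<omega>\<bar> \<le> r}"
proof -
  let ?K = "\<Pi>\<^sub>M i\<in>I - {j}. (borel :: real measure)"
  let ?Z = "\<lambda>\<omega>. \<lambda>i\<in>I - {j}. X i \<omega>"
  have Zm: "?Z \<in> measurable M ?K"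
    using ind by (intro measurable_restrict) (auto simp: indep_vars_def)
  have Gs: "{w\<in>space ?K. G w} \<in> sets ?K" using G by (simp add: pred_def)
  have Zs: "?Z \<omega> \<in> space ?K" for \<omega> by (simp add: space_PiM)
  have G'm: "{\<omega>\<in>space M. G' \<omega>} \<in> sets M"
    using measurable_sets[OF Zm Gs] Zs dep(1) by (simp add: vimage_def Int_def conj_commute)
  have eq: "emeasure M {\<omega>\<in>space M. G' \<omega> \<and> \<bar>X j \<omega> + f' \<omega>\<bar> \<le> r} =
      (\<integral>\<^sup>+\<omega>. indicator {\<omega>\<in>space M. G' \<omega>} \<omega> * emeasure (normal_law v) {y. \<bar>y + f' \<omega>\<bar> \<le> r} \<partial>M)"
  proof -
    have "emeasure M {\<omega>\<in>space M. G' \<omega> \<and> \<bar>X j \<omega> + f' \<omega>\<bar> \<le> r} =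
        emeasure M {\<omega>\<in>space M. ?Z \<omega> \<in> {w\<in>space ?K. G w} \<and> \<bar>X j \<omega> + f (?Z \<omega>)\<bar> \<le> r}"
      using Zs dep by simp
    also have "\<dots> = (\<integral>\<^sup>+\<omega>. indicator {w\<in>space ?K. G w} (?Z \<omega>) * emeasure (normal_law v) {y. \<bar>y + f (?Z \<omega>)\<bar> \<le> r} \<partial>M)"
      by (rule emeasure_indep_slice[OF ind j law Gs f])
    also have "\<dots> = (\<integral>\<^sup>+\<omega>. indicator {\<omega>\<in>space M. G' \<omega>} \<omega> * emeasure (normal_law v) {y. \<bar>y + f' \<omega>\<bar> \<le> r} \<partial>M)"
      using Zs dep by (intro nn_integral_cong) (simp add: indicator_def)
    finally show ?thesis .
  qed
  have "emeasure M {\<omega>\<in>space M. G' \<omega> \<and> \<bar>X j \<omega> + f' \<omega>\<bar> \<le> r} \<le>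
      (\<integral>\<^sup>+\<omega>. ennreal (r / sqrt v) * indicator {\<omega>\<in>space M. G' \<omega>} \<omega> \<partial>M)"
    unfolding eq using normal_law_interval(1)[OF v r]
    by (intro nn_integral_mono) (auto simp: indicator_def)
  also have "\<dots> = ennreal (r / sqrt v) * emeasure M {\<omega>\<in>space M. G' \<omega>}"
    using G'm by (rule nn_integral_cmult_indicator)
  finally show "prob {\<omega>\<in>space M. G' \<omega> \<and> \<bar>X j \<omega> + f' \<omega>\<bar> \<le> r} \<le> r / sqrt v * prob {\<omega>\<in>space M. G' \<omega>}"
    using r v by (simp add: emeasure_eq_measure ennreal_mult[symmetric])
  assume b: "\<And>\<omega>. G' \<omega> \<Longrightarrow> \<bar>f' \<omega>\<bar> \<le> 2 * sqrt v" and rv: "r \<le> sqrt v"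
  have "ennreal (exp (- 9 / 2) / 2 * (r / sqrt v)) * emeasure M {\<omega>\<in>space M. G' \<omega>} =
      (\<integral>\<^sup>+\<omega>. ennreal (exp (- 9 / 2) / 2 * (r / sqrt v)) * indicator {\<omega>\<in>space M. G' \<omega>} \<omega> \<partial>M)"
    using G'm by (rule nn_integral_cmult_indicator[symmetric])
  also have "\<dots> \<le> emeasure M {\<omega>\<in>space M. G' \<omega> \<and> \<bar>X j \<omega> + f' \<omega>\<bar> \<le> r}"
    unfolding eq using normal_law_interval(2)[OF v r b rv]
    by (intro nn_integral_mono) (auto simp: indicator_def)
  finally show "exp (- 9 / 2) / 2 * (r / sqrt v) * prob {\<omega>\<in>space M. G' \<omega>} \<le>
        prob {\<omega>\<in>space M. G' \<omega> \<and> \<bar>X j \<omega> + f' \<omega>\<bar> \<le> r}"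
    using r v by (simp add: emeasure_eq_measure ennreal_mult[symmetric])
qed

text \<open>One factor \<open>exp (- 9 / 2) / 2\<close>, the constant of the Gaussian lower bound,
  for each of the four variables in \<open>two_differences_bounds\<close>.\<close>

definition hit_const :: real where
  "hit_const = (exp (- 9 / 2) / 2) ^ 4"

lemma hit_const_pos: "0 < hit_const" by (simp add: hit_const_def)

text \<open>\<open>X a\<close> and \<open>X c\<close> occur in one difference each, so integrating
  over them in turn gives a factor of order \<open>r / sqrt v\<close> each time. For the lower bound
  the other two variables are merely kept within \<open>sqrt v\<close> of 0. They may coincide: this
  is the case of two pairs sharing a particle, that is, of a triple meeting.\<close>

lemma (in prob_space) two_differences_bounds:
  fixes X :: "'i \<Rightarrow> 'a \<Rightarrow> real"
  assumes ind: "indep_vars (\<lambda>_. borel) X I" and v: "0 < v" and r: "0 \<le> r"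
    and law: "\<And>i. i \<in> I \<Longrightarrow> distr M borel (X i) = normal_law v"
    and I: "a \<in> I" "b \<in> I" "c \<in> I" "d \<in> I" and free: "a \<notin> {b, c, d}" "c \<notin> {a, b, d}"
  shows "prob {\<omega>\<in>space M. \<bar>X a \<omega> - X b \<omega> + x\<bar> \<le> r \<and> \<bar>X c \<omega> - X d \<omega> + y\<bar> \<le> r} \<le> r\<^sup>2 / v"
    and "r \<le> sqrt v \<Longrightarrow>
      hit_const * (r\<^sup>2 / v) \<le> prob {\<omega>\<in>space M. \<bar>X a \<omega> - X b \<omega>\<bar> \<le> r \<and> \<bar>X c \<omega> - X d \<omega>\<bar> \<le> r}"
proof -
  let ?K = "\<lambda>j. \<Pi>\<^sub>M i\<in>I - {j}. (borel :: real measure)"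
  have comp: "(\<lambda>w. w i) \<in> borel_measurable (?K j)" if "i \<in> I" "i \<noteq> j" for i j
    using that by (intro measurable_component_singleton) auto
  have sq: "(r / sqrt v) * (r / sqrt v) = r\<^sup>2 / v" using v by (simp add: power2_eq_square)
  have nn: "0 \<le> r / sqrt v" using r v by simp
  have up1: "prob {\<omega>\<in>space M. \<bar>X c \<omega> - X d \<omega> + y\<bar> \<le> r \<and> \<bar>X a \<omega> + (x - X b \<omega>)\<bar> \<le> r} \<le>
      r / sqrt v * prob {\<omega>\<in>space M. \<bar>X c \<omega> - X d \<omega> + y\<bar> \<le> r}"
    by (rule indep_slice_bounds(1)[OF ind I(1) v r law[OF I(1)], where G="\<lambda>w. \<bar>w c - w d + y\<bar> \<le> r" and f="\<lambda>w. x - w b"])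
      (use I free in \<open>auto intro!: pred_le_real borel_measurable_abs borel_measurable_add
          borel_measurable_diff comp\<close>)
  have up2: "prob {\<omega>\<in>space M. \<bar>X c \<omega> - X d \<omega> + y\<bar> \<le> r} \<le> r / sqrt v"
  proof -
    have "prob {\<omega>\<in>space M. True \<and> \<bar>X c \<omega> + (y - X d \<omega>)\<bar> \<le> r} \<le> r / sqrt v * prob {\<omega>\<in>space M. True}"
      by (rule indep_slice_bounds(1)[OF ind I(3) v r law[OF I(3)], where G="\<lambda>w. True" and f="\<lambda>w. y - w d"])
        (use I free in \<open>auto intro!: borel_measurable_diff comp\<close>)
    then show ?thesis by (simp add: prob_space algebra_simps)
  qed
  have "{\<omega>\<in>space M. \<bar>X a \<omega> - X b \<omega> + x\<bar> \<le> r \<and> \<bar>X c \<omega> - X d \<omega> + y\<bar> \<le> r} =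
      {\<omega>\<in>space M. \<bar>X c \<omega> - X d \<omega> + y\<bar> \<le> r \<and> \<bar>X a \<omega> + (x - X b \<omega>)\<bar> \<le> r}"
    by (auto simp: algebra_simps)
  then show "prob {\<omega>\<in>space M. \<bar>X a \<omega> - X b \<omega> + x\<bar> \<le> r \<and> \<bar>X c \<omega> - X d \<omega> + y\<bar> \<le> r} \<le> r\<^sup>2 / v"
    using order_trans[OF up1 mult_left_mono[OF up2 nn]] unfolding sq by simp
  assume rv: "r \<le> sqrt v"
  define p where "p = exp (- 9 / 2) / (2 :: real)"
  have p: "0 < p" "p \<le> 1"
  proof -
    have "exp (- 9 / 2 :: real) \<le> 1" by simp
    then show "p \<le> 1" unfolding p_def by linarith
  qed (simp add: p_def)
  have sv: "0 \<le> sqrt v" "sqrt v \<le> sqrt v" "sqrt v / sqrt v = 1" using v by auto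
  have one: "p \<le> prob {\<omega>\<in>space M. \<bar>X i \<omega>\<bar> \<le> sqrt v}" if i: "i \<in> I" for i
  proof -
    have "p * (sqrt v / sqrt v) * prob {\<omega>\<in>space M. True} \<le> prob {\<omega>\<in>space M. True \<and> \<bar>X i \<omega> + 0\<bar> \<le> sqrt v}"
      unfolding p_def
      by (rule indep_slice_bounds(2)[OF ind i v sv(1) law[OF i], where G="\<lambda>w. True" and f="\<lambda>w. 0"])
         (use v in auto)
    then show ?thesis using sv by (simp add: prob_space)
  qed
  have two: "p * p \<le> prob {\<omega>\<in>space M. \<bar>X d \<omega>\<bar> \<le> sqrt v \<and> \<bar>X b \<omega>\<bar> \<le> sqrt v}"
  \<comment> \<open>If \<open>b = d\<close>, a single constraint gives one factor \<open>p\<close>;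
    the other may be inserted because \<open>p \<le> 1\<close>.\<close>
  proof (cases "b = d")
    case True
    have "p * p \<le> p * 1" using p by (intro mult_left_mono) auto
    then show ?thesis using one[OF I(4)] True by simp
  next
    case False
    have "p * (sqrt v / sqrt v) * prob {\<omega>\<in>space M. \<bar>X d \<omega>\<bar> \<le> sqrt v} \<le>
        prob {\<omega>\<in>space M. \<bar>X d \<omega>\<bar> \<le> sqrt v \<and> \<bar>X b \<omega> + 0\<bar> \<le> sqrt v}"
      unfolding p_def
      by (rule indep_slice_bounds(2)[OF ind I(2) v sv(1) law[OF I(2)], where G="\<lambda>w. \<bar>w d\<bar> \<le> sqrt v" and f="\<lambda>w. 0"])
         (use v I False in \<open>auto intro!: pred_le_real borel_measurable_abs comp\<close>)
    moreover have "p * p \<le> p * prob {\<omega>\<in>space M. \<bar>X d \<omega>\<bar> \<le> sqrt v}"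
      using one[OF I(4)] p by (intro mult_left_mono) auto
    ultimately show ?thesis using sv by simp
  qed
  have three: "p * (r / sqrt v) * prob {\<omega>\<in>space M. \<bar>X d \<omega>\<bar> \<le> sqrt v \<and> \<bar>X b \<omega>\<bar> \<le> sqrt v} \<le>
      prob {\<omega>\<in>space M. (\<bar>X d \<omega>\<bar> \<le> sqrt v \<and> \<bar>X b \<omega>\<bar> \<le> sqrt v) \<and> \<bar>X c \<omega> + - X d \<omega>\<bar> \<le> r}"
    unfolding p_def
    by (rule indep_slice_bounds(2)[OF ind I(3) v r law[OF I(3)],
          where G="\<lambda>w. \<bar>w d\<bar> \<le> sqrt v \<and> \<bar>w b\<bar> \<le> sqrt v" and f="\<lambda>w. - w d"])
       (use v rv I free in \<open>auto intro!: pred_intros_logic pred_le_real borel_measurable_abs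
          borel_measurable_uminus comp\<close>)
  have four: "p * (r / sqrt v) * prob {\<omega>\<in>space M. \<bar>X b \<omega>\<bar> \<le> sqrt v \<and> \<bar>X c \<omega> + - X d \<omega>\<bar> \<le> r} \<le>
      prob {\<omega>\<in>space M. (\<bar>X b \<omega>\<bar> \<le> sqrt v \<and> \<bar>X c \<omega> + - X d \<omega>\<bar> \<le> r) \<and> \<bar>X a \<omega> + - X b \<omega>\<bar> \<le> r}"
    unfolding p_def
    by (rule indep_slice_bounds(2)[OF ind I(1) v r law[OF I(1)],
          where G="\<lambda>w. \<bar>w b\<bar> \<le> sqrt v \<and> \<bar>w c + - w d\<bar> \<le> r" and f="\<lambda>w. - w b"])
       (use v rv I free in \<open>auto intro!: pred_intros_logic pred_le_real borel_measurable_abs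
          borel_measurable_add borel_measurable_uminus comp\<close>)
  have Xm: "X i \<in> borel_measurable M" if "i \<in> I" for i using ind that by (auto simp: indep_vars_def)
  have ev1: "{\<omega>\<in>space M. \<bar>X b \<omega>\<bar> \<le> sqrt v \<and> \<bar>X c \<omega> + - X d \<omega>\<bar> \<le> r} \<in> events"
    using Xm[OF I(2)] Xm[OF I(3)] Xm[OF I(4)] by measurable
  have ev2: "{\<omega>\<in>space M. \<bar>X a \<omega> - X b \<omega>\<bar> \<le> r \<and> \<bar>X c \<omega> - X d \<omega>\<bar> \<le> r} \<in> events"
    using Xm[OF I(1)] Xm[OF I(2)] Xm[OF I(3)] Xm[OF I(4)] by measurable
  have pr: "0 \<le> p * (r / sqrt v)" using p nn by (intro mult_nonneg_nonneg) auto
  have hc: "hit_const = p * p * p * p"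
    by (simp add: hit_const_def p_def power4_eq_xxxx)
  have "hit_const * (r\<^sup>2 / v) = p * (r / sqrt v) * (p * (r / sqrt v) * (p * p))"
    unfolding sq[symmetric] hc by (simp only: ac_simps)
  also have "\<dots> \<le> p * (r / sqrt v) * (p * (r / sqrt v) *
      prob {\<omega>\<in>space M. \<bar>X d \<omega>\<bar> \<le> sqrt v \<and> \<bar>X b \<omega>\<bar> \<le> sqrt v})"
    by (intro mult_left_mono two pr)
  also have "\<dots> \<le> p * (r / sqrt v) * prob {\<omega>\<in>space M. (\<bar>X d \<omega>\<bar> \<le> sqrt v \<and> \<bar>X b \<omega>\<bar> \<le> sqrt v) \<and> \<bar>X c \<omega> + - X d \<omega>\<bar> \<le> r}"
    by (intro mult_left_mono three pr)
  also have "\<dots> \<le> p * (r / sqrt v) * prob {\<omega>\<in>space M. \<bar>X b \<omega>\<bar> \<le> sqrt v \<and> \<bar>X c \<omega> + - X d \<omega>\<bar> \<le> r}"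
    using ev1 by (intro mult_left_mono finite_measure_mono pr) auto
  also have "\<dots> \<le> prob {\<omega>\<in>space M. (\<bar>X b \<omega>\<bar> \<le> sqrt v \<and> \<bar>X c \<omega> + - X d \<omega>\<bar> \<le> r) \<and> \<bar>X a \<omega> + - X b \<omega>\<bar> \<le> r}"
    by (rule four)
  also have "\<dots> \<le> prob {\<omega>\<in>space M. \<bar>X a \<omega> - X b \<omega>\<bar> \<le> r \<and> \<bar>X c \<omega> - X d \<omega>\<bar> \<le> r}"
    using ev2 by (intro finite_measure_mono) auto
  finally show "hit_const * (r\<^sup>2 / v) \<le> prob {\<omega>\<in>space M. \<bar>X a \<omega> - X b \<omega>\<bar> \<le> r \<and> \<bar>X c \<omega> - X d \<omega>\<bar> \<le> r}" .
qed

section \<open>Counting close approaches on a time grid\<close>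

lemma dyadic_harmonic_sum:
  assumes "0 < m"
  shows "real K / 2 \<le> (\<Sum>j\<in>{m<..2 ^ K * m}. 1 / real j)"
proof (induction K)
  case (Suc K)
  have split: "{m<..2 ^ Suc K * m} = {m<..2 ^ K * m} \<union> {2 ^ K * m<..2 ^ Suc K * m}"
  proof -
    have "m \<le> 2 ^ K * m" "2 ^ K * m \<le> 2 ^ Suc K * m" by simp_all
    then show ?thesis by (subst ivl_disj_un_two(6)) auto
  qed
  \<comment> \<open>A doubling adds \<open>2 ^ K * m\<close> terms, none below
    \<open>1 / (2 ^ Suc K * m)\<close>, hence at least \<open>1 / 2\<close>. This is the source of
    the logarithm.\<close>
  have "real (card {2 ^ K * m<..2 ^ Suc K * m}) * (1 / real (2 ^ Suc K * m)) \<le>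
      (\<Sum>j\<in>{2 ^ K * m<..2 ^ Suc K * m}. 1 / real j)"
    using assms by (intro sum_bounded_below frac_le) (auto simp del: of_nat_mult of_nat_power power_Suc)
  then have "1 / 2 \<le> (\<Sum>j\<in>{2 ^ K * m<..2 ^ Suc K * m}. 1 / real j)"
    using assms by simp
  then show ?case
    using Suc by (subst split, subst sum.union_disjoint) auto
qed simp

text \<open>
  That two distinct pairs meet at the same time is an event of probability zero, since a planar
  Brownian motion does not hit points. On a grid of mesh \<open>1 / n\<close>, both distances are at most \<open>2 r\<close>
  at \<open>O(n r\<^sup>2)\<close> grid times on average; but from the first time they are at most \<open>r\<close> there are of order
  \<open>n r\<^sup>2 log (1 / r)\<close> such times. So that first time exists with probability \<open>O(1 / log (1 / r))\<close>.
\<close>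

definition near_pairs ::
    "'a measure \<Rightarrow> (nat \<Rightarrow> real \<Rightarrow> 'a \<Rightarrow> real) \<Rightarrow> nat \<Rightarrow> nat \<Rightarrow> nat \<Rightarrow> nat \<Rightarrow> real \<Rightarrow> real \<Rightarrow> 'a set" where
  "near_pairs M W a b c d r s =
    {\<omega>\<in>space M. \<bar>W a s \<omega> - W b s \<omega>\<bar> \<le> r \<and> \<bar>W c s \<omega> - W d s \<omega>\<bar> \<le> r}"

lemma near_pairs_sets:
  assumes "\<And>i. i \<in> {a, b, c, d} \<Longrightarrow> W i s \<in> borel_measurable M"
  shows "near_pairs M W a b c d r s \<in> sets M"
proof -
  have "W a s \<in> borel_measurable M" "W b s \<in> borel_measurable M"
    "W c s \<in> borel_measurable M" "W d s \<in> borel_measurable M" using assms by auto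
  then show ?thesis unfolding near_pairs_def by measurable
qed

text \<open>A single interval from 0 to \<open>s\<close> suffices; the starting points enter as the
  constant shifts in the bound for two differences.\<close>

lemma near_pairs_upper:
  assumes ibm: "independent_brownian_motions M xs W"
    and I: "a < length xs" "b < length xs" "c < length xs" "d < length xs"
    and free: "a \<notin> {b, c, d}" "c \<notin> {a, b, d}" and s: "0 < s" and r: "0 \<le> r"
  shows "measure M (near_pairs M W a b c d r s) \<le> r\<^sup>2 / s"
proof -
  interpret prob_space M using ibm by (rule ibm_prob_space)
  define \<tau> where "\<tau> l = (if l = 0 then 0 else s)" for l :: nat
  let ?I = "{..<length xs} \<times> {..<1::nat}"
  have ind: "indep_vars (\<lambda>_. borel) (\<lambda>p \<omega>. inc W \<tau> p \<omega>) ?I"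
    using s by (intro indep_increments[OF ibm]) (auto simp: \<tau>_def)
  have law: "distr M borel (\<lambda>\<omega>. inc W \<tau> p \<omega>) = normal_law s" if "p \<in> ?I" for p
    using distr_increment[OF ibm_brownian[OF ibm, of "fst p"], of 0 s] that s by (auto simp: \<tau>_def)
  have "prob {\<omega>\<in>space M. \<bar>inc W \<tau> (a, 0) \<omega> - inc W \<tau> (b, 0) \<omega> + (xs ! a - xs ! b)\<bar> \<le> r \<and>
      \<bar>inc W \<tau> (c, 0) \<omega> - inc W \<tau> (d, 0) \<omega> + (xs ! c - xs ! d)\<bar> \<le> r} \<le> r\<^sup>2 / s"
    by (rule two_differences_bounds(1)[OF ind s r law]) (use I free in auto)
  also have "{\<omega>\<in>space M. \<bar>inc W \<tau> (a, 0) \<omega> - inc W \<tau> (b, 0) \<omega> + (xs ! a - xs ! b)\<bar> \<le> r \<and>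
      \<bar>inc W \<tau> (c, 0) \<omega> - inc W \<tau> (d, 0) \<omega> + (xs ! c - xs ! d)\<bar> \<le> r} = near_pairs M W a b c d r s"
    using I ibm_start[OF ibm] by (auto simp: near_pairs_def \<tau>_def)
  finally show ?thesis .
qed

text \<open>The disjointed event says that \<open>s l\<close> is the earliest time of the sequence
  with both distances at most \<open>r\<close>, so it is determined by increments before
  \<open>s l\<close>. That both differences change by at most \<open>r\<close> during the next
  \<open>u\<close> time units is independent of it and has probability at least
  \<open>hit_const * (r\<^sup>2 / u)\<close>; in that case both distances end up at most
  \<open>2 * r\<close>.\<close>

lemma near_pairs_return:
  assumes ibm: "independent_brownian_motions M xs W"
    and I: "a < length xs" "b < length xs" "c < length xs" "d < length xs"
    and free: "a \<notin> {b, c, d}" "c \<notin> {a, b, d}"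
    and s: "0 < s 0" "\<And>l. s l < s (Suc l)" and r: "0 \<le> r" and u: "0 < u" "r\<^sup>2 \<le> u"
  shows "hit_const * (r\<^sup>2 / u) * measure M (disjointed (\<lambda>l. near_pairs M W a b c d r (s l)) l) \<le>
    measure M (disjointed (\<lambda>l. near_pairs M W a b c d r (s l)) l \<inter> near_pairs M W a b c d (2 * r) (s l + u))"
proof -
  interpret prob_space M using ibm by (rule ibm_prob_space)
  let ?N = "length xs"
  have spos: "0 < s l" for l
  proof (induction l)
    case (Suc l)
    then show ?case using s(2)[of l] by linarith
  qed (rule s(1))
  \<comment> \<open>The grid \<open>0, s 0, ..., s l, s l + u\<close>. The leading 0 shifts all
    indices by one, so the interval of length \<open>u\<close> has index
    \<open>Suc l\<close>.\<close>
  define \<tau> where "\<tau> m = (case m of 0 \<Rightarrow> 0 | Suc m' \<Rightarrow> if m' \<le> l then s m' else s l + u)" for m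
  have \<tau>: "\<tau> m < \<tau> (Suc m)" if "m < Suc (Suc l)" for m
  proof (cases m)
    case 0
    then show ?thesis using spos[of 0] by (simp add: \<tau>_def)
  next
    case (Suc m')
    show ?thesis
    proof (cases "m' = l")
      case True
      then show ?thesis using Suc u(1) by (simp add: \<tau>_def)
    next
      case False
      then show ?thesis using Suc that s(2)[of m'] by (simp add: \<tau>_def)
    qed
  qed
  have \<tau>0: "\<tau> 0 = 0" by (simp add: \<tau>_def)
  let ?I = "{..<?N} \<times> {..<Suc (Suc l)}"
  let ?A = "{..<?N} \<times> {..<Suc l}" and ?B = "{..<?N} \<times> {Suc l}"
  let ?X = "\<lambda>p \<omega>. inc W \<tau> p \<omega>"
  have ind: "indep_vars (\<lambda>_. borel) ?X ?I"
    using \<tau> \<tau>0 by (intro indep_increments[OF ibm]) auto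
  have ivAB: "indep_var (\<Pi>\<^sub>M p\<in>?A. borel) (\<lambda>\<omega>. \<lambda>p\<in>?A. ?X p \<omega>) (\<Pi>\<^sub>M p\<in>?B. borel) (\<lambda>\<omega>. \<lambda>p\<in>?B. ?X p \<omega>)"
    by (rule indep_var_restrict[OF ind]) auto
  have indB: "indep_vars (\<lambda>_. borel) ?X ?B" by (rule indep_vars_subset[OF ind]) auto
  have lawB: "distr M borel (\<lambda>\<omega>. ?X p \<omega>) = normal_law u" if "p \<in> ?B" for p
    using distr_increment[OF ibm_brownian[OF ibm, of "fst p"], of "s l" "s l + u"] that u spos[of l]
    by (auto simp: \<tau>_def)
  \<comment> \<open>The position at time \<open>s m\<close>, recovered from the increments over the
    intervals \<open>0, ..., m\<close>.\<close>
  define pos where "pos w i m = xs ! i + (\<Sum>m'\<le>m. w (i, m'))" for w :: "nat \<times> nat \<Rightarrow> real" and i m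
  define near where "near w m \<longleftrightarrow> \<bar>pos w a m - pos w b m\<bar> \<le> r \<and> \<bar>pos w c m - pos w d m\<bar> \<le> r" for w m
  define GA where "GA = {w\<in>space (\<Pi>\<^sub>M p\<in>?A. (borel :: real measure)). near w l \<and> (\<forall>m\<in>{..<l}. \<not> near w m)}"
  define GB where "GB = {w\<in>space (\<Pi>\<^sub>M p\<in>?B. (borel :: real measure)).
    \<bar>w (a, Suc l) - w (b, Suc l)\<bar> \<le> r \<and> \<bar>w (c, Suc l) - w (d, Suc l)\<bar> \<le> r}"
  have posm: "(\<lambda>w. pos w i m) \<in> borel_measurable (\<Pi>\<^sub>M p\<in>?A. (borel :: real measure))" if "i < ?N" "m \<le> l" for i m
    unfolding pos_def
    by (intro borel_measurable_add borel_measurable_const borel_measurable_sum measurable_component_singleton)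
       (use that in auto)
  have nearm: "Measurable.pred (\<Pi>\<^sub>M p\<in>?A. (borel :: real measure)) (\<lambda>w. near w m)" if "m \<le> l" for m
    unfolding near_def using I that
    by (intro pred_intros_logic pred_le_real borel_measurable_abs borel_measurable_diff borel_measurable_const posm)
  have GA: "GA \<in> sets (\<Pi>\<^sub>M p\<in>?A. borel)"
  proof -
    have "Measurable.pred (\<Pi>\<^sub>M p\<in>?A. (borel :: real measure)) (\<lambda>w. \<forall>m\<in>{..<l}. \<not> near w m)"
      by (intro pred_intros_finite pred_intros_logic nearm) auto
    then have "Measurable.pred (\<Pi>\<^sub>M p\<in>?A. (borel :: real measure)) (\<lambda>w. near w l \<and> (\<forall>m\<in>{..<l}. \<not> near w m))"
      by (intro pred_intros_logic nearm) auto
    then show ?thesis unfolding GA_def by (simp add: pred_def)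
  qed
  have GB: "GB \<in> sets (\<Pi>\<^sub>M p\<in>?B. borel)"
  proof -
    have comp: "(\<lambda>w. w (i, Suc l)) \<in> borel_measurable (\<Pi>\<^sub>M p\<in>?B. (borel :: real measure))" if "i < ?N" for i
      using that by (intro measurable_component_singleton) auto
    have "Measurable.pred (\<Pi>\<^sub>M p\<in>?B. (borel :: real measure))
        (\<lambda>w. \<bar>w (a, Suc l) - w (b, Suc l)\<bar> \<le> r \<and> \<bar>w (c, Suc l) - w (d, Suc l)\<bar> \<le> r)"
      by (intro pred_intros_logic pred_le_real borel_measurable_abs borel_measurable_diff borel_measurable_const comp I)
    then show ?thesis unfolding GB_def by (simp add: pred_def)
  qed
  have posW: "pos (\<lambda>p\<in>?A. ?X p \<omega>) i m = W i (s m) \<omega>" if "i < ?N" "m \<le> l" "\<omega> \<in> space M" for i m \<omega>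
  proof -
    have "(\<Sum>m'\<le>m. (\<lambda>p\<in>?A. ?X p \<omega>) (i, m')) = (\<Sum>m'<Suc m. W i (\<tau> (Suc m')) \<omega> - W i (\<tau> m') \<omega>)"
      using that by (intro sum.cong) auto
    also have "\<dots> = W i (\<tau> (Suc m)) \<omega> - W i (\<tau> 0) \<omega>"
      by (rule sum_lessThan_telescope)
    finally show ?thesis using that ibm_start[OF ibm] by (simp add: pos_def \<tau>_def)
  qed
  let ?H = "disjointed (\<lambda>l. near_pairs M W a b c d r (s l)) l"
  have H: "(\<lambda>\<omega>. \<lambda>p\<in>?A. ?X p \<omega>) -` GA \<inter> space M = ?H"
  proof -
    have "near (\<lambda>p\<in>?A. ?X p \<omega>) m \<longleftrightarrow> \<omega> \<in> near_pairs M W a b c d r (s m)" if "\<omega> \<in> space M" "m \<le> l" for \<omega> m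
      using that I by (simp add: near_def near_pairs_def posW)
    then show ?thesis
      by (auto simp: GA_def disjointed_def space_PiM near_pairs_def)
  qed
  have "hit_const * (r\<^sup>2 / u) \<le>
      prob {\<omega>\<in>space M. \<bar>?X (a, Suc l) \<omega> - ?X (b, Suc l) \<omega>\<bar> \<le> r \<and> \<bar>?X (c, Suc l) \<omega> - ?X (d, Suc l) \<omega>\<bar> \<le> r}"
    by (rule two_differences_bounds(2)[OF indB u(1) r lawB])
       (use I free real_le_rsqrt[OF u(2)] in auto)
  also have "{\<omega>\<in>space M. \<bar>?X (a, Suc l) \<omega> - ?X (b, Suc l) \<omega>\<bar> \<le> r \<and> \<bar>?X (c, Suc l) \<omega> - ?X (d, Suc l) \<omega>\<bar> \<le> r} =
      (\<lambda>\<omega>. \<lambda>p\<in>?B. ?X p \<omega>) -` GB \<inter> space M"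
    using I by (auto simp: GB_def space_PiM)
  finally have pB: "hit_const * (r\<^sup>2 / u) \<le> prob ((\<lambda>\<omega>. \<lambda>p\<in>?B. ?X p \<omega>) -` GB \<inter> space M)" .
  have "hit_const * (r\<^sup>2 / u) * prob ?H \<le> prob ?H * prob ((\<lambda>\<omega>. \<lambda>p\<in>?B. ?X p \<omega>) -` GB \<inter> space M)"
    using pB by (subst mult.commute) (intro mult_left_mono, auto)
  also have "\<dots> = prob ((\<lambda>x. (\<lambda>p\<in>?A. ?X p x, \<lambda>p\<in>?B. ?X p x)) -` (GA \<times> GB) \<inter> space M)"
    unfolding H[symmetric] by (rule indep_varD[OF ivAB GA GB, symmetric])
  also have "\<dots> \<le> prob (?H \<inter> near_pairs M W a b c d (2 * r) (s l + u))"
  proof (rule finite_measure_mono)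
    show "?H \<inter> near_pairs M W a b c d (2 * r) (s l + u) \<in> events"
    proof (intro sets.Int)
      show "?H \<in> events" unfolding H[symmetric] by (rule measurable_sets[OF indep_var_rv1[OF ivAB] GA])
      show "near_pairs M W a b c d (2 * r) (s l + u) \<in> events"
        using I u spos[of l] by (intro near_pairs_sets ibm_measurable[OF ibm]) auto
    qed
    show "(\<lambda>x. (\<lambda>p\<in>?A. ?X p x, \<lambda>p\<in>?B. ?X p x)) -` (GA \<times> GB) \<inter> space M \<subseteq>
        ?H \<inter> near_pairs M W a b c d (2 * r) (s l + u)"
    proof
      fix \<omega> assume \<omega>: "\<omega> \<in> (\<lambda>x. (\<lambda>p\<in>?A. ?X p x, \<lambda>p\<in>?B. ?X p x)) -` (GA \<times> GB) \<inter> space M"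
      then have "\<omega> \<in> ?H" unfolding H[symmetric] by blast
      have n: "\<bar>W a (s l) \<omega> - W b (s l) \<omega>\<bar> \<le> r" "\<bar>W c (s l) \<omega> - W d (s l) \<omega>\<bar> \<le> r"
        using \<open>\<omega> \<in> ?H\<close> by (auto simp: disjointed_def near_pairs_def)
      have "\<bar>?X (a, Suc l) \<omega> - ?X (b, Suc l) \<omega>\<bar> \<le> r" "\<bar>?X (c, Suc l) \<omega> - ?X (d, Suc l) \<omega>\<bar> \<le> r"
        using \<omega> I by (auto simp: GB_def)
      then have "\<bar>W a (s l + u) \<omega> - W a (s l) \<omega> - (W b (s l + u) \<omega> - W b (s l) \<omega>)\<bar> \<le> r"
        "\<bar>W c (s l + u) \<omega> - W c (s l) \<omega> - (W d (s l + u) \<omega> - W d (s l) \<omega>)\<bar> \<le> r"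
        by (simp_all add: \<tau>_def)
      with n have "\<bar>W a (s l + u) \<omega> - W b (s l + u) \<omega>\<bar> \<le> 2 * r" "\<bar>W c (s l + u) \<omega> - W d (s l + u) \<omega>\<bar> \<le> 2 * r"
        by linarith+
      then have "\<omega> \<in> near_pairs M W a b c d (2 * r) (s l + u)"
        using \<omega> unfolding near_pairs_def by blast
      with \<open>\<omega> \<in> ?H\<close> show "\<omega> \<in> ?H \<inter> near_pairs M W a b c d (2 * r) (s l + u)" by blast
    qed
  qed
  finally show ?thesis .
qed

text \<open>The expected number of close grid times is estimated from both sides. As
  \<open>r\<^sup>2 = m / n\<close>, the return estimate is available for all lags
  \<open>j / n\<close> with \<open>m < j \<le> n\<close>, and the sum of \<open>1 / j\<close> over
  these is at least \<open>K / 2\<close>. Since \<open>m\<close> does not enter the bound, the mesh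
  can be refined while \<open>r\<close> stays fixed.\<close>

lemma near_pairs_grid_bound:
  assumes ibm: "independent_brownian_motions M xs W"
    and I: "a < length xs" "b < length xs" "c < length xs" "d < length xs"
    and free: "a \<notin> {b, c, d}" "c \<notin> {a, b, d}"
    and \<delta>: "0 < \<delta>" and m: "0 < m" and K: "0 < K"
    and r: "r = sqrt (1 / 2 ^ K)" and n: "n = 2 ^ K * m"
  shows "measure M (\<Union>l<n * B + 1. near_pairs M W a b c d r (\<delta> + real l / real n)) \<le>
    8 * (real B + 2) / (\<delta> * hit_const * real K)"
proof -
  interpret prob_space M using ibm by (rule ibm_prob_space)
  define s where "s l = \<delta> + real l / real n" for l
  have n0: "0 < n" using m n by simp
  have r2: "r\<^sup>2 = 1 / 2 ^ K" "0 < r" by (simp_all add: r)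
  have s: "0 < s 0" "\<And>l. s l < s (Suc l)" using \<delta> n0 by (auto simp: s_def field_simps)
  have spos: "\<delta> \<le> s l" for l by (simp add: s_def)
  define L where "L = n * B + 1"
  define C where "C l = near_pairs M W a b c d (2 * r) (s l)" for l
  define H where "H = disjointed (\<lambda>l. near_pairs M W a b c d r (s l))"
  have evn: "near_pairs M W a b c d r' (s l) \<in> events" for r' l
    using I spos[of l] \<delta> by (intro near_pairs_sets ibm_measurable[OF ibm]) auto
  have C: "C l \<in> events" for l unfolding C_def by (rule evn)
  have H: "H l \<in> events" for l
    unfolding H_def using sets.range_disjointed_sets[of "\<lambda>l. near_pairs M W a b c d r (s l)" M] evn by auto
  have disj: "disjoint_family H" unfolding H_def by (rule disjoint_family_disjointed)
  \<comment> \<open>On \<open>H l\<close>, a lower bound for the expected number of close grid times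
    in the unit of time after the first approach.\<close>
  have lower: "hit_const * r\<^sup>2 * real n * (real K / 2) * prob (H l) \<le> (\<Sum>k<L + n. prob (H l \<inter> C k))"
    if l: "l < L" for l
  proof -
    let ?J = "{m<..n}"
    have "hit_const * r\<^sup>2 * real n * (real K / 2) * prob (H l) \<le>
        hit_const * r\<^sup>2 * real n * (\<Sum>j\<in>?J. 1 / real j) * prob (H l)"
      using dyadic_harmonic_sum[OF m, of K] hit_const_pos unfolding n[symmetric]
      by (intro mult_right_mono mult_left_mono) auto
    also have "\<dots> = (\<Sum>j\<in>?J. hit_const * (r\<^sup>2 / (real j / real n)) * prob (H l))"
      by (simp add: sum_distrib_left sum_distrib_right field_simps)
    also have "\<dots> \<le> (\<Sum>j\<in>?J. prob (H l \<inter> C (l + j)))"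
    proof (rule sum_mono)
      fix j assume j: "j \<in> ?J"
      have eq: "s l + real j / real n = s (l + j)" by (simp add: s_def add_divide_distrib)
      have "r\<^sup>2 = real m / real n" using m by (simp add: r2 n)
      also have "\<dots> \<le> real j / real n" using j by (intro divide_right_mono) auto
      finally have rj: "r\<^sup>2 \<le> real j / real n" .
      have j0: "0 < real j / real n" using j n0 by auto
      show "hit_const * (r\<^sup>2 / (real j / real n)) * prob (H l) \<le> prob (H l \<inter> C (l + j))"
        using near_pairs_return[OF ibm I free s _ j0 rj, of l] r2(2) unfolding H_def C_def eq by simp
    qed
    also have "\<dots> = (\<Sum>k\<in>(\<lambda>j. l + j) ` ?J. prob (H l \<inter> C k))"
      by (subst sum.reindex) (auto simp: inj_on_def)
    also have "\<dots> \<le> (\<Sum>k<L + n. prob (H l \<inter> C k))"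
      using l by (intro sum_mono2) auto
    finally show ?thesis .
  qed
  \<comment> \<open>The \<open>H l\<close> are disjoint, so each grid time is counted at most once;
    \<open>\<delta>\<close> bounds all grid times from below.\<close>
  have upper: "(\<Sum>l<L. prob (H l \<inter> C k)) \<le> 4 * r\<^sup>2 / \<delta>" for k
  proof -
    have "(\<Sum>l<L. prob (H l \<inter> C k)) = prob (\<Union>l<L. H l \<inter> C k)"
      using H C disj by (intro finite_measure_finite_Union[symmetric])
        (auto simp: disjoint_family_on_def, blast)
    also have "\<dots> \<le> prob (C k)" using C by (intro finite_measure_mono) auto
    also have "\<dots> \<le> (2 * r)\<^sup>2 / s k"
      unfolding C_def using spos[of k] \<delta> r2 by (intro near_pairs_upper[OF ibm I free]) auto
    also have "\<dots> \<le> (2 * r)\<^sup>2 / \<delta>"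
      using spos[of k] \<delta> by (intro divide_left_mono) auto
    finally show ?thesis by (simp add: power_mult_distrib)
  qed
  have U: "(\<Union>l<L. near_pairs M W a b c d r (s l)) = (\<Union>l<L. H l)"
    unfolding H_def using finite_UN_disjointed_eq[of "\<lambda>l. near_pairs M W a b c d r (s l)" L]
    by (simp add: atLeast0LessThan)
  have pU: "prob (\<Union>l<L. near_pairs M W a b c d r (s l)) = (\<Sum>l<L. prob (H l))"
    unfolding U using H disj by (intro finite_measure_finite_Union) (auto simp: disjoint_family_on_def)
  have "hit_const * r\<^sup>2 * real n * (real K / 2) * (\<Sum>l<L. prob (H l)) \<le> (\<Sum>l<L. \<Sum>k<L + n. prob (H l \<inter> C k))"
    unfolding sum_distrib_left by (intro sum_mono lower) auto
  also have "\<dots> = (\<Sum>k<L + n. \<Sum>l<L. prob (H l \<inter> C k))" by (rule sum.swap)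
  also have "\<dots> \<le> (\<Sum>k<L + n. 4 * r\<^sup>2 / \<delta>)" by (intro sum_mono upper)
  also have "\<dots> = real (L + n) * (4 * r\<^sup>2 / \<delta>)" by simp
  also have "\<dots> \<le> (real n * (real B + 2)) * (4 * r\<^sup>2 / \<delta>)"
  proof -
    \<comment> \<open>The additional 1 in \<open>L\<close> is absorbed by
      \<open>1 \<le> n\<close>.\<close>
    have "L + n \<le> n * (B + 2)" using n0 by (simp add: L_def)
    then have "real (L + n) \<le> real (n * (B + 2))" by (rule of_nat_mono)
    then show ?thesis using \<delta> by (intro mult_right_mono) (auto simp: algebra_simps)
  qed
  finally have *: "(r\<^sup>2 * real n) * (hit_const * (real K / 2) * (\<Sum>l<L. prob (H l))) \<le>
      (r\<^sup>2 * real n) * ((real B + 2) * (4 / \<delta>))" by (simp add: field_simps)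
  have "0 < r\<^sup>2 * real n" using r2(2) n0 by simp
  with * have "hit_const * (real K / 2) * (\<Sum>l<L. prob (H l)) \<le> (real B + 2) * (4 / \<delta>)"
    by (simp only: mult_le_cancel_left_pos)
  then show ?thesis
    unfolding L_def[symmetric] s_def[symmetric] pU using hit_const_pos K \<delta> by (simp add: field_simps)
qed

text \<open>Simultaneous meetings involve uncountably many times, so they are handled through
  measurable covers instead of the measurability of \<open>Z\<close> itself.\<close>

lemma null_if_small_covers:
  assumes "\<And>e. 0 < e \<Longrightarrow> \<exists>A\<in>sets M. Z \<subseteq> A \<and> emeasure M A \<le> ennreal e"
  shows "\<exists>A\<in>null_sets M. Z \<subseteq> A"
proof -
  have "\<forall>k::nat. \<exists>A\<in>sets M. Z \<subseteq> A \<and> emeasure M A \<le> ennreal (1 / real (Suc k))"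
    by (intro allI assms) simp
  then obtain A where A: "\<And>k. A k \<in> sets M" "\<And>k. Z \<subseteq> A k"
    "\<And>k::nat. emeasure M (A k) \<le> ennreal (1 / real (Suc k))" by metis
  have I: "(\<Inter>k. A k) \<in> sets M" using A(1) by auto
  have "emeasure M (\<Inter>k. A k) \<le> 0"
  proof (rule tendsto_lowerbound)
    show "(\<lambda>k. ennreal (1 / real (Suc k))) \<longlonglongrightarrow> 0"
      using tendsto_ennrealI[OF LIMSEQ_inverse_real_of_nat] by (simp add: inverse_eq_divide)
    show "\<forall>\<^sub>F k in sequentially. emeasure M (\<Inter>k. A k) \<le> ennreal (1 / real (Suc k))"
      using A by (intro always_eventually allI order_trans[OF emeasure_mono A(3)]) auto
  qed simp
  then have "(\<Inter>k. A k) \<in> null_sets M" using I by (auto simp: null_sets_def)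
  then show ?thesis using A(2) by blast
qed

text \<open>\<open>K\<close>, and with it \<open>r\<close>, is chosen so that the grid bound is at
  most \<open>e\<close> for every mesh. By continuity, an outcome with a simultaneous meeting has
  both distances at most \<open>r\<close> at some time of every sufficiently fine grid; it lies in
  the lower limit of the events \<open>U m\<close>, whose probability is at most
  \<open>e\<close>.\<close>

lemma simultaneous_meeting_null:
  assumes ibm: "independent_brownian_motions M xs W"
    and I: "a < length xs" "b < length xs" "c < length xs" "d < length xs"
    and free: "a \<notin> {b, c, d}" "c \<notin> {a, b, d}" and \<delta>: "0 < \<delta>"
  shows "\<exists>A\<in>null_sets M. {\<omega>\<in>space M. \<exists>s\<in>{\<delta>..\<delta> + real B}. W a s \<omega> = W b s \<omega> \<and> W c s \<omega> = W d s \<omega>} \<subseteq> A"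
    (is "\<exists>A\<in>_. ?Z \<subseteq> A")
proof (rule null_if_small_covers)
  interpret prob_space M using ibm by (rule ibm_prob_space)
  fix e :: real assume e: "0 < e"
  define Q where "Q = 8 * (real B + 2) / (\<delta> * hit_const)"
  obtain K :: nat where K: "Q / e < real K" using reals_Archimedean2 by blast
  have "0 \<le> Q / e" using e \<delta> hit_const_pos by (simp add: Q_def)
  then have K0: "0 < K" using K by (cases K) auto
  have bound: "8 * (real B + 2) / (\<delta> * hit_const * real K) \<le> e"
  proof -
    have "Q / real K \<le> e" using K K0 e by (simp add: field_simps)
    then show ?thesis by (simp add: Q_def)
  qed
  define r where "r = sqrt (1 / 2 ^ K)"
  have r: "0 < r" by (simp add: r_def)
  define n where "n m = 2 ^ K * Suc m" for m
  define U where "U m = (\<Union>l<n m * B + 1. near_pairs M W a b c d r (\<delta> + real l / real (n m)))" for m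
  have Um: "U m \<in> events" for m
    unfolding U_def using I \<delta> by (intro sets.finite_UN near_pairs_sets ibm_measurable[OF ibm]) auto
  have pU: "prob (U m) \<le> e" for m
    unfolding U_def using near_pairs_grid_bound[OF ibm I free \<delta> _ K0 r_def n_def, of m B] bound by simp
  \<comment> \<open>The union of the increasing sets \<open>V k\<close> is the lower limit of the
    \<open>U m\<close>.\<close>
  define V where "V k = (\<Inter>m\<in>{k..}. U m)" for k
  have Vm: "V k \<in> events" for k unfolding V_def using Um by (intro sets.countable_INT) auto
  have "incseq V" unfolding V_def by (auto simp: incseq_def)
  then have "(\<lambda>k. emeasure M (V k)) \<longlonglongrightarrow> emeasure M (\<Union>k. V k)"
    using Vm by (intro Lim_emeasure_incseq) auto
  moreover have "emeasure M (V k) \<le> ennreal e" for k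
  proof -
    have "emeasure M (V k) \<le> emeasure M (U k)" using Um by (intro emeasure_mono) (auto simp: V_def)
    then show ?thesis using pU[of k] by (auto simp: emeasure_eq_measure intro: order_trans ennreal_leI)
  qed
  ultimately have le: "emeasure M (\<Union>k. V k) \<le> ennreal e"
    by (intro LIMSEQ_le_const2) auto
  have "?Z \<subseteq> (\<Union>k. V k)"
  proof
    fix \<omega> assume "\<omega> \<in> ?Z"
    then obtain s where \<omega>: "\<omega> \<in> space M" and s: "\<delta> \<le> s" "s \<le> \<delta> + real B"
      and eq: "W a s \<omega> = W b s \<omega>" "W c s \<omega> = W d s \<omega>" by auto
    have cont: "continuous_on {0..} (\<lambda>s. W i s \<omega> - W j s \<omega>)" if "i < length xs" "j < length xs" for i j
      using that \<omega> by (intro continuous_on_diff ibm_continuous[OF ibm])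
    have "\<exists>h>0. \<forall>u\<in>{0..}. dist u s < h \<longrightarrow> dist (W i u \<omega> - W j u \<omega>) (W i s \<omega> - W j s \<omega>) \<le> r"
      if "i < length xs" "j < length xs" for i j
      using cont[OF that] r s \<delta> unfolding continuous_on_iff by (force intro: less_imp_le)
    from this[OF I(1,2)] this[OF I(3,4)] obtain h1 h2 where h: "0 < h1" "0 < h2"
      "\<And>u. 0 \<le> u \<Longrightarrow> dist u s < h1 \<Longrightarrow> \<bar>W a u \<omega> - W b u \<omega>\<bar> \<le> r"
      "\<And>u. 0 \<le> u \<Longrightarrow> dist u s < h2 \<Longrightarrow> \<bar>W c u \<omega> - W d u \<omega>\<bar> \<le> r"
      using eq by (auto simp: dist_real_def)
    obtain k :: nat where k: "1 / min h1 h2 < real k" using reals_Archimedean2 by blast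
    have "\<omega> \<in> U m" if "k \<le> m" for m
    proof -
      have "0 < n m" unfolding n_def by simp
      then have n0: "0 < real (n m)" by (rule of_nat_0_less_iff[THEN iffD2])
      have "1 / min h1 h2 < real (n m)"
      proof -
        have "m \<le> 2 ^ K * Suc m"
          using mult_le_mono[of 1 "2 ^ K" m "Suc m"] by simp
        then have "real k \<le> real (n m)" using that by (simp only: n_def of_nat_le_iff)
        then show ?thesis using k by simp
      qed
      moreover have "0 < min h1 h2" using h(1,2) by simp
      ultimately have inv: "1 / real (n m) < min h1 h2"
        using n0 by (simp only: pos_divide_less_eq mult.commute)
      \<comment> \<open>Index of the last grid time not after \<open>s\<close>; it is less than one
        mesh width away from \<open>s\<close>.\<close>
      define l where "l = nat \<lfloor>(s - \<delta>) * real (n m)\<rfloor>"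
      have fl: "real l = of_int \<lfloor>(s - \<delta>) * real (n m)\<rfloor>" using s n0 by (simp add: l_def)
      have l1: "real l \<le> (s - \<delta>) * real (n m)" "(s - \<delta>) * real (n m) < real l + 1"
        unfolding fl by linarith+
      have "(s - \<delta>) * real (n m) \<le> real B * real (n m)" using s n0 by (intro mult_right_mono) auto
      then have "real l \<le> real (n m * B)" using l1 by (simp add: mult.commute)
      then have lB: "l < n m * B + 1" by (simp only: of_nat_le_iff)
      define u where "u = \<delta> + real l / real (n m)"
      have "u \<le> s" "s < u + 1 / real (n m)"
        using l1 n0 by (simp_all add: u_def field_simps)
      then have "dist u s < min h1 h2" using inv by (simp add: dist_real_def)
      moreover have "0 \<le> u" using \<delta> by (simp add: u_def)
      ultimately have "\<omega> \<in> near_pairs M W a b c d r u"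
        using h \<omega> by (simp add: near_pairs_def)
      then show ?thesis unfolding U_def u_def using lB by blast
    qed
    then show "\<omega> \<in> (\<Union>k. V k)" by (auto simp: V_def)
  qed
  moreover have "(\<Union>k. V k) \<in> events" using Vm by auto
  ultimately show "\<exists>A\<in>events. ?Z \<subseteq> A \<and> emeasure M A \<le> ennreal e" using le by blast
qed

text \<open>At time 0 the positions are distinct. Positive times are covered by countably many
  compact intervals bounded away from 0, as the grid bound degenerates when \<open>\<delta>\<close>
  tends to 0.\<close>

lemma AE_no_simultaneous_meeting_free:
  assumes ibm: "independent_brownian_motions M xs W" and dist: "distinct xs"
    and I: "a < length xs" "b < length xs" "c < length xs" "d < length xs"
    and free: "a \<notin> {b, c, d}" "c \<notin> {a, b, d}"
  shows "AE \<omega> in M. \<forall>s\<ge>0. \<not> (W a s \<omega> = W b s \<omega> \<and> W c s \<omega> = W d s \<omega>)"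
proof -
  have "AE \<omega> in M. \<forall>k B. \<forall>s\<in>{1 / real (Suc k)..1 / real (Suc k) + real B}.
      \<not> (W a s \<omega> = W b s \<omega> \<and> W c s \<omega> = W d s \<omega>)"
  proof (simp only: AE_all_countable, intro allI)
    fix k B
    obtain A where "A \<in> null_sets M" "{\<omega>\<in>space M. \<exists>s\<in>{1 / real (Suc k)..1 / real (Suc k) + real B}.
        W a s \<omega> = W b s \<omega> \<and> W c s \<omega> = W d s \<omega>} \<subseteq> A"
      using simultaneous_meeting_null[OF ibm I free, of "1 / real (Suc k)" B] by auto
    then show "AE \<omega> in M. \<forall>s\<in>{1 / real (Suc k)..1 / real (Suc k) + real B}.
        \<not> (W a s \<omega> = W b s \<omega> \<and> W c s \<omega> = W d s \<omega>)"
      by (intro AE_I'[of A]) auto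
  qed
  then show ?thesis
    using AE_space
  proof eventually_elim
    case (elim \<omega>)
    show ?case
    proof (intro allI impI notI)
      fix s :: real assume s: "0 \<le> s" and eq: "W a s \<omega> = W b s \<omega> \<and> W c s \<omega> = W d s \<omega>"
      show False
      proof (cases "s = 0")
        case True
        then have "xs ! a = xs ! b" using eq ibm_start[OF ibm] I elim(2) by metis
        then show False using dist I free by (simp add: nth_eq_iff_index_eq)
      next
        case False
        then obtain k where k: "inverse (real (Suc k)) < s" using s reals_Archimedean[of s] by auto
        obtain B :: nat where "s < real B" using reals_Archimedean2 by blast
        then have "s \<in> {1 / real (Suc k)..1 / real (Suc k) + real B}"
          using k by (auto simp: inverse_eq_divide intro: add_increasing)
        then show False using elim(1) eq by blast
      qed
    qed
  qed
qed

text \<open>Two different pairs can be ordered so that the leading element of each is absent from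
  the other, which is the freeness used in the Gaussian estimates; the remaining two elements may
  coincide.\<close>

lemma AE_no_simultaneous_meeting:
  assumes ibm: "independent_brownian_motions M xs W" and dist: "distinct xs"
  shows "AE \<omega> in M. \<forall>a<length xs. \<forall>b<length xs. \<forall>c<length xs. \<forall>d<length xs. \<forall>s\<ge>0.
    a \<noteq> b \<longrightarrow> c \<noteq> d \<longrightarrow> W a s \<omega> = W b s \<omega> \<longrightarrow> W c s \<omega> = W d s \<omega> \<longrightarrow> {a, b} = {c, d}"
proof -
  have "AE \<omega> in M. \<forall>a b c d. a < length xs \<longrightarrow> b < length xs \<longrightarrow> c < length xs \<longrightarrow> d < length xs \<longrightarrow>
      a \<notin> {b, c, d} \<longrightarrow> c \<notin> {a, b, d} \<longrightarrow> (\<forall>s\<ge>0. \<not> (W a s \<omega> = W b s \<omega> \<and> W c s \<omega> = W d s \<omega>))"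
    unfolding AE_all_countable
  proof (intro allI)
    fix a b c d
    show "AE \<omega> in M. a < length xs \<longrightarrow> b < length xs \<longrightarrow> c < length xs \<longrightarrow> d < length xs \<longrightarrow>
      a \<notin> {b, c, d} \<longrightarrow> c \<notin> {a, b, d} \<longrightarrow> (\<forall>s\<ge>0. \<not> (W a s \<omega> = W b s \<omega> \<and> W c s \<omega> = W d s \<omega>))"
      using AE_no_simultaneous_meeting_free[OF ibm dist, of a b c d]
      by (cases "a < length xs \<and> b < length xs \<and> c < length xs \<and> d < length xs \<and> a \<notin> {b, c, d} \<and> c \<notin> {a, b, d}") auto
  qed
  then show ?thesis
  proof eventually_elim
    case (elim \<omega>)
    show ?case
    proof (intro allI impI)
      fix a b c d and s :: real
      assume I: "a < length xs" "b < length xs" "c < length xs" "d < length xs" and s: "0 \<le> s"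
        and ne: "a \<noteq> b" "c \<noteq> d" and eq: "W a s \<omega> = W b s \<omega>" "W c s \<omega> = W d s \<omega>"
      show "{a, b} = {c, d}"
      proof (rule ccontr)
        assume neq: "{a, b} \<noteq> {c, d}"
        obtain a' b' where 1: "{a', b'} = {a, b}" "a' \<noteq> b'" "a' \<notin> {c, d}"
        proof (cases "a \<in> {c, d}")
          case True
          then have "b \<notin> {c, d}" using neq ne by auto
          then show thesis using that[of b a] ne by auto
        qed (use that[of a b] ne in auto)
        obtain c' d' where 2: "{c', d'} = {c, d}" "c' \<noteq> d'" "c' \<notin> {a, b}"
        proof (cases "c \<in> {a, b}")
          case True
          then have "d \<notin> {a, b}" using neq ne by auto
          then show thesis using that[of d c] ne by auto
        qed (use that[of c d] ne in auto)
        have lt: "a' < length xs" "b' < length xs" "c' < length xs" "d' < length xs"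
          and eqs: "W a' s \<omega> = W b' s \<omega>" "W c' s \<omega> = W d' s \<omega>"
          using I eq 1(1) 2(1) by (auto simp: doubleton_eq_iff)
        have "a' \<notin> {c', d'}" "c' \<notin> {a', b'}" using 1(3) 2(3) unfolding 1(1) 2(1) by blast+
        then have "a' \<notin> {b', c', d'}" "c' \<notin> {a', b', d'}" using 1(2) 2(2) by auto
        with elim lt s eqs show False by blast
      qed
    qed
  qed
qed

section \<open>Signed sums over matchings\<close>

text \<open>A permutation stands for the matching with blocks
  \<open>{p (2 * k), p (2 * k + 1)}\<close>, together with an order of the blocks and an orientation
  of each.\<close>

definition matching_perms :: "nat \<Rightarrow> nat set set \<Rightarrow> (nat \<Rightarrow> nat) set" where
  "matching_perms n H =
    {p. p permutes {..<2 * n} \<and> (\<forall>h\<in>H. \<exists>k<n. {p (2 * k), p (2 * k + 1)} = h)}"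

definition pf_term :: "nat \<Rightarrow> (nat \<Rightarrow> nat \<Rightarrow> real) \<Rightarrow> (nat \<Rightarrow> nat) \<Rightarrow> real" where
  "pf_term n f p = of_int (sign p) * (\<Prod>k<n. skew_matrix f (p (2 * k)) (p (2 * k + 1)))"

text \<open>As in the definition of the Pfaffian, every matching is counted \<open>2 ^ n * fact n\<close> times; \<open>H\<close> is a
  set of prescribed pairs.\<close>

definition pf_sum :: "nat \<Rightarrow> nat set set \<Rightarrow> (nat \<Rightarrow> nat \<Rightarrow> real) \<Rightarrow> real" where
  "pf_sum n H f = (\<Sum>p\<in>matching_perms n H. pf_term n f p)"

lemma pfaffian_eq_pf_sum: "pfaffian n (skew_matrix f) = pf_sum n {} f / (2 ^ n * fact n)"
  by (simp add: pfaffian_def pf_sum_def matching_perms_def pf_term_def)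

lemma finite_matching_perms: "finite (matching_perms n H)"
  by (rule finite_subset[OF _ finite_permutations[of "{..<2 * n}"]]) (auto simp: matching_perms_def)

lemma matching_perms_insert: "matching_perms n (insert h H) \<subseteq> matching_perms n H"
  by (auto simp: matching_perms_def)

section \<open>Cancellation of matchings under a transposition\<close>

lemma perm_block_unique:
  assumes p: "p permutes S" and x: "x \<in> {p (2 * k), p (2 * k + 1)}" "x \<in> {p (2 * l), p (2 * l + 1)}"
  shows "k = (l :: nat)"
proof -
  obtain i where i: "i = 2 * k \<or> i = 2 * k + 1" "p i = x" using x(1) by auto
  obtain j where j: "j = 2 * l \<or> j = 2 * l + 1" "p j = x" using x(2) by auto
  have "i = j" using permutes_inj[OF p] i(2) j(2) by (auto dest: injD)
  then show ?thesis using i(1) j(1) by presburger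
qed

lemma matching_perms_block:
  assumes p: "p \<in> matching_perms n H" and k: "k < n"
    and x: "x \<in> {p (2 * k), p (2 * k + 1)}" "x \<in> h" and h: "h \<in> H"
  shows "{p (2 * k), p (2 * k + 1)} = h"
proof -
  obtain l where l: "l < n" "{p (2 * l), p (2 * l + 1)} = h"
    using p h by (auto simp: matching_perms_def)
  then have "k = l" using perm_block_unique[of p "{..<2 * n}" x k l] p x by (auto simp: matching_perms_def)
  then show ?thesis using l by simp
qed

text \<open>Composition with the transposition of \<open>a\<close> and \<open>b\<close> is an
  involution on the matchings that contain \<open>H\<close> but not \<open>{a, b}\<close>, and it
  reverses the sign of the permutation. No index strictly between \<open>a\<close> and
  \<open>b\<close> lies outside \<open>\<Union>H\<close>, so the order within every other free pair
  is kept and the skew entries add no further sign.\<close>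

lemma pf_swap_cancel:
  assumes a: "a < b" "b < 2 * n" "a \<notin> \<Union>H" "b \<notin> \<Union>H"
    and adj: "\<And>c. a < c \<Longrightarrow> c < b \<Longrightarrow> c \<in> \<Union>H"
    and sym: "\<And>i j. f i j = f j i" "\<And>i j. f' i j = f' j i"
    and f: "\<And>i j. i < 2 * n \<Longrightarrow> j < 2 * n \<Longrightarrow> i \<noteq> j \<Longrightarrow> i \<notin> \<Union>H \<Longrightarrow> j \<notin> \<Union>H \<Longrightarrow> {i, j} \<noteq> {a, b} \<Longrightarrow>
        f' i j = f (Transposition.transpose a b i) (Transposition.transpose a b j)"
    and fH: "\<And>i j. {i, j} \<in> H \<Longrightarrow> f' i j = f i j"
  shows "(\<Sum>p\<in>matching_perms n H - matching_perms n (insert {a, b} H). pf_term n f' p) =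
    - (\<Sum>p\<in>matching_perms n H - matching_perms n (insert {a, b} H). pf_term n f p)"
proof -
  let ?\<sigma> = "Transposition.transpose a b"
  let ?D = "matching_perms n H - matching_perms n (insert {a, b} H)"
  have \<sigma>p: "?\<sigma> permutes {..<2 * n}" using a by (intro permutes_swap_id) auto
  have im: "?\<sigma> ` {x, y} = {a, b} \<longleftrightarrow> {x, y} = {a, b}" for x y
    by (auto simp: Transposition.transpose_def doubleton_eq_iff)
  have fix_H: "?\<sigma> x = x" if "x \<in> \<Union>H" for x
    using that a(3,4) by (auto simp: Transposition.transpose_def)
  have inD: "?\<sigma> \<circ> p \<in> ?D" if p: "p \<in> ?D" for p
  proof -
    have pp: "p permutes {..<2 * n}" using p by (auto simp: matching_perms_def)
    have "\<exists>k<n. {(?\<sigma> \<circ> p) (2 * k), (?\<sigma> \<circ> p) (2 * k + 1)} = h" if h: "h \<in> H" for h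
    proof -
      obtain k where k: "k < n" "{p (2 * k), p (2 * k + 1)} = h"
        using p h by (auto simp: matching_perms_def)
      then have "p (2 * k) \<in> \<Union>H" "p (2 * k + 1) \<in> \<Union>H" using h by auto
      then have "{(?\<sigma> \<circ> p) (2 * k), (?\<sigma> \<circ> p) (2 * k + 1)} = h"
        using fix_H[of "p (2 * k)"] fix_H[of "p (2 * k + 1)"] k(2) by simp
      then show ?thesis using k(1) by blast
    qed
    moreover have "{(?\<sigma> \<circ> p) (2 * k), (?\<sigma> \<circ> p) (2 * k + 1)} \<noteq> {a, b}" if "k < n" for k
    proof -
      have "{p (2 * k), p (2 * k + 1)} \<noteq> {a, b}" using p that by (auto simp: matching_perms_def)
      then show ?thesis using im[of "p (2 * k)" "p (2 * k + 1)"] by simp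
    qed
    ultimately show ?thesis using permutes_compose[OF pp \<sigma>p] by (auto simp: matching_perms_def)
  qed
  have term_eq: "pf_term n f' p = - pf_term n f (?\<sigma> \<circ> p)" if p: "p \<in> ?D" for p
  proof -
    have pp: "p permutes {..<2 * n}" using p by (auto simp: matching_perms_def)
    have sg: "sign (?\<sigma> \<circ> p) = - sign p"
    proof -
      have "permutation p" using pp by (metis finite_lessThan permutation_permutes)
      then show ?thesis using a by (simp add: sign_compose permutation_swap_id sign_swap_id)
    qed
    have "skew_matrix f' (p (2 * k)) (p (2 * k + 1)) = skew_matrix f (?\<sigma> (p (2 * k))) (?\<sigma> (p (2 * k + 1)))"
      if k: "k < n" for k
    proof -
      define i j where "i = p (2 * k)" and "j = p (2 * k + 1)"
      have ij: "i \<noteq> j" unfolding i_def j_def using permutes_inj[OF pp] by (simp add: inj_eq)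
      have lt: "i < 2 * n" "j < 2 * n"
        unfolding i_def j_def using permutes_in_image[OF pp] k by auto
      have "skew_matrix f' i j = skew_matrix f (?\<sigma> i) (?\<sigma> j)"
      proof (cases "{i, j} \<in> H")
        case True
        then have "i \<in> \<Union>H" "j \<in> \<Union>H" by auto
        then show ?thesis using fix_H fH[OF True] fH[of j i] True by (simp add: skew_matrix_def insert_commute)
      next
        case False
        have notH: "x \<notin> \<Union>H" if x: "x \<in> {i, j}" for x
        proof
          assume "x \<in> \<Union>H"
          then obtain h where "h \<in> H" "x \<in> h" by blast
          then have "{i, j} = h"
            using matching_perms_block[of p n H k x h] p k x by (simp add: i_def j_def)
          then show False using False \<open>h \<in> H\<close> by simp
        qed
        have ne: "{i, j} \<noteq> {a, b}" using p k by (auto simp: matching_perms_def i_def j_def)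
        have between: "\<not> (a < x \<and> x < b)" if "x \<in> {i, j}" for x
          using adj notH[OF that] by blast
        \<comment> \<open>Among the free indices \<open>a\<close> and \<open>b\<close> are
          neighbours, so only the pair \<open>{a, b}\<close> itself would be reordered.\<close>
        have ord: "?\<sigma> i < ?\<sigma> j \<longleftrightarrow> i < j" "?\<sigma> j < ?\<sigma> i \<longleftrightarrow> j < i"
          using ij ne a(1) between[of i] between[of j]
          by (auto simp: Transposition.transpose_def doubleton_eq_iff)
        have "f' i j = f (?\<sigma> i) (?\<sigma> j)" "f' j i = f (?\<sigma> j) (?\<sigma> i)"
          using f[of i j] f[of j i] lt ij ne notH by (auto simp: insert_commute)
        then show ?thesis unfolding skew_matrix_def ord by simp
      qed
      then show ?thesis by (simp add: i_def j_def)
    qed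
    then show ?thesis by (simp add: pf_term_def sg)
  qed
  have "(\<Sum>p\<in>?D. pf_term n f' p) = (\<Sum>p\<in>?D. - pf_term n f (?\<sigma> \<circ> p))"
    using term_eq by (rule sum.cong[OF refl])
  also have "\<dots> = (\<Sum>p\<in>?D. - pf_term n f p)"
    by (rule sum.reindex_bij_witness[where i="\<lambda>p. ?\<sigma> \<circ> p" and j="\<lambda>p. ?\<sigma> \<circ> p"])
       (use inD in \<open>auto simp: comp_def simp del: Diff_iff\<close>)
  finally show ?thesis by (simp add: sum_negf)
qed

text \<open>For constant entries the sum over the matchings without the pair \<open>{a, b}\<close>
  equals its own negative.\<close>

lemma pf_sum_insert_one:
  assumes "a < b" "b < 2 * n" "a \<notin> \<Union>H" "b \<notin> \<Union>H"
    and "\<And>c. a < c \<Longrightarrow> c < b \<Longrightarrow> c \<in> \<Union>H"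
  shows "pf_sum n (insert {a, b} H) (\<lambda>_ _. 1) = pf_sum n H (\<lambda>_ _. 1)"
proof -
  have "(\<Sum>p\<in>matching_perms n H - matching_perms n (insert {a, b} H). pf_term n (\<lambda>_ _. 1) p) = 0"
    using pf_swap_cancel[OF assms, where f="\<lambda>_ _. 1" and f'="\<lambda>_ _. 1"] by simp
  then show ?thesis
    unfolding pf_sum_def using sum.subset_diff[OF matching_perms_insert[of n "{a, b}" H] finite_matching_perms,
      of "pf_term n (\<lambda>_ _. 1)"] by linarith
qed

text \<open>Reversing the orientation of block \<open>k\<close> changes both the sign of the
  permutation and the sign of one skew entry.\<close>

lemma pf_term_compose_flip:
  assumes k: "k < n" and p: "p permutes {..<2 * n}"
  shows "pf_term n f (p \<circ> Transposition.transpose (2 * k) (2 * k + 1)) = pf_term n f p"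
proof -
  have sk: "skew_matrix f i j = - skew_matrix f j i" for i j by (simp add: skew_matrix_def)
  have "permutation p" using p by (metis finite_lessThan permutation_permutes)
  then have sg: "sign (p \<circ> Transposition.transpose (2 * k) (2 * k + 1)) = - sign p"
    by (simp add: sign_compose permutation_swap_id sign_swap_id)
  have "(\<Prod>l<n. skew_matrix f ((p \<circ> Transposition.transpose (2 * k) (2 * k + 1)) (2 * l)) ((p \<circ> Transposition.transpose (2 * k) (2 * k + 1)) (2 * l + 1))) =
      (\<Prod>l<n. (if l = k then - 1 else 1) * skew_matrix f (p (2 * l)) (p (2 * l + 1)))"
  proof (rule prod.cong[OF refl])
    fix l
    show "skew_matrix f ((p \<circ> Transposition.transpose (2 * k) (2 * k + 1)) (2 * l)) ((p \<circ> Transposition.transpose (2 * k) (2 * k + 1)) (2 * l + 1)) =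
      (if l = k then - 1 else 1) * skew_matrix f (p (2 * l)) (p (2 * l + 1))"
    proof (cases "l = k")
      case True
      then show ?thesis using sk[of "p (2 * k + 1)" "p (2 * k)"] by simp
    next
      case False
      then have "2 * l \<noteq> 2 * k" "2 * l \<noteq> 2 * k + 1" "2 * l + 1 \<noteq> 2 * k" "2 * l + 1 \<noteq> 2 * k + 1" by presburger+
      then show ?thesis using False by (simp add: transpose_def)
    qed
  qed
  also have "\<dots> = - (\<Prod>l<n. skew_matrix f (p (2 * l)) (p (2 * l + 1)))"
    using k by (simp add: prod.distrib)
  finally have eq: "(\<Prod>l<n. skew_matrix f ((p \<circ> Transposition.transpose (2 * k) (2 * k + 1)) (2 * l))
        ((p \<circ> Transposition.transpose (2 * k) (2 * k + 1)) (2 * l + 1))) =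
      - (\<Prod>l<n. skew_matrix f (p (2 * l)) (p (2 * l + 1)))" .
  show ?thesis unfolding pf_term_def sg eq by simp
qed

text \<open>Exchanges the blocks \<open>k\<close> and \<open>l\<close> and keeps their orientations.
  As a product of two transpositions it is even, so no sign arises.\<close>

definition block_swap :: "nat \<Rightarrow> nat \<Rightarrow> nat \<Rightarrow> nat" where
  "block_swap k l = Transposition.transpose (2 * k) (2 * l) \<circ> Transposition.transpose (2 * k + 1) (2 * l + 1)"

lemma block_swap_even [simp]: "block_swap k l (2 * m) = 2 * Transposition.transpose k l m"
  and block_swap_odd [simp]: "block_swap k l (Suc (2 * m)) = Suc (2 * Transposition.transpose k l m)"
proof -
  have "2 * m \<noteq> 2 * k + 1" "2 * m \<noteq> 2 * l + 1" "Suc (2 * m) \<noteq> 2 * k" "Suc (2 * m) \<noteq> 2 * l" for m by presburger+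
  then show "block_swap k l (2 * m) = 2 * Transposition.transpose k l m" "block_swap k l (Suc (2 * m)) = Suc (2 * Transposition.transpose k l m)"
    unfolding block_swap_def by (auto simp: Transposition.transpose_def)
qed

lemma block_swap_permutes: "k < n \<Longrightarrow> l < n \<Longrightarrow> block_swap k l permutes {..<2 * n}"
  unfolding block_swap_def by (intro permutes_compose permutes_swap_id) auto

lemma block_swap_involution: "block_swap k l \<circ> block_swap k l = id"
proof
  fix x
  obtain m where "x = 2 * m \<or> x = Suc (2 * m)" by (metis Suc_eq_plus1 oddE evenE)
  then show "(block_swap k l \<circ> block_swap k l) x = id x" by auto
qed

lemma pf_term_compose_block_swap:
  assumes k: "k < n" "l < n" and p: "p permutes {..<2 * n}"
  shows "pf_term n f (p \<circ> block_swap k l) = pf_term n f p"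
proof -
  have "permutation p" using p by (metis finite_lessThan permutation_permutes)
  moreover have "sign (block_swap k l) = 1"
    unfolding block_swap_def by (simp add: sign_compose permutation_swap_id sign_swap_id)
  moreover have "permutation (block_swap k l)"
    using block_swap_permutes[OF k] by (metis finite_lessThan permutation_permutes)
  ultimately have sg: "sign (p \<circ> block_swap k l) = sign p" by (simp add: sign_compose)
  have "(\<Prod>m<n. skew_matrix f ((p \<circ> block_swap k l) (2 * m)) ((p \<circ> block_swap k l) (2 * m + 1))) =
      (\<Prod>m<n. skew_matrix f (p (2 * m)) (p (2 * m + 1)))"
    by (rule prod.reindex_bij_witness[where i="Transposition.transpose k l" and j="Transposition.transpose k l"])
       (use k in \<open>auto simp: Transposition.transpose_def\<close>)
  then show ?thesis by (simp add: pf_term_def sg)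
qed

text \<open>Prescribing the last pair does not change the sum; its position among the \<open>n + 1\<close> blocks and its
  orientation account for the factor \<open>2 (n + 1)\<close>.\<close>

lemma pf_sum_one: "pf_sum n {} (\<lambda>_ _. 1) = 2 ^ n * fact n"
proof (induction n)
  case 0
  then show ?case by (simp add: pf_sum_def matching_perms_def pf_term_def sign_id)
next
  case (Suc n)
  let ?one = "\<lambda>_ _. 1 :: real"
  let ?n = "Suc n"
  define T where "T k = {p. p permutes {..<2 * ?n} \<and> {p (2 * k), p (2 * k + 1)} = {2 * n, 2 * n + 1}}" for k
  define P where "P = {p. p permutes {..<2 * n}}"
  have finT: "finite (T k)" for k
    by (rule finite_subset[OF _ finite_permutations[of "{..<2 * ?n}"]]) (auto simp: T_def)
  \<comment> \<open>No index lies strictly between \<open>2 * n\<close> and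
    \<open>2 * n + 1\<close>, so this pair may be prescribed.\<close>
  have "pf_sum ?n {} ?one = pf_sum ?n {{2 * n, 2 * n + 1}} ?one"
    by (rule pf_sum_insert_one[symmetric]) auto
  also have "matching_perms ?n {{2 * n, 2 * n + 1}} = (\<Union>k\<in>{..<?n}. T k)"
    by (auto simp: matching_perms_def T_def)
  then have "pf_sum ?n {{2 * n, 2 * n + 1}} ?one = (\<Sum>k<?n. \<Sum>p\<in>T k. pf_term ?n ?one p)"
    unfolding pf_sum_def
  proof (simp only:, intro sum.UNION_disjoint)
    show "\<forall>k\<in>{..<?n}. \<forall>l\<in>{..<?n}. k \<noteq> l \<longrightarrow> T k \<inter> T l = {}"
    proof (intro ballI impI)
      fix k l :: nat assume "k \<noteq> l"
      show "T k \<inter> T l = {}"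
      proof (rule ccontr)
        assume "T k \<inter> T l \<noteq> {}"
        then obtain p where "p \<in> T k" "p \<in> T l" by blast
        then have "p permutes {..<2 * ?n}" "2 * n \<in> {p (2 * k), p (2 * k + 1)}" "2 * n \<in> {p (2 * l), p (2 * l + 1)}"
          unfolding T_def by auto
        then show False using perm_block_unique \<open>k \<noteq> l\<close> by blast
      qed
    qed
  qed (use finT in auto)
  \<comment> \<open>Exchanging the blocks \<open>k\<close> and \<open>n\<close> moves the prescribed
    pair to the last block.\<close>
  also have "\<dots> = (\<Sum>k<?n. \<Sum>p\<in>T n. pf_term ?n ?one p)"
  proof (rule sum.cong[OF refl])
    fix k assume "k \<in> {..<?n}"
    then have k: "k < ?n" "n < ?n" by auto
    have perm: "p \<circ> block_swap k n permutes {..<2 * ?n}" if "p permutes {..<2 * ?n}" for p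
      by (rule permutes_compose[OF block_swap_permutes[OF k] that])
    have inv: "(p \<circ> block_swap k n) \<circ> block_swap k n = p" for p :: "nat \<Rightarrow> nat"
      using block_swap_involution[of k n] by (simp add: comp_assoc)
    show "(\<Sum>p\<in>T k. pf_term ?n ?one p) = (\<Sum>p\<in>T n. pf_term ?n ?one p)"
    proof (rule sum.reindex_bij_witness[where i="\<lambda>p. p \<circ> block_swap k n" and j="\<lambda>p. p \<circ> block_swap k n"])
      show "p \<circ> block_swap k n \<circ> block_swap k n = p" for p :: "nat \<Rightarrow> nat" by (rule inv)
      then show "p \<circ> block_swap k n \<circ> block_swap k n = p" for p :: "nat \<Rightarrow> nat" .
      show "p \<circ> block_swap k n \<in> T n" if "p \<in> T k" for p
        using that perm[of p] by (auto simp: T_def)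
      show "p \<circ> block_swap k n \<in> T k" if "p \<in> T n" for p
        using that perm[of p] by (auto simp: T_def)
      show "pf_term ?n ?one (p \<circ> block_swap k n) = pf_term ?n ?one p" if "p \<in> T k" for p
        using that by (intro pf_term_compose_block_swap[OF k]) (simp add: T_def)
    qed
  qed
  also have "\<dots> = real ?n * (\<Sum>p\<in>T n. pf_term ?n ?one p)" by simp
  also have "(\<Sum>p\<in>T n. pf_term ?n ?one p) = 2 * (\<Sum>p\<in>P. pf_term ?n ?one p)"
  proof -
    let ?fl = "Transposition.transpose (2 * n) (2 * n + 1)"
    have Pp: "p permutes {..<2 * ?n}" "p (2 * n) = 2 * n" "p (2 * n + 1) = 2 * n + 1" if "p \<in> P" for p
    proof -
      have p: "p permutes {..<2 * n}" using that by (simp add: P_def)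
      show "p permutes {..<2 * ?n}" by (rule permutes_subset[OF p]) auto
      show "p (2 * n) = 2 * n" "p (2 * n + 1) = 2 * n + 1" using permutes_not_in[OF p] by auto
    qed
    have toP: "p \<in> P" if p: "p permutes {..<2 * ?n}" "p (2 * n) = 2 * n" "p (2 * n + 1) = 2 * n + 1" for p
      unfolding P_def
    proof (simp, rule permutes_superset[OF p(1)])
      fix x assume "x \<in> {..<2 * ?n} - {..<2 * n}"
      then have "x = 2 * n \<or> x = 2 * n + 1" by auto
      then show "p x = x" using p by auto
    qed
    have flp: "p \<circ> ?fl permutes {..<2 * ?n}" if "p permutes {..<2 * ?n}" for p
      by (intro permutes_compose[OF _ that] permutes_swap_id) auto
    have flfl: "(p \<circ> ?fl) \<circ> ?fl = p" for p :: "nat \<Rightarrow> nat" by (simp add: comp_assoc)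
    \<comment> \<open>The last block is either in natural order, which leaves a permutation of the
      smaller indices, or reversed.\<close>
    have T: "T n = P \<union> (\<lambda>p. p \<circ> ?fl) ` P"
    proof (intro set_eqI iffI)
      fix p assume p: "p \<in> T n"
      then have pp: "p permutes {..<2 * ?n}"
        and "p (2 * n) = 2 * n \<and> p (2 * n + 1) = 2 * n + 1 \<or> p (2 * n) = 2 * n + 1 \<and> p (2 * n + 1) = 2 * n"
        unfolding T_def doubleton_eq_iff by auto
      then show "p \<in> P \<union> (\<lambda>p. p \<circ> ?fl) ` P"
      proof (elim disjE conjE)
        assume *: "p (2 * n) = 2 * n + 1" "p (2 * n + 1) = 2 * n"
        have "p \<circ> ?fl \<in> P" by (rule toP[OF flp[OF pp]]) (use * in auto)
        then have "(p \<circ> ?fl) \<circ> ?fl \<in> (\<lambda>p. p \<circ> ?fl) ` P" by (rule imageI)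
        then show ?thesis unfolding flfl by simp
      qed (use toP[OF pp] in simp)
    next
      fix p assume "p \<in> P \<union> (\<lambda>p. p \<circ> ?fl) ` P"
      then consider "p \<in> P" | q where "q \<in> P" "p = q \<circ> ?fl" by blast
      then show "p \<in> T n"
      proof cases
        case 1
        then show ?thesis unfolding T_def using Pp[OF 1] by simp
      next
        case 2
        then show ?thesis unfolding T_def using Pp[OF 2(1)] flp[of q] by (simp add: insert_commute)
      qed
    qed
    have disj: "P \<inter> (\<lambda>p. p \<circ> ?fl) ` P = {}"
    proof -
      have "(p \<circ> ?fl) (2 * n) \<noteq> 2 * n" if "p \<in> P" for p using Pp[OF that] by simp
      then show ?thesis using Pp(2) by blast
    qed
    have inj: "inj_on (\<lambda>p. p \<circ> ?fl) P" by (rule inj_on_inverseI[where g="\<lambda>p. p \<circ> ?fl"]) (rule flfl)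
    have "finite P" unfolding P_def by (rule finite_permutations) simp
    then have "(\<Sum>p\<in>T n. pf_term ?n ?one p) = (\<Sum>p\<in>P. pf_term ?n ?one p) + (\<Sum>p\<in>P. pf_term ?n ?one (p \<circ> ?fl))"
      unfolding T using disj inj by (simp add: sum.union_disjoint sum.reindex del: One_nat_def)
    also have "(\<Sum>p\<in>P. pf_term ?n ?one (p \<circ> ?fl)) = (\<Sum>p\<in>P. pf_term ?n ?one p)"
      using Pp(1) by (intro sum.cong refl pf_term_compose_flip) auto
    finally show ?thesis by simp
  qed
  also have "(\<Sum>p\<in>P. pf_term ?n ?one p) = pf_sum n {} ?one"
    unfolding pf_sum_def
  proof (rule sum.cong)
    show "P = matching_perms n {}" by (simp add: P_def matching_perms_def)
    fix p assume "p \<in> matching_perms n {}"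
    then have "p permutes {..<2 * n}" by (simp add: matching_perms_def)
    then have "p (2 * n) = 2 * n" "p (2 * n + 1) = 2 * n + 1" using permutes_not_in[of p "{..<2 * n}"] by auto
    then show "pf_term ?n ?one p = pf_term n ?one p" by (simp add: pf_term_def skew_matrix_def)
  qed
  finally show ?case using Suc by (simp add: algebra_simps)
qed

section \<open>First meetings\<close>

text \<open>One direction uses continuity and density of the rationals, the other the minimum of the
  distance on a compact interval. The right-hand side refers to countably many times, which is what
  measurability needs.\<close>

lemma meet_by_rationals:
  fixes v w :: "real \<Rightarrow> real"
  assumes v: "continuous_on {0..} v" and w: "continuous_on {0..} w" and u: "0 \<le> u"
  shows "(\<exists>s\<in>{0..u}. v s = w s) \<longleftrightarrow> (\<forall>k::nat. \<exists>s\<in>\<rat> \<inter> {0..u}. \<bar>v s - w s\<bar> < 1 / real (Suc k))"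
proof
  assume "\<exists>s\<in>{0..u}. v s = w s"
  then obtain s where s: "0 \<le> s" "s \<le> u" "v s = w s" by auto
  show "\<forall>k::nat. \<exists>s\<in>\<rat> \<inter> {0..u}. \<bar>v s - w s\<bar> < 1 / real (Suc k)"
  proof
    fix k :: nat
    have "continuous_on {0..} (\<lambda>s. v s - w s)" using v w by (intro continuous_on_diff)
    moreover have "0 < 1 / real (Suc k)" "s \<in> {0..}" using s by auto
    ultimately obtain d where d: "0 < d"
      "\<And>x. x \<in> {0..} \<Longrightarrow> dist x s < d \<Longrightarrow> dist (v x - w x) (v s - w s) < 1 / real (Suc k)"
      unfolding continuous_on_iff by metis
    obtain x where x: "x \<in> \<rat>" "0 \<le> x" "x \<le> u" "dist x s < d"
    \<comment> \<open>For \<open>u = 0\<close> there is no open interval in which to look for a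
      rational, but the point 0 is itself rational.\<close>
    proof (cases "u = 0")
      case True
      then show thesis using that[of 0] s d(1) by simp
    next
      case False
      then have "max 0 (s - d) < min u (s + d)" using s u d(1) by auto
      then obtain x where "x \<in> \<rat>" "max 0 (s - d) < x" "x < min u (s + d)"
        using Rats_dense_in_real by blast
      then show thesis using that[of x] by (auto simp: dist_real_def)
    qed
    then show "\<exists>s\<in>\<rat> \<inter> {0..u}. \<bar>v s - w s\<bar> < 1 / real (Suc k)"
      using d(2)[of x] s(3) by (intro bexI[of _ x]) (auto simp: dist_real_def)
  qed
next
  assume *: "\<forall>k::nat. \<exists>s\<in>\<rat> \<inter> {0..u}. \<bar>v s - w s\<bar> < 1 / real (Suc k)"
  have "continuous_on {0..u} (\<lambda>s. \<bar>v s - w s\<bar>)"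
    using v w by (intro continuous_intros continuous_on_subset[of "{0..}" _ "{0..u}"]) auto
  then obtain s where s: "s \<in> {0..u}" "\<And>x. x \<in> {0..u} \<Longrightarrow> \<bar>v s - w s\<bar> \<le> \<bar>v x - w x\<bar>"
    using continuous_attains_inf[of "{0..u}" "\<lambda>s. \<bar>v s - w s\<bar>"] u by auto
  show "\<exists>s\<in>{0..u}. v s = w s"
  proof (rule ccontr)
    assume "\<not> (\<exists>s\<in>{0..u}. v s = w s)"
    then have "0 < \<bar>v s - w s\<bar>" using s(1) by auto
    then obtain k where k: "inverse (real (Suc k)) < \<bar>v s - w s\<bar>" using reals_Archimedean by blast
    obtain x where "x \<in> {0..u}" "\<bar>v x - w x\<bar> < 1 / real (Suc k)"
      using *[rule_format, of k] by (elim bexE IntE)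
    then show False using s(2)[of x] k by (simp add: inverse_eq_divide)
  qed
qed

text \<open>Meetings after time \<open>t + 1\<close> are irrelevant; the cap makes this a bounded stopping time.\<close>

definition first_meet :: "(nat \<Rightarrow> real \<Rightarrow> real) \<Rightarrow> real \<Rightarrow> nat \<Rightarrow> nat \<Rightarrow> real" where
  "first_meet w t i j = Inf (insert (t + 1) {s \<in> {0..t + 1}. w i s = w j s})"

lemma first_meet_sym: "first_meet w t i j = first_meet w t j i"
proof -
  have "{s \<in> {0..t + 1}. w i s = w j s} = {s \<in> {0..t + 1}. w j s = w i s}" by auto
  then show ?thesis by (simp add: first_meet_def)
qed

lemma first_meet_le: "0 \<le> s \<Longrightarrow> s \<le> t + 1 \<Longrightarrow> w i s = w j s \<Longrightarrow> 0 \<le> t \<Longrightarrow> first_meet w t i j \<le> s"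
  unfolding first_meet_def by (intro cInf_lower bdd_belowI[of _ 0]) auto

lemma first_meet_bounds:
  assumes "0 \<le> t"
  shows "0 \<le> first_meet w t i j" "first_meet w t i j \<le> t + 1"
  unfolding first_meet_def using assms
  by (auto intro!: cInf_greatest cInf_lower bdd_belowI[of _ 0])

lemma first_meet_not_before:
  assumes "0 \<le> t" "0 \<le> s" "s < first_meet w t i j"
  shows "w i s \<noteq> w j s"
  using first_meet_le[of s t w i j] first_meet_bounds(2)[of t w i j] assms by force

text \<open>The meeting times up to \<open>t + 1\<close> form a closed set, so the infimum is
  attained. The value \<open>t + 1\<close> may also stand for no meeting at all; this explains the
  strict assumption \<open>T\<close>.\<close>

lemma first_meet_attained:
  assumes t: "0 \<le> t" and c: "continuous_on {0..} (w i)" "continuous_on {0..} (w j)"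
    and T: "first_meet w t i j < t + 1"
  shows "w i (first_meet w t i j) = w j (first_meet w t i j)"
proof -
  let ?S = "{s \<in> {0..t + 1}. w i s = w j s}"
  have "continuous_on {0..t + 1} (\<lambda>s. w i s - w j s)"
    using c by (intro continuous_on_diff continuous_on_subset[of "{0..}" _ "{0..t + 1}"]) auto
  then have "closed ({0..t + 1} \<inter> (\<lambda>s. w i s - w j s) -` {0})"
    by (intro continuous_closed_preimage) auto
  also have "{0..t + 1} \<inter> (\<lambda>s. w i s - w j s) -` {0} = ?S" by auto
  finally have "closed (insert (t + 1) ?S)" by (rule closed_insert)
  moreover have "bdd_below (insert (t + 1) ?S)" using t by (intro bdd_belowI[of _ 0]) auto
  ultimately have "first_meet w t i j \<in> insert (t + 1) ?S"
    unfolding first_meet_def by (intro closed_contains_Inf) auto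
  then show ?thesis using T by auto
qed

lemma first_meet_less_iff:
  assumes t: "0 \<le> t" and c: "continuous_on {0..} (w i)" "continuous_on {0..} (w j)" and q: "q \<le> t + 1"
  shows "first_meet w t i j < q \<longleftrightarrow> (\<exists>u\<in>\<rat>. 0 \<le> u \<and> u < q \<and> (\<exists>s\<in>{0..u}. w i s = w j s))"
proof
  assume T: "first_meet w t i j < q"
  then obtain u where u: "u \<in> \<rat>" "first_meet w t i j < u" "u < q" using Rats_dense_in_real by blast
  moreover have "w i (first_meet w t i j) = w j (first_meet w t i j)"
    using first_meet_attained[OF t c] T q by simp
  moreover have "0 \<le> first_meet w t i j" by (rule first_meet_bounds[OF t])
  ultimately show "\<exists>u\<in>\<rat>. 0 \<le> u \<and> u < q \<and> (\<exists>s\<in>{0..u}. w i s = w j s)"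
    by (intro bexI[of _ u] conjI bexI[of _ "first_meet w t i j"]) auto
next
  assume "\<exists>u\<in>\<rat>. 0 \<le> u \<and> u < q \<and> (\<exists>s\<in>{0..u}. w i s = w j s)"
  then obtain s where "0 \<le> s" "s < q" "w i s = w j s" by auto
  then show "first_meet w t i j < q" using first_meet_le[of s t w i j] t q by auto
qed

text \<open>A meeting strictly before \<open>q\<close> has happened by some rational
  \<open>u < q\<close>, and a meeting by time \<open>u\<close> is a condition on rational times up
  to \<open>u\<close>. For \<open>q \<le> t + 1\<close> the event thus arises by countable
  operations from positions before \<open>q\<close>; beyond the cap it is the whole space.\<close>

lemma first_meet_before_past:
  assumes ibm: "independent_brownian_motions M xs W" and N: "N = length xs"
    and t: "0 \<le> t" and ij: "i < N" "j < N"
  shows "{\<omega>\<in>space M. first_meet (\<lambda>i s. W i s \<omega>) t i j < q} \<in> sets (past M N W q)"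
proof -
  let ?F = "past M N W q"
  let ?T = "\<lambda>\<omega>. first_meet (\<lambda>i s. W i s \<omega>) t i j"
  have c: "continuous_on {0..} (\<lambda>s. W k s \<omega>)" if "k < N" "\<omega> \<in> space M" for k \<omega>
    using ibm_continuous[OF ibm] that N by blast
  show ?thesis
  proof (cases "q \<le> t + 1")
    case False
    then have "?T \<omega> < q" for \<omega> using first_meet_bounds(2)[OF t, of "\<lambda>i s. W i s \<omega>" i j] by linarith
    then have "{\<omega>\<in>space M. ?T \<omega> < q} = space ?F" by simp
    then show ?thesis by (metis sets.top)
  next
    case True
    have sm: "{\<omega>\<in>space M. \<bar>W i s \<omega> - W j s \<omega>\<bar> < 1 / real (Suc k)} \<in> sets ?F"
      if "0 \<le> s" "s < q" for s k
    proof -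
      have "W i s \<in> borel_measurable ?F" "W j s \<in> borel_measurable ?F"
        using that ij by (auto intro!: past_component)
      then have "{\<omega>\<in>space ?F. \<bar>W i s \<omega> - W j s \<omega>\<bar> < 1 / real (Suc k)} \<in> sets ?F" by measurable
      then show ?thesis by simp
    qed
    have "{\<omega>\<in>space M. ?T \<omega> < q} =
        (\<Union>u\<in>\<rat> \<inter> {0..<q}. \<Inter>k. \<Union>s\<in>\<rat> \<inter> {0..u}. {\<omega>\<in>space M. \<bar>W i s \<omega> - W j s \<omega>\<bar> < 1 / real (Suc k)})"
    proof (intro set_eqI iffI)
      fix \<omega> assume \<omega>: "\<omega> \<in> {\<omega>\<in>space M. ?T \<omega> < q}"
      then have sp: "\<omega> \<in> space M" by simp
      from \<omega> obtain u where u: "u \<in> \<rat>" "0 \<le> u" "u < q" "\<exists>s\<in>{0..u}. W i s \<omega> = W j s \<omega>"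
        using first_meet_less_iff[OF t c[OF ij(1) sp] c[OF ij(2) sp] True] by auto
      show "\<omega> \<in> (\<Union>u\<in>\<rat> \<inter> {0..<q}. \<Inter>k. \<Union>s\<in>\<rat> \<inter> {0..u}. {\<omega>\<in>space M. \<bar>W i s \<omega> - W j s \<omega>\<bar> < 1 / real (Suc k)})"
      proof (rule UN_I[of u], use u in simp, rule INT_I)
        fix k :: nat
        obtain s where "s \<in> \<rat> \<inter> {0..u}" "\<bar>W i s \<omega> - W j s \<omega>\<bar> < 1 / real (Suc k)"
          using meet_by_rationals[OF c[OF ij(1) sp] c[OF ij(2) sp] u(2)] u(4) by blast
        then show "\<omega> \<in> (\<Union>s\<in>\<rat> \<inter> {0..u}. {\<omega>\<in>space M. \<bar>W i s \<omega> - W j s \<omega>\<bar> < 1 / real (Suc k)})"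
          using sp by (intro UN_I[of s]) auto
      qed
    next
      fix \<omega> assume "\<omega> \<in> (\<Union>u\<in>\<rat> \<inter> {0..<q}. \<Inter>k. \<Union>s\<in>\<rat> \<inter> {0..u}. {\<omega>\<in>space M. \<bar>W i s \<omega> - W j s \<omega>\<bar> < 1 / real (Suc k)})"
      then obtain u where uu: "u \<in> \<rat> \<inter> {0..<q}" and
        "\<omega> \<in> (\<Inter>k. \<Union>s\<in>\<rat> \<inter> {0..u}. {\<omega>\<in>space M. \<bar>W i s \<omega> - W j s \<omega>\<bar> < 1 / real (Suc k)})"
        by (rule UN_E)
      then have *: "\<exists>s\<in>\<rat> \<inter> {0..u}. \<omega> \<in> {\<omega>\<in>space M. \<bar>W i s \<omega> - W j s \<omega>\<bar> < 1 / real (Suc k)}" for k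
        by blast
      have u: "u \<in> \<rat>" "0 \<le> u" "u < q" using uu by auto
      from * have sp: "\<omega> \<in> space M" by blast
      have "\<forall>k. \<exists>s\<in>\<rat> \<inter> {0..u}. \<bar>W i s \<omega> - W j s \<omega>\<bar> < 1 / real (Suc k)"
        using * by simp
      then have "\<exists>s\<in>{0..u}. W i s \<omega> = W j s \<omega>"
        using meet_by_rationals[OF c[OF ij(1) sp] c[OF ij(2) sp] u(2)] by blast
      then show "\<omega> \<in> {\<omega>\<in>space M. ?T \<omega> < q}"
        using first_meet_less_iff[OF t c[OF ij(1) sp] c[OF ij(2) sp] True] u sp by auto
    qed
    moreover have "(\<Union>s\<in>\<rat> \<inter> {0..u}. {\<omega>\<in>space M. \<bar>W i s \<omega> - W j s \<omega>\<bar> < 1 / real (Suc k)}) \<in> sets ?F"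
      if "u \<in> \<rat> \<inter> {0..<q}" for u k
      using that by (intro sets.countable_UN'' sm) (auto intro: countable_rat countable_subset[OF Int_lower1])
    then have "(\<Union>u\<in>\<rat> \<inter> {0..<q}. \<Inter>k. \<Union>s\<in>\<rat> \<inter> {0..u}.
        {\<omega>\<in>space M. \<bar>W i s \<omega> - W j s \<omega>\<bar> < 1 / real (Suc k)}) \<in> sets ?F"
      by (intro sets.countable_UN'' sets.countable_INT)
        (auto simp del: of_nat_Suc intro: countable_rat countable_subset[OF Int_lower1])
    ultimately show ?thesis by simp
  qed
qed

text \<open>The past up to \<open>q\<close> knows a meeting time only while it is below
  \<open>q\<close>, and the truncation is the part that is known. Comparing truncated times
  expresses, within the past, which pair meets first.\<close>

lemma first_meet_trunc_measurable:
  assumes ibm: "independent_brownian_motions M xs W" and N: "N = length xs"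
    and t: "0 \<le> t" and ij: "i < N" "j < N"
  shows "(\<lambda>\<omega>. min (first_meet (\<lambda>i s. W i s \<omega>) t i j) q) \<in> borel_measurable (past M N W q)"
proof (rule borel_measurableI_less)
  fix c
  show "{\<omega>\<in>space (past M N W q). min (first_meet (\<lambda>i s. W i s \<omega>) t i j) q < c} \<in> sets (past M N W q)"
  proof (cases "c \<le> q")
    case True
    then have "{\<omega>\<in>space (past M N W q). min (first_meet (\<lambda>i s. W i s \<omega>) t i j) q < c} =
        {\<omega>\<in>space M. first_meet (\<lambda>i s. W i s \<omega>) t i j < c}" by auto
    then show ?thesis
      using first_meet_before_past[OF ibm N t ij, of c] past_mono[OF True, of M N W] by auto
  next
    case False
    then have "{\<omega>\<in>space (past M N W q). min (first_meet (\<lambda>i s. W i s \<omega>) t i j) q < c} = space (past M N W q)"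
      by auto
    then show ?thesis by (metis sets.top)
  qed
qed

lemma first_meet_measurable:
  assumes ibm: "independent_brownian_motions M xs W" and N: "N = length xs"
    and t: "0 \<le> t" and ij: "i < N" "j < N"
  shows "(\<lambda>\<omega>. first_meet (\<lambda>i s. W i s \<omega>) t i j) \<in> borel_measurable M"
proof (rule borel_measurableI_less)
  fix c
  show "{\<omega>\<in>space M. first_meet (\<lambda>i s. W i s \<omega>) t i j < c} \<in> sets M"
    using first_meet_before_past[OF ibm N t ij] past_subset[of N W M] ibm_measurable[OF ibm] N by blast
qed

text \<open>The strict inequality excludes ties, so along given paths at most one unordered pair of
  distinct labels of \<open>A\<close> qualifies.\<close>

definition first_pair :: "(nat \<Rightarrow> real \<Rightarrow> real) \<Rightarrow> real \<Rightarrow> nat set \<Rightarrow> nat \<Rightarrow> nat \<Rightarrow> bool" where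
  "first_pair w t A a b \<longleftrightarrow> first_meet w t a b \<le> t \<and>
    (\<forall>i\<in>A. \<forall>j\<in>A. i \<noteq> j \<longrightarrow> {i, j} \<noteq> {a, b} \<longrightarrow> first_meet w t a b < first_meet w t i j)"

definition no_pair :: "(nat \<Rightarrow> real \<Rightarrow> real) \<Rightarrow> real \<Rightarrow> nat set \<Rightarrow> bool" where
  "no_pair w t A \<longleftrightarrow> (\<forall>i\<in>A. \<forall>j\<in>A. i \<noteq> j \<longrightarrow> t < first_meet w t i j)"

section \<open>The first meeting pair along given paths\<close>

lemma no_pair_iff:
  assumes t: "0 \<le> t" and c: "\<And>i. i \<in> A \<Longrightarrow> continuous_on {0..} (w i)"
  shows "no_pair w t A \<longleftrightarrow> meet_times w t A = {}"
proof
  assume np: "no_pair w t A"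
  show "meet_times w t A = {}"
  proof (rule ccontr)
    assume "meet_times w t A \<noteq> {}"
    then obtain i j s where *: "0 \<le> s" "s \<le> t" "i \<in> A" "j \<in> A" "i \<noteq> j" "w i s = w j s"
      by (auto simp: meet_times_def)
    then have "t < first_meet w t i j" using np unfolding no_pair_def by blast
    then have "s < first_meet w t i j" using *(2) by simp
    then show False using first_meet_not_before[OF t *(1)] *(6) by blast
  qed
next
  assume m: "meet_times w t A = {}"
  show "no_pair w t A"
    unfolding no_pair_def
  proof (intro ballI impI, rule ccontr)
    fix i j assume ij: "i \<in> A" "j \<in> A" "i \<noteq> j" and "\<not> t < first_meet w t i j"
    then have T: "first_meet w t i j \<le> t" by simp
    then have "w i (first_meet w t i j) = w j (first_meet w t i j)"
      using first_meet_attained[OF t c[OF ij(1)] c[OF ij(2)]] by simp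
    then have "first_meet w t i j \<in> meet_times w t A"
      using T ij first_meet_bounds(1)[OF t] unfolding meet_times_def by auto
    then show False using m by simp
  qed
qed

lemma annihilate_no_pair:
  assumes "0 \<le> t" "\<And>i. i \<in> A \<Longrightarrow> continuous_on {0..} (w i)" "no_pair w t A"
  shows "(annihilate w t ^^ m) A = A"
proof -
  have "meet_times w t A = {}" using no_pair_iff[of t A w, OF assms(1,2)] assms(3) by blast
  then have "annihilate w t A = A" by (simp add: annihilate_def)
  then show ?thesis by (induction m) simp_all
qed

lemma first_pair_only:
  assumes t: "0 \<le> t" and f: "first_pair w t A a b"
    and ij: "i \<in> A" "j \<in> A" "i \<noteq> j" "w i s = w j s" and s: "0 \<le> s" "s \<le> first_meet w t a b"
  shows "{i, j} = {a, b}"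
proof (rule ccontr)
  assume "{i, j} \<noteq> {a, b}"
  then have "first_meet w t a b < first_meet w t i j" using f ij(1-3) unfolding first_pair_def by blast
  then have "s < first_meet w t i j" using s(2) by simp
  then show False using first_meet_not_before[OF t s(1)] ij(4) by blast
qed

lemma first_meet_attained':
  assumes t: "0 \<le> t" and c: "\<And>i. i \<in> A \<Longrightarrow> continuous_on {0..} (w i)"
    and ab: "a \<in> A" "b \<in> A" and f: "first_pair w t A a b"
  shows "w a (first_meet w t a b) = w b (first_meet w t a b)"
  using f by (intro first_meet_attained[OF t c[OF ab(1)] c[OF ab(2)]]) (simp add: first_pair_def)

lemma Inf_meet_times_first_pair:
  assumes t: "0 \<le> t" and c: "\<And>i. i \<in> A \<Longrightarrow> continuous_on {0..} (w i)"
    and ab: "a \<in> A" "b \<in> A" "a \<noteq> b" and f: "first_pair w t A a b"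
  shows "first_meet w t a b \<in> meet_times w t A" "Inf (meet_times w t A) = first_meet w t a b"
proof -
  let ?T = "first_meet w t a b"
  show m: "?T \<in> meet_times w t A"
    using first_meet_attained'[OF t c ab(1,2) f] f ab first_meet_bounds(1)[OF t]
    unfolding meet_times_def first_pair_def by auto
  show "Inf (meet_times w t A) = ?T"
  proof (rule cInf_eq_minimum[OF m])
    fix s assume "s \<in> meet_times w t A"
    then obtain i j where s: "0 \<le> s" "s \<le> t" and ij: "i \<in> A" "j \<in> A" "i \<noteq> j" "w i s = w j s"
      by (auto simp: meet_times_def)
    show "?T \<le> s"
    proof (rule ccontr)
      assume n: "\<not> ?T \<le> s"
      then have "{i, j} = {a, b}" using first_pair_only[OF t f ij s(1)] by simp
      then have "w a s = w b s" using ij(4) by (auto simp: doubleton_eq_iff)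
      then show False using first_meet_not_before[OF t s(1)] n by force
    qed
  qed
qed

lemma annihilate_first_pair:
  assumes t: "0 \<le> t" and c: "\<And>i. i \<in> A \<Longrightarrow> continuous_on {0..} (w i)"
    and ab: "a \<in> A" "b \<in> A" "a \<noteq> b" and f: "first_pair w t A a b"
  shows "annihilate w t A = A - {a, b}"
proof -
  let ?T = "first_meet w t a b"
  have eq: "w a ?T = w b ?T" by (rule first_meet_attained'[OF t c ab(1,2) f])
  have only: "{i, j} = {a, b}" if "i \<in> A" "j \<in> A" "i \<noteq> j" "w i ?T = w j ?T" for i j
    using first_pair_only[OF t f that first_meet_bounds(1)[OF t]] by simp
  have "(\<forall>j\<in>A. j \<noteq> i \<longrightarrow> w j ?T \<noteq> w i ?T) \<longleftrightarrow> i \<notin> {a, b}" if "i \<in> A" for i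
  proof
    assume "\<forall>j\<in>A. j \<noteq> i \<longrightarrow> w j ?T \<noteq> w i ?T"
    then show "i \<notin> {a, b}" using ab eq by auto
  next
    assume "i \<notin> {a, b}"
    then show "\<forall>j\<in>A. j \<noteq> i \<longrightarrow> w j ?T \<noteq> w i ?T" using only[of i] that by fastforce
  qed
  moreover have "meet_times w t A \<noteq> {}" using Inf_meet_times_first_pair(1)[OF t c ab f] by auto
  moreover have "Inf (meet_times w t A) = ?T" by (rule Inf_meet_times_first_pair(2)[OF t c ab f])
  ultimately show ?thesis unfolding annihilate_def by auto
qed

text \<open>If \<open>k\<close> were alive between \<open>a\<close> and \<open>b\<close>, neither
  \<open>a, k\<close> nor \<open>k, b\<close> would have met by the first meeting. By the
  intermediate value theorem their orders would persist until then, and \<open>a\<close> and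
  \<open>b\<close> could not be at the same point.\<close>

lemma first_pair_adjacent:
  assumes t: "0 \<le> t" and c: "\<And>i. i \<in> A \<Longrightarrow> continuous_on {0..} (w i)"
    and ord: "\<And>i j. i \<in> A \<Longrightarrow> j \<in> A \<Longrightarrow> i < j \<Longrightarrow> w i 0 < w j 0"
    and ab: "a \<in> A" "b \<in> A" and f: "first_pair w t A a b"
    and k: "a < k" "k < b"
  shows "k \<notin> A"
proof
  assume kA: "k \<in> A"
  let ?T = "first_meet w t a b"
  have T0: "0 \<le> ?T" by (rule first_meet_bounds[OF t])
  have less: "w i ?T < w j ?T" if ij: "i \<in> A" "j \<in> A" "i < j" "{i, j} \<noteq> {a, b}" for i j
  proof (rule ccontr)
    assume n: "\<not> w i ?T < w j ?T"
    have "continuous_on {0..?T} (\<lambda>s. w i s - w j s)"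
      using c ij by (intro continuous_on_diff continuous_on_subset[of "{0..}" _ "{0..?T}"]) auto
    then obtain s where s: "0 \<le> s" "s \<le> ?T" "w i s - w j s = 0"
      using IVT'[of "\<lambda>s. w i s - w j s" 0 0 ?T] ord[OF ij(1-3)] n T0 by auto
    then show False using first_pair_only[OF t f ij(1,2) _ _ s(1,2)] ij by auto
  qed
  have "w a ?T < w k ?T" "w k ?T < w b ?T"
    using less[of a k] less[of k b] ab kA k by (auto simp: doubleton_eq_iff)
  then show False using first_meet_attained'[OF t c ab f] by simp
qed

text \<open>A pair minimising the meeting time qualifies: a tie would be a simultaneous meeting of
  two different pairs, excluded by \<open>simple\<close>.\<close>

lemma first_pair_exists:
  assumes t: "0 \<le> t" and fin: "finite A" and c: "\<And>i. i \<in> A \<Longrightarrow> continuous_on {0..} (w i)"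
    and simple: "\<And>a b c d s. a \<in> A \<Longrightarrow> b \<in> A \<Longrightarrow> c \<in> A \<Longrightarrow> d \<in> A \<Longrightarrow> 0 \<le> s \<Longrightarrow> a \<noteq> b \<Longrightarrow> c \<noteq> d \<Longrightarrow>
      w a s = w b s \<Longrightarrow> w c s = w d s \<Longrightarrow> {a, b} = {c, d}"
    and np: "\<not> no_pair w t A"
  shows "\<exists>a\<in>A. \<exists>b\<in>A. a < b \<and> first_pair w t A a b"
proof -
  define P where "P = {(i, j). i \<in> A \<and> j \<in> A \<and> i \<noteq> j}"
  have P: "finite P" by (rule finite_subset[of _ "A \<times> A"]) (use fin in \<open>auto simp: P_def\<close>)
  obtain i0 j0 where "i0 \<in> A" "j0 \<in> A" "i0 \<noteq> j0" "\<not> t < first_meet w t i0 j0"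
    using np unfolding no_pair_def by blast
  then have 0: "(i0, j0) \<in> P" "first_meet w t i0 j0 \<le> t" by (simp_all add: P_def)
  define T where "T p = first_meet w t (fst p) (snd p)" for p
  define p where "p = arg_min_on T P"
  have "P \<noteq> {}" using 0(1) by blast
  then have "p \<in> P" "\<And>r. r \<in> P \<Longrightarrow> T p \<le> T r"
    unfolding p_def using arg_min_if_finite[OF P, of T] by (auto simp: not_less)
  then have p: "p \<in> P" "\<And>r. r \<in> P \<Longrightarrow> first_meet w t (fst p) (snd p) \<le> first_meet w t (fst r) (snd r)"
    by (auto simp: T_def)
  define a b where "a = min (fst p) (snd p)" and "b = max (fst p) (snd p)"
  have ab: "a \<in> A" "b \<in> A" "a < b" and Tp: "first_meet w t a b = first_meet w t (fst p) (snd p)"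
    using p(1) by (auto simp: P_def a_def b_def min_def max_def first_meet_sym)
  have Tt: "first_meet w t a b \<le> t" using p(2)[OF 0(1)] 0(2) Tp by simp
  have "first_meet w t a b < first_meet w t i j" if ij: "i \<in> A" "j \<in> A" "i \<noteq> j" "{i, j} \<noteq> {a, b}" for i j
  proof -
    have le: "first_meet w t a b \<le> first_meet w t i j" using p(2)[of "(i, j)"] ij Tp by (simp add: P_def)
    moreover have "first_meet w t a b \<noteq> first_meet w t i j"
    proof
      assume eq: "first_meet w t a b = first_meet w t i j"
      have "w i (first_meet w t a b) = w j (first_meet w t a b)"
        unfolding eq using Tt eq by (intro first_meet_attained[OF t c c] ij) simp
      moreover have "w a (first_meet w t a b) = w b (first_meet w t a b)"
        using Tt by (intro first_meet_attained[OF t c c] ab) simp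
      ultimately have "{i, j} = {a, b}"
        using simple[OF ij(1,2) ab(1,2) first_meet_bounds(1)[OF t]] ij(3) ab(3) by blast
      then show False using ij(4) by blast
    qed
    ultimately show ?thesis by simp
  qed
  then have "first_pair w t A a b" using Tt by (auto simp: first_pair_def)
  then show ?thesis using ab by blast
qed

text \<open>The outcome of the two-particle system, read off from two paths that continue after
  meeting; the value 1 is the empty product.\<close>

definition pair_value :: "(real \<Rightarrow> real) \<Rightarrow> real \<Rightarrow> (nat \<Rightarrow> real \<Rightarrow> real) \<Rightarrow> nat \<Rightarrow> nat \<Rightarrow> real" where
  "pair_value g t w i j = (if \<exists>s\<in>{0..t}. w i s = w j s then 1 else g (w i t) * g (w j t))"

text \<open>A version of \<open>pair_value\<close> that is measurable on the whole product space, as it refers to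
  countably many times only; the two agree on continuous paths.\<close>

definition traj_value :: "(real \<Rightarrow> real) \<Rightarrow> real \<Rightarrow> (nat \<times> real \<Rightarrow> real) \<Rightarrow> nat \<Rightarrow> nat \<Rightarrow> real" where
  "traj_value g t z i j =
    (if \<forall>k::nat. \<exists>s\<in>\<rat> \<inter> {0..t}. \<bar>z (i, s) - z (j, s)\<bar> < 1 / real (Suc k) then 1
     else g (z (i, t)) * g (z (j, t)))"

lemma pair_value_sym: "pair_value g t w i j = pair_value g t w j i"
proof -
  have "(\<exists>s\<in>{0..t}. w i s = w j s) = (\<exists>s\<in>{0..t}. w j s = w i s)" by (metis (full_types))
  then show ?thesis by (simp add: pair_value_def mult.commute)
qed

lemma traj_value_eq:
  assumes "i < N" "j < N" "0 \<le> t" "continuous_on {0..} (w i)" "continuous_on {0..} (w j)"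
  shows "traj_value g t (traj N w) i j = pair_value g t w i j"
proof -
  have "(\<exists>s\<in>\<rat> \<inter> {0..t}. \<bar>traj N w (i, s) - traj N w (j, s)\<bar> < e) \<longleftrightarrow>
      (\<exists>s\<in>\<rat> \<inter> {0..t}. \<bar>w i s - w j s\<bar> < e)" for e
    using assms by (intro bex_cong) auto
  then have "(\<forall>k::nat. \<exists>s\<in>\<rat> \<inter> {0..t}. \<bar>traj N w (i, s) - traj N w (j, s)\<bar> < 1 / real (Suc k)) \<longleftrightarrow>
      (\<exists>s\<in>{0..t}. w i s = w j s)"
    using meet_by_rationals[OF assms(4,5,3)] by simp
  then show ?thesis using assms(1-3) unfolding traj_value_def pair_value_def by simp
qed

lemma Collect_bex_conj: "{x \<in> S. \<exists>s\<in>R. P s x} = (\<Union>s\<in>R. {x \<in> S. P s x})"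
  by auto

text \<open>Stated for arbitrary families \<open>U\<close> and \<open>V\<close> because it is
  applied both on \<open>traj_space\<close> and on products of path spaces of single
  particles.\<close>

lemma indicator_meet_measurable:
  fixes U V :: "real \<Rightarrow> 'q \<Rightarrow> real" and g :: "real \<Rightarrow> real"
  assumes g: "g \<in> borel_measurable borel" and t: "0 \<le> t"
    and U: "\<And>s. 0 \<le> s \<Longrightarrow> U s \<in> borel_measurable Q" and V: "\<And>s. 0 \<le> s \<Longrightarrow> V s \<in> borel_measurable Q"
  shows "(\<lambda>z. if \<forall>k::nat. \<exists>s\<in>\<rat> \<inter> {0..t}. \<bar>U s z - V s z\<bar> < 1 / real (Suc k) then 1
      else g (U t z) * g (V t z)) \<in> borel_measurable Q"
proof -
  have "Measurable.pred Q (\<lambda>z. \<bar>U s z - V s z\<bar> < 1 / real (Suc k))"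
    if "s \<in> \<rat> \<inter> {0..t}" for s k
    using that by (intro borel_measurable_pred_less borel_measurable_abs borel_measurable_diff
        U V borel_measurable_const) auto
  then have "Measurable.pred Q (\<lambda>z. \<exists>s\<in>\<rat> \<inter> {0..t}. \<bar>U s z - V s z\<bar> < 1 / real (Suc k))" for k
    unfolding pred_def Collect_bex_conj
    by (intro sets.countable_UN'' countable_subset[OF Int_lower1 countable_rat])
  then have "Measurable.pred Q
      (\<lambda>z. \<forall>k::nat. \<exists>s\<in>\<rat> \<inter> {0..t}. \<bar>U s z - V s z\<bar> < 1 / real (Suc k))"
    by (intro pred_intros_countable)
  moreover have "(\<lambda>z. g (U t z) * g (V t z)) \<in> borel_measurable Q"
    by (rule borel_measurable_times[OF measurable_compose[OF U[OF t] g] measurable_compose[OF V[OF t] g]])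
  ultimately show ?thesis
    unfolding pred_def by (intro measurable_If borel_measurable_const)
qed

lemma traj_value_measurable:
  assumes g: "g \<in> borel_measurable borel" and ij: "i < N" "j < N" and t: "0 \<le> t"
  shows "(\<lambda>z. traj_value g t z i j) \<in> borel_measurable (traj_space N)"
  unfolding traj_value_def by (intro indicator_meet_measurable[OF g t] measurable_traj_component ij)

lemma pf_term_traj_measurable:
  assumes g: "g \<in> borel_measurable borel" and p: "p permutes {..<2 * n}" and t: "0 \<le> t"
  shows "(\<lambda>z. pf_term n (traj_value g t z) p) \<in> borel_measurable (traj_space (2 * n))"
proof -
  have "(\<lambda>z. skew_matrix (traj_value g t z) i j) \<in> borel_measurable (traj_space (2 * n))"
    if "i < 2 * n" "j < 2 * n" for i j
  proof -
    note m = traj_value_measurable[OF g that t] traj_value_measurable[OF g that(2,1) t]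
    show ?thesis using m unfolding skew_matrix_def
      by (cases i j rule: linorder_cases) (simp_all add: borel_measurable_uminus)
  qed
  moreover have "p x < 2 * n" if "x < 2 * n" for x
    using permutes_in_image[OF p, of x] that by simp
  ultimately show ?thesis
    unfolding pf_term_def by (intro borel_measurable_times borel_measurable_prod borel_measurable_const) auto
qed

lemma pf_term_bounded:
  assumes "\<And>i j. \<bar>f i j\<bar> \<le> D" "0 \<le> D"
  shows "\<bar>pf_term n f p\<bar> \<le> D ^ n"
proof -
  have "\<bar>skew_matrix f i j\<bar> \<le> D" for i j using assms by (simp add: skew_matrix_def)
  then have "(\<Prod>k<n. \<bar>skew_matrix f (p (2 * k)) (p (2 * k + 1))\<bar>) \<le> (\<Prod>k<n. D)"
    by (intro prod_mono) auto
  moreover have "\<bar>of_int (sign p) :: real\<bar> = 1" by (simp add: sign_def)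
  ultimately show ?thesis by (simp add: pf_term_def abs_mult abs_prod)
qed

lemma pair_value_bounded:
  assumes "\<And>x. \<bar>g x\<bar> \<le> C" "1 \<le> C"
  shows "\<bar>pair_value g t w i j\<bar> \<le> C * C"
proof -
  have "\<bar>g x * g y\<bar> \<le> C * C" for x y
    unfolding abs_mult using assms by (intro mult_mono) auto
  moreover have "1 * 1 \<le> C * C" using assms by (intro mult_mono) auto
  ultimately show ?thesis by (simp add: pair_value_def)
qed

lemma swap_at_first_meet:
  assumes eq: "w a T = w b T"
  shows "s \<le> T \<Longrightarrow> swap_after (Transposition.transpose a b) T w i s = w i s"
    and "T \<le> s \<Longrightarrow> swap_after (Transposition.transpose a b) T w i s = w (Transposition.transpose a b i) s"
  using eq by (auto simp: swap_after_def Transposition.transpose_def)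

lemma continuous_swap_at_first_meet:
  assumes eq: "w a T = w b T" and T: "0 \<le> T"
    and c: "continuous_on {0..} (w i)" "continuous_on {0..} (w (Transposition.transpose a b i))"
  shows "continuous_on {0..} (swap_after (Transposition.transpose a b) T w i)"
proof -
  let ?Y = "swap_after (Transposition.transpose a b) T w i"
  have "{0..} = {0..T} \<union> {T..}" using T by auto
  moreover have "continuous_on {0..T} ?Y"
    using swap_at_first_meet(1)[where w=w, OF eq] continuous_on_subset[OF c(1), of "{0..T}"]
    by (subst continuous_on_cong[where g="w i"]) auto
  moreover have "continuous_on {T..} ?Y"
    using swap_at_first_meet(2)[where w=w, OF eq] continuous_on_subset[OF c(2), of "{T..}"] T
    by (subst continuous_on_cong[where g="w (Transposition.transpose a b i)"]) auto
  ultimately show ?thesis by (simp add: continuous_on_closed_Un)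
qed

text \<open>Up to the first meeting neither \<open>{i, j}\<close> nor its image under the
  transposition has met, so neither side sees a meeting there; afterwards the new paths are the
  relabelled old ones.\<close>

lemma pair_value_swap:
  assumes t: "0 \<le> t" and c: "\<And>i. i \<in> A \<Longrightarrow> continuous_on {0..} (w i)"
    and ab: "a \<in> A" "b \<in> A" "a \<noteq> b" and f: "first_pair w t A a b"
    and ij: "i \<in> A" "j \<in> A" "i \<noteq> j" "{i, j} \<noteq> {a, b}"
  shows "pair_value g t (swap_after (Transposition.transpose a b) (first_meet w t a b) w) i j =
    pair_value g t w (Transposition.transpose a b i) (Transposition.transpose a b j)"
proof -
  let ?\<sigma> = "Transposition.transpose a b" and ?T = "first_meet w t a b"
  let ?Y = "swap_after ?\<sigma> ?T w"
  have eq: "w a ?T = w b ?T" by (rule first_meet_attained'[OF t c ab(1,2) f])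
  have Tt: "?T \<le> t" using f by (simp add: first_pair_def)
  have \<sigma>: "?\<sigma> i \<in> A" "?\<sigma> j \<in> A" "?\<sigma> i \<noteq> ?\<sigma> j" "{?\<sigma> i, ?\<sigma> j} \<noteq> {a, b}"
    using ab ij by (auto simp: Transposition.transpose_def doubleton_eq_iff)
  have "(\<exists>s\<in>{0..t}. ?Y i s = ?Y j s) \<longleftrightarrow> (\<exists>s\<in>{0..t}. w (?\<sigma> i) s = w (?\<sigma> j) s)"
  proof (intro bex_cong refl)
    fix s assume s: "s \<in> {0..t}"
    show "?Y i s = ?Y j s \<longleftrightarrow> w (?\<sigma> i) s = w (?\<sigma> j) s"
    proof (cases "s \<le> ?T")
      case True
      have "w i s \<noteq> w j s" using first_pair_only[OF t f ij(1-3) _ _ True] ij(4) s by auto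
      moreover have "w (?\<sigma> i) s \<noteq> w (?\<sigma> j) s"
        using first_pair_only[OF t f \<sigma>(1-3) _ _ True] \<sigma>(4) s by auto
      ultimately show ?thesis using swap_at_first_meet(1)[where w=w, OF eq True] by simp
    next
      case False
      then show ?thesis using swap_at_first_meet(2)[where w=w, OF eq, of s] by simp
    qed
  qed
  then show ?thesis
    using swap_at_first_meet(2)[where w=w, OF eq Tt] by (simp add: pair_value_def)
qed

lemma pair_value_swap_fixed:
  assumes "i \<notin> {a, b}" "j \<notin> {a, b}"
  shows "pair_value g t (swap_after (Transposition.transpose a b) T w) i j = pair_value g t w i j"
proof -
  have "swap_after (Transposition.transpose a b) T w k = w k" if "k \<notin> {a, b}" for k
    using that by (auto simp: swap_after_def fun_eq_iff)
  then show ?thesis using assms by (simp add: pair_value_def)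
qed

text \<open>Every index of \<open>A\<close> lies in exactly one block, and this block is outside
  \<open>H\<close>. Each matching therefore contributes the same product of the
  \<open>v i\<close>.\<close>

lemma pf_sum_no_pair:
  assumes A: "A = {..<2 * n} - \<Union>H"
    and one: "\<And>i j. {i, j} \<in> H \<Longrightarrow> f i j = 1"
    and val: "\<And>i j. i \<in> A \<Longrightarrow> j \<in> A \<Longrightarrow> i \<noteq> j \<Longrightarrow> f i j = v i * v j"
  shows "pf_sum n H f = pf_sum n H (\<lambda>_ _. 1) * (\<Prod>i\<in>A. v i)"
proof -
  \<comment> \<open>The value 1 on prescribed pairs lets the blocks of \<open>H\<close> be treated
    like all others.\<close>
  define u where "u i = (if i \<in> A then v i else 1)" for i
  have "pf_term n f p = pf_term n (\<lambda>_ _. 1) p * (\<Prod>i\<in>A. v i)" if p: "p \<in> matching_perms n H" for p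
  proof -
    have pp: "p permutes {..<2 * n}" using p by (simp add: matching_perms_def)
    have "skew_matrix f (p (2 * k)) (p (2 * k + 1)) =
        skew_matrix (\<lambda>_ _. 1) (p (2 * k)) (p (2 * k + 1)) * (u (p (2 * k)) * u (p (2 * k + 1)))"
      if k: "k < n" for k
    proof -
      define i j where "i = p (2 * k)" and "j = p (2 * k + 1)"
      have ij: "i \<noteq> j" unfolding i_def j_def using permutes_inj[OF pp] by (simp add: inj_eq)
      have lt: "i < 2 * n" "j < 2 * n"
        unfolding i_def j_def using permutes_in_image[OF pp] k by auto
      have "f i j = u i * u j \<and> f j i = u i * u j"
      proof (cases "{i, j} \<in> H")
        case True
        then have "i \<notin> A" "j \<notin> A" using A by auto
        then show ?thesis using one[of i j] one[of j i] True by (simp add: u_def insert_commute)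
      next
        case False
        have "x \<in> A" if x: "x \<in> {i, j}" for x
        proof (rule ccontr)
          assume "x \<notin> A"
          then obtain h where "h \<in> H" "x \<in> h" using A lt x by auto
          then have "{i, j} = h"
            using matching_perms_block[OF p k, of x h] x by (simp add: i_def j_def)
          then show False using False \<open>h \<in> H\<close> by simp
        qed
        then show ?thesis using val[of i j] val[of j i] ij by (simp add: u_def mult.commute)
      qed
      then show ?thesis unfolding i_def[symmetric] j_def[symmetric] by (simp add: skew_matrix_def)
    qed
    then have "pf_term n f p = pf_term n (\<lambda>_ _. 1) p * (\<Prod>k<n. u (p (2 * k)) * u (p (2 * k + 1)))"
      by (simp add: pf_term_def prod.distrib)
    also have "(\<Prod>k<n. u (p (2 * k)) * u (p (2 * k + 1))) = (\<Prod>x<2 * n. u (p x))"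
      by (induction n) (simp_all add: algebra_simps)
    also have "\<dots> = (\<Prod>x<2 * n. u x)"
      using prod.permute[OF pp, of u] by (simp add: comp_def)
    also have "\<dots> = (\<Prod>i\<in>A. v i)"
      by (rule prod.mono_neutral_cong_right) (auto simp: u_def A)
    finally show ?thesis .
  qed
  then show ?thesis unfolding pf_sum_def sum_distrib_right by (intro sum.cong) auto
qed

text \<open>A round is expressed by comparisons of meeting times alone, which makes it measurable.
  Simultaneous meetings are allowed, so the description holds for every outcome: in a round with a
  meeting, a particle survives when none of its meeting times is the minimum over all pairs.\<close>

lemma annihilate_by_first_meet:
  assumes t: "0 \<le> t" and fin: "finite A" and c: "\<And>i. i \<in> A \<Longrightarrow> continuous_on {0..} (w i)"
  shows "annihilate w t A = (if no_pair w t A then A else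
    {i \<in> A. \<forall>j\<in>A. j \<noteq> i \<longrightarrow> (\<exists>k\<in>A. \<exists>l\<in>A. k \<noteq> l \<and> first_meet w t k l < first_meet w t i j)})"
proof (cases "no_pair w t A")
  case True
  have "(annihilate w t ^^ 1) A = A" by (rule annihilate_no_pair[OF t c True])
  then have "annihilate w t A = A" by simp
  then show ?thesis using True by (simp only: if_True)
next
  case False
  define m where "m = Inf (meet_times w t A)"
  have "no_pair w t A \<longleftrightarrow> meet_times w t A = {}" by (rule no_pair_iff[OF t c])
  then have ne: "meet_times w t A \<noteq> {}" using False by simp
  have m: "m \<in> meet_times w t A" unfolding m_def by (rule Inf_meet_times[OF fin c ne])
  have le: "m \<le> s" if "s \<in> meet_times w t A" for s
    unfolding m_def using that by (intro cInf_lower bdd_belowI[of _ 0]) (auto simp: meet_times_def)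
  have mt: "0 \<le> m" "m \<le> t" using m by (auto simp: meet_times_def)
  have mem: "m \<le> first_meet w t k l" "w k (first_meet w t k l) = w l (first_meet w t k l)"
    if "k \<in> A" "l \<in> A" "k \<noteq> l" "first_meet w t k l \<le> t" for k l
  proof -
    show "w k (first_meet w t k l) = w l (first_meet w t k l)"
      using that by (intro first_meet_attained[OF t c c]) auto
    then show "m \<le> first_meet w t k l"
      using that first_meet_bounds(1)[OF t, of w k l] by (intro le) (auto simp: meet_times_def)
  qed
  have iff: "w j m \<noteq> w i m \<longleftrightarrow> (\<exists>k\<in>A. \<exists>l\<in>A. k \<noteq> l \<and> first_meet w t k l < first_meet w t i j)"
    if ij: "i \<in> A" "j \<in> A" "j \<noteq> i" for i j
  proof
    assume n: "w j m \<noteq> w i m"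
    obtain k l where kl: "k \<in> A" "l \<in> A" "k \<noteq> l" "w k m = w l m"
      using m by (auto simp: meet_times_def)
    have "first_meet w t k l \<le> m" using first_meet_le[of m t w k l] mt kl t by simp
    moreover have "m < first_meet w t i j"
    proof (rule ccontr)
      assume "\<not> m < first_meet w t i j"
      then have "first_meet w t i j \<le> m" by simp
      then have "m = first_meet w t i j" using mem(1)[of i j] ij mt by simp
      then show False using mem(2)[of i j] ij mt n by simp
    qed
    ultimately show "\<exists>k\<in>A. \<exists>l\<in>A. k \<noteq> l \<and> first_meet w t k l < first_meet w t i j"
      using kl(1-3) by (meson le_less_trans)
  next
    assume "\<exists>k\<in>A. \<exists>l\<in>A. k \<noteq> l \<and> first_meet w t k l < first_meet w t i j"
    then obtain k l where kl: "k \<in> A" "l \<in> A" "k \<noteq> l" "first_meet w t k l < first_meet w t i j" by blast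
    show "w j m \<noteq> w i m"
    proof
      assume "w j m = w i m"
      then have "first_meet w t i j \<le> m" using first_meet_le[of m t w i j] mt t by simp
      then have "first_meet w t k l < m" using kl(4) by simp
      then show False using mem(1)[OF kl(1-3)] mt by simp
    qed
  qed
  have "{i \<in> A. \<forall>j\<in>A. j \<noteq> i \<longrightarrow> w j m \<noteq> w i m} =
      {i \<in> A. \<forall>j\<in>A. j \<noteq> i \<longrightarrow> (\<exists>k\<in>A. \<exists>l\<in>A. k \<noteq> l \<and> first_meet w t k l < first_meet w t i j)}"
    by (intro Collect_cong conj_cong ball_cong imp_cong refl iff)
  then show ?thesis using False ne unfolding annihilate_def m_def[symmetric] by simp
qed

lemma funpow_annihilate_subset: "(annihilate w t ^^ m) A \<subseteq> A"
proof (induction m)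
  case (Suc m)
  then show ?case using annihilate_subset[of w t "(annihilate w t ^^ m) A"] by simp
qed simp

text \<open>Truncation at \<open>q\<close> does not disturb a comparison whose left side is below
  \<open>q\<close>.\<close>

lemma trunc_simps:
  fixes x y q :: real
  shows "min x q < q \<longleftrightarrow> x < q"
    and "x < q \<Longrightarrow> min x q \<le> min y q \<longleftrightarrow> x \<le> y"
    and "x < q \<Longrightarrow> min x q < min y q \<longleftrightarrow> x < y"
    and "x < q \<Longrightarrow> min x q \<le> c \<longleftrightarrow> x \<le> c"
  by (auto simp: min_def)

text \<open>Exhibits a two-particle system inside the large one, whose law can be compared with that
  of the separate system defining the two-point moment.\<close>

lemma ibm_subsystem:
  assumes ibm: "independent_brownian_motions M xs W"
    and ij: "i < length xs" "j < length xs" "i \<noteq> j"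
  shows "independent_brownian_motions M [xs ! i, xs ! j] (\<lambda>k. W (if k = 0 then i else j))"
proof -
  interpret prob_space M using ibm by (rule ibm_prob_space)
  let ?r = "\<lambda>k::nat. if k = 0 then i else j"
  let ?P = "\<Pi>\<^sub>M t\<in>{0::real..}. (borel :: real measure)"
  have ind: "indep_vars (\<lambda>_. ?P) (\<lambda>i \<omega>. \<lambda>t\<in>{0..}. W i t \<omega>) {..<length xs}"
    using ibm by (simp add: independent_brownian_motions_def)
  have "indep_vars (\<lambda>k. \<Pi>\<^sub>M _\<in>{?r k}. ?P) (\<lambda>k \<omega>. \<lambda>i\<in>{?r k}. \<lambda>t\<in>{0..}. W i t \<omega>) {..<2}"
    by (rule indep_vars_restrict[OF ind]) (use ij in \<open>auto simp: disjoint_family_on_def\<close>)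
  then have "indep_vars (\<lambda>k. ?P) (\<lambda>k \<omega>. (\<lambda>i\<in>{?r k}. \<lambda>t\<in>{0..}. W i t \<omega>) (?r k)) {..<2}"
    by (rule indep_vars_compose2) (intro measurable_component_singleton, simp)
  then have "indep_vars (\<lambda>k. ?P) (\<lambda>k \<omega>. \<lambda>t\<in>{0..}. W (?r k) t \<omega>) {..<2}" by simp
  moreover have "brownian_motion M ([xs ! i, xs ! j] ! k) (W (?r k))" if "k < 2" for k
    using that ibm_brownian[OF ibm ij(1)] ibm_brownian[OF ibm ij(2)] by (auto simp: less_2_cases_iff)
  ultimately show ?thesis
    unfolding independent_brownian_motions_def using prob_space_axioms by (simp add: numeral_2_eq_2)
qed

text \<open>Of two particles either both survive or neither does; these are the two branches of
  \<open>pair_value\<close>.\<close>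

lemma survivors_two:
  assumes t: "0 \<le> t" and c: "\<And>i. i < 2 \<Longrightarrow> continuous_on {0..} (w i)"
  shows "(\<Prod>i\<in>survivors w 2 t. g (w i t)) = pair_value g t w 0 1"
proof -
  have set2: "{..<2::nat} = {0, 1}" by auto
  have c': "continuous_on {0..} (w i)" if "i \<in> {0, 1::nat}" for i using c[of i] that by auto
  show ?thesis
  proof (cases "no_pair w t {0, 1}")
    case True
    have "survivors w 2 t = {0, 1}"
      unfolding survivors_def set2 by (rule annihilate_no_pair[where w=w, OF t c' True])
    moreover have "meet_times w t {0, 1} = {}"
      using no_pair_iff[where w=w and A="{0, 1}", OF t c'] True by simp
    then have "\<not> (\<exists>s\<in>{0..t}. w 0 s = w 1 s)"
      unfolding meet_times_def by fastforce
    ultimately show ?thesis by (simp add: pair_value_def)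
  next
    case False
    then have T: "first_meet w t 0 1 \<le> t"
      by (auto simp: no_pair_def not_less first_meet_sym[of w t "Suc 0" 0])
    have f: "first_pair w t {0, 1} 0 1"
      using T by (auto simp: first_pair_def doubleton_eq_iff)
    have "annihilate w t {0, 1} = {0, 1} - {0, 1}"
      by (rule annihilate_first_pair[where w=w, OF t c' _ _ _ f]) auto
    moreover have "annihilate w t {} = {}" using annihilate_subset[of w t "{}"] by simp
    moreover have "survivors w 2 t = annihilate w t (annihilate w t {0, 1})"
      unfolding survivors_def set2 by (simp add: numeral_2_eq_2)
    ultimately have "survivors w 2 t = {}" by simp
    moreover have "w 0 (first_meet w t 0 1) = w 1 (first_meet w t 0 1)"
      by (rule first_meet_attained'[where w=w, OF t c' _ _ f]) auto
    then have "\<exists>s\<in>{0..t}. w 0 s = w 1 s"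
      using T first_meet_bounds(1)[OF t] by (intro bexI[of _ "first_meet w t 0 1"]) auto
    ultimately show ?thesis by (simp add: pair_value_def)
  qed
qed

section \<open>The annihilating system\<close>

text \<open>The bound \<open>C\<close> is at least 1 so that its powers dominate both branches of
  \<open>pair_value\<close> and the products over all sets of survivors.\<close>

locale annihilating =
  fixes M :: "'a measure" and xs :: "real list" and W :: "nat \<Rightarrow> real \<Rightarrow> 'a \<Rightarrow> real"
    and n :: nat and t :: real and g :: "real \<Rightarrow> real" and C :: real
  assumes ibm: "independent_brownian_motions M xs W" and len: "length xs = 2 * n"
    and sorted: "sorted_wrt (<) xs" and t: "0 < t"
    and g: "g \<in> borel_measurable borel" and gC: "\<And>x. \<bar>g x\<bar> \<le> C" and C: "1 \<le> C"
begin

sublocale prob_space M using ibm by (rule ibm_prob_space)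

abbreviation paths :: "'a \<Rightarrow> nat \<Rightarrow> real \<Rightarrow> real" where "paths \<omega> \<equiv> \<lambda>i s. W i s \<omega>"
abbreviation T :: "'a \<Rightarrow> nat \<Rightarrow> nat \<Rightarrow> real" where "T \<omega> \<equiv> first_meet (paths \<omega>) t"
abbreviation pv :: "'a \<Rightarrow> nat \<Rightarrow> nat \<Rightarrow> real" where "pv \<omega> \<equiv> pair_value g t (paths \<omega>)"

lemma t0: "0 \<le> t" using t by simp

lemma N: "2 * n = length xs" by (simp add: len)

lemma W_measurable: "i < 2 * n \<Longrightarrow> 0 \<le> s \<Longrightarrow> W i s \<in> borel_measurable M"
  using ibm_measurable[OF ibm] len by simp

lemma W_continuous: "\<omega> \<in> space M \<Longrightarrow> i < 2 * n \<Longrightarrow> continuous_on {0..} (paths \<omega> i)"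
  using ibm_continuous[OF ibm] len by simp

lemma W_order: "\<omega> \<in> space M \<Longrightarrow> i < j \<Longrightarrow> j < 2 * n \<Longrightarrow> paths \<omega> i 0 < paths \<omega> j 0"
  using ibm_start[OF ibm] len sorted by (simp add: sorted_wrt_iff_nth_less)

lemma T_measurable: "i < 2 * n \<Longrightarrow> j < 2 * n \<Longrightarrow> (\<lambda>\<omega>. T \<omega> i j) \<in> borel_measurable M"
  by (rule first_meet_measurable[OF ibm N t0])

lemma g_measurable: "i < 2 * n \<Longrightarrow> (\<lambda>\<omega>. g (W i t \<omega>)) \<in> borel_measurable M"
  by (rule measurable_compose[OF W_measurable g]) (use t in auto)

lemma paths_trajectory_measurable: "(\<lambda>\<omega>. traj (2 * n) (paths \<omega>)) \<in> measurable M (traj_space (2 * n))"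
  by (rule measurable_traj) (rule W_measurable)

lemma pf_term_cong:
  assumes "p permutes {..<2 * n}" "\<And>i j. i < 2 * n \<Longrightarrow> j < 2 * n \<Longrightarrow> f i j = f' i j"
  shows "pf_term n f p = pf_term n f' p"
proof -
  have "p x < 2 * n" if "x < 2 * n" for x using permutes_in_image[OF assms(1), of x] that by simp
  then show ?thesis unfolding pf_term_def using assms(2)
    by (intro arg_cong2[where f="(*)"] refl prod.cong) (auto simp: skew_matrix_def)
qed

lemma pf_term_paths:
  assumes p: "p permutes {..<2 * n}" and c: "\<And>i. i < 2 * n \<Longrightarrow> continuous_on {0..} (w i)"
  shows "pf_term n (traj_value g t (traj (2 * n) w)) p = pf_term n (pair_value g t w) p"
  by (rule pf_term_cong[OF p]) (use traj_value_eq t0 c in auto)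

lemma pf_term_measurable:
  assumes "p permutes {..<2 * n}"
  shows "(\<lambda>\<omega>. pf_term n (pv \<omega>) p) \<in> borel_measurable M"
proof -
  have "(\<lambda>\<omega>. pf_term n (traj_value g t (traj (2 * n) (paths \<omega>))) p) \<in> borel_measurable M"
    by (rule measurable_compose[OF paths_trajectory_measurable pf_term_traj_measurable[OF g assms t0]])
  then show ?thesis
    by (subst measurable_cong[where g="\<lambda>\<omega>. pf_term n (traj_value g t (traj (2 * n) (paths \<omega>))) p"])
       (simp_all add: pf_term_paths[OF assms W_continuous])
qed

lemma pf_term_integrable:
  assumes E: "E \<in> events" and p: "p permutes {..<2 * n}"
  shows "integrable M (\<lambda>\<omega>. indicator E \<omega> * pf_term n (pv \<omega>) p)"
proof (rule integrable_const_bound[where B="(C * C) ^ n"])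
  have "\<bar>pf_term n (pv \<omega>) p\<bar> \<le> (C * C) ^ n" for \<omega>
    using C by (intro pf_term_bounded pair_value_bounded[OF gC C]) simp
  then show "AE \<omega> in M. norm (indicator E \<omega> * pf_term n (pv \<omega>) p) \<le> (C * C) ^ n"
    using C by (intro AE_I2) (auto simp: indicator_def)
  show "(\<lambda>\<omega>. indicator E \<omega> * pf_term n (pv \<omega>) p) \<in> borel_measurable M"
    using E pf_term_measurable[OF p] by (intro borel_measurable_times) auto
qed

lemma sum_pf_term_integrable:
  assumes E: "E \<in> events" and D: "D \<subseteq> matching_perms n H"
  shows "integrable M (\<lambda>\<omega>. indicator E \<omega> * (\<Sum>p\<in>D. pf_term n (pv \<omega>) p))"
  unfolding sum_distrib_left using D
  by (intro Bochner_Integration.integrable_sum pf_term_integrable[OF E]) (auto simp: matching_perms_def)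

section \<open>Measurability of the annihilation rounds\<close>

lemma pred_T_less: "i < 2 * n \<Longrightarrow> j < 2 * n \<Longrightarrow> k < 2 * n \<Longrightarrow> l < 2 * n \<Longrightarrow>
    Measurable.pred M (\<lambda>\<omega>. T \<omega> i j < T \<omega> k l)"
  by (intro borel_measurable_pred_less T_measurable)

lemma pred_no_pair:
  assumes "A \<subseteq> {..<2 * n}"
  shows "Measurable.pred M (\<lambda>\<omega>. no_pair (paths \<omega>) t A)"
proof -
  have "finite A" using assms finite_subset by blast
  then show ?thesis
    unfolding no_pair_def using assms
    by (intro pred_intros_finite pred_intros_imp' borel_measurable_pred_less T_measurable
        borel_measurable_const) auto
qed

lemma pred_first_pair:
  assumes "A \<subseteq> {..<2 * n}" "a \<in> A" "b \<in> A"
  shows "Measurable.pred M (\<lambda>\<omega>. first_pair (paths \<omega>) t A a b)"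
proof -
  have "finite A" using assms finite_subset by blast
  then show ?thesis
    unfolding first_pair_def using assms
    by (intro pred_intros_logic(2-4) pred_intros_finite pred_intros_imp' pred_le_real pred_T_less T_measurable
        borel_measurable_const) auto
qed

lemma annihilate_sets:
  assumes A: "A \<subseteq> {..<2 * n}"
  shows "{\<omega>\<in>space M. annihilate (paths \<omega>) t A = S} \<in> events"
proof -
  have fin: "finite A" using A finite_subset by blast
  let ?Q = "\<lambda>\<omega> i. \<forall>j\<in>A. j \<noteq> i \<longrightarrow> (\<exists>k\<in>A. \<exists>l\<in>A. k \<noteq> l \<and> T \<omega> k l < T \<omega> i j)"
  have Q: "Measurable.pred M (\<lambda>\<omega>. ?Q \<omega> i)" if "i \<in> A" for i
    using A fin that
    by (intro pred_intros_finite pred_intros_imp' pred_intros_conj1' pred_T_less) auto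
  have "Measurable.pred M (\<lambda>\<omega>. no_pair (paths \<omega>) t A \<and> A = S \<or>
      \<not> no_pair (paths \<omega>) t A \<and> (S \<subseteq> A \<and> (\<forall>i\<in>A. i \<in> S \<longleftrightarrow> ?Q \<omega> i)))"
    using fin by (intro pred_intros_logic pred_no_pair[OF A] pred_intros_finite Q measurable_const) auto
  moreover have "{\<omega>\<in>space M. annihilate (paths \<omega>) t A = S} =
      {\<omega>\<in>space M. no_pair (paths \<omega>) t A \<and> A = S \<or>
      \<not> no_pair (paths \<omega>) t A \<and> (S \<subseteq> A \<and> (\<forall>i\<in>A. i \<in> S \<longleftrightarrow> ?Q \<omega> i))}"
  proof (intro Collect_cong conj_cong refl)
    fix \<omega> assume "\<omega> \<in> space M"
    then have "annihilate (paths \<omega>) t A = (if no_pair (paths \<omega>) t A then A else {i \<in> A. ?Q \<omega> i})"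
      using A by (intro annihilate_by_first_meet[OF t0 fin W_continuous]) auto
    then show "annihilate (paths \<omega>) t A = S \<longleftrightarrow> no_pair (paths \<omega>) t A \<and> A = S \<or>
      \<not> no_pair (paths \<omega>) t A \<and> (S \<subseteq> A \<and> (\<forall>i\<in>A. i \<in> S \<longleftrightarrow> ?Q \<omega> i))" by auto
  qed
  ultimately show ?thesis by (simp add: pred_def)
qed

lemma funpow_annihilate_sets:
  assumes A: "A \<subseteq> {..<2 * n}"
  shows "{\<omega>\<in>space M. (annihilate (paths \<omega>) t ^^ m) A = S} \<in> events"
proof (induction m arbitrary: S)
  case 0
  then show ?case by simp
next
  case (Suc m)
  have "{\<omega>\<in>space M. (annihilate (paths \<omega>) t ^^ Suc m) A = S} =
      (\<Union>R\<in>Pow A. {\<omega>\<in>space M. (annihilate (paths \<omega>) t ^^ m) A = R} \<inter> {\<omega>\<in>space M. annihilate (paths \<omega>) t R = S})"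
  proof (intro set_eqI iffI)
    fix \<omega> assume "\<omega> \<in> {\<omega>\<in>space M. (annihilate (paths \<omega>) t ^^ Suc m) A = S}"
    then show "\<omega> \<in> (\<Union>R\<in>Pow A. {\<omega>\<in>space M. (annihilate (paths \<omega>) t ^^ m) A = R} \<inter>
        {\<omega>\<in>space M. annihilate (paths \<omega>) t R = S})"
      using funpow_annihilate_subset by (intro UN_I[of "(annihilate (paths \<omega>) t ^^ m) A"]) auto
  qed auto
  moreover have "finite (Pow A)" using A finite_subset by blast
  ultimately show ?case
    using A Suc by (auto intro!: sets.finite_UN sets.Int annihilate_sets)
qed

definition surv_prod :: "nat \<Rightarrow> nat set \<Rightarrow> 'a \<Rightarrow> real" where
  "surv_prod m A \<omega> = (\<Prod>i\<in>(annihilate (paths \<omega>) t ^^ m) A. g (W i t \<omega>))"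

lemma surv_prod_integrable:
  assumes E: "E \<in> events" and A: "A \<subseteq> {..<2 * n}"
  shows "integrable M (\<lambda>\<omega>. indicator E \<omega> * surv_prod m A \<omega>)"
proof (rule integrable_const_bound[where B="C ^ card A"])
  have fin: "finite A" using A finite_subset by blast
  have "\<bar>surv_prod m A \<omega>\<bar> \<le> C ^ card A" for \<omega>
  proof -
    let ?S = "(annihilate (paths \<omega>) t ^^ m) A"
    have "\<bar>surv_prod m A \<omega>\<bar> \<le> (\<Prod>i\<in>?S. C)"
      unfolding surv_prod_def abs_prod using gC by (intro prod_mono) auto
    also have "\<dots> \<le> C ^ card A"
      using C funpow_annihilate_subset fin by (simp add: power_increasing card_mono)
    finally show ?thesis .
  qed
  then show "AE \<omega> in M. norm (indicator E \<omega> * surv_prod m A \<omega>) \<le> C ^ card A"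
    using C by (intro AE_I2) (auto simp: indicator_def)
  \<comment> \<open>The random set of survivors has finitely many possible values, so the product
    over it is a finite sum over these values.\<close>
  have "(\<lambda>\<omega>. \<Sum>S\<in>Pow A. indicator {\<omega>\<in>space M. (annihilate (paths \<omega>) t ^^ m) A = S} \<omega> * (\<Prod>i\<in>S. g (W i t \<omega>)))
      \<in> borel_measurable M"
    using A by (intro borel_measurable_sum borel_measurable_times borel_measurable_prod g_measurable
        borel_measurable_indicator funpow_annihilate_sets) auto
  moreover have "surv_prod m A \<omega> =
      (\<Sum>S\<in>Pow A. indicator {\<omega>\<in>space M. (annihilate (paths \<omega>) t ^^ m) A = S} \<omega> * (\<Prod>i\<in>S. g (W i t \<omega>)))"
    if "\<omega> \<in> space M" for \<omega>
  proof -
    let ?S = "(annihilate (paths \<omega>) t ^^ m) A"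
    have "(\<Sum>S\<in>Pow A. indicator {\<omega>\<in>space M. (annihilate (paths \<omega>) t ^^ m) A = S} \<omega> * (\<Prod>i\<in>S. g (W i t \<omega>))) =
        (\<Sum>S\<in>Pow A. if S = ?S then (\<Prod>i\<in>?S. g (W i t \<omega>)) else 0)"
      using that by (intro sum.cong) (auto simp: indicator_def)
    also have "\<dots> = surv_prod m A \<omega>"
      using fin funpow_annihilate_subset by (simp add: surv_prod_def)
    finally show ?thesis by simp
  qed
  ultimately have "surv_prod m A \<in> borel_measurable M" by (simp cong: measurable_cong)
  then show "(\<lambda>\<omega>. indicator E \<omega> * surv_prod m A \<omega>) \<in> borel_measurable M"
    using E by (intro borel_measurable_times) auto
qed

text \<open>The inequality is weak because the quantifiers also run over \<open>a, b\<close> itself,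
  in both orders.\<close>

definition before_first :: "'a set \<Rightarrow> nat set \<Rightarrow> nat \<Rightarrow> nat \<Rightarrow> real \<Rightarrow> 'a set" where
  "before_first E A a b q = {\<omega>\<in>E. T \<omega> a b < q \<and> (\<forall>i\<in>A. \<forall>j\<in>A. i \<noteq> j \<longrightarrow> T \<omega> a b \<le> T \<omega> i j)}"

text \<open>The event \<open>E\<close> is decided no later than at the first meeting among the particles in \<open>A\<close>.\<close>

definition decided :: "'a set \<Rightarrow> nat set \<Rightarrow> bool" where
  "decided E A \<longleftrightarrow> E \<in> events \<and>
    (\<forall>a\<in>A. \<forall>b\<in>A. \<forall>q. a \<noteq> b \<longrightarrow> before_first E A a b q \<in> sets (past M (2 * n) W q))"

definition first_event :: "'a set \<Rightarrow> nat set \<Rightarrow> nat \<Rightarrow> nat \<Rightarrow> 'a set" where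
  "first_event E A a b = {\<omega>\<in>E. first_pair (paths \<omega>) t A a b}"

definition quiet_event :: "'a set \<Rightarrow> nat set \<Rightarrow> 'a set" where
  "quiet_event E A = {\<omega>\<in>E. no_pair (paths \<omega>) t A}"

section \<open>Histories known at the first meeting\<close>

lemma trunc_measurable: "i < 2 * n \<Longrightarrow> j < 2 * n \<Longrightarrow>
    (\<lambda>\<omega>. min (T \<omega> i j) q) \<in> borel_measurable (past M (2 * n) W q)"
  by (rule first_meet_trunc_measurable[OF ibm N t0])

lemma decided_space: "decided (space M) {..<2 * n}"
  unfolding decided_def
proof (intro conjI ballI allI impI)
  fix a b q assume ab: "a \<in> {..<2 * n}" "b \<in> {..<2 * n}" "a \<noteq> b"
  let ?F = "past M (2 * n) W q"
  \<comment> \<open>All meeting times are truncated at \<open>q\<close>, which makes them measurable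
    for the past; given \<open>T \<omega> a b < q\<close> this does not change the
    comparisons.\<close>
  have "Measurable.pred ?F (\<lambda>\<omega>. min (T \<omega> a b) q < q \<and>
      (\<forall>i\<in>{..<2 * n}. \<forall>j\<in>{..<2 * n}. i \<noteq> j \<longrightarrow> min (T \<omega> a b) q \<le> min (T \<omega> i j) q))"
    using ab by (intro pred_intros_logic pred_intros_finite pred_intros_imp' borel_measurable_pred_less
        pred_le_real trunc_measurable borel_measurable_const) auto
  moreover have "before_first (space M) {..<2 * n} a b q = {\<omega>\<in>space ?F. min (T \<omega> a b) q < q \<and>
      (\<forall>i\<in>{..<2 * n}. \<forall>j\<in>{..<2 * n}. i \<noteq> j \<longrightarrow> min (T \<omega> a b) q \<le> min (T \<omega> i j) q)}"
    unfolding before_first_def space_past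
    by (intro Collect_cong conj_cong refl) (simp_all only: trunc_simps(1,2))
  ultimately show "before_first (space M) {..<2 * n} a b q \<in> sets ?F" by (simp only: pred_def)
qed simp

text \<open>The property of the exchange time that \<open>strong_markov_swap\<close> demands. By
  \<open>decided\<close> the event \<open>E\<close> is known at the first meeting, and whether
  \<open>a\<close> and \<open>b\<close> form the unique first pair is a comparison of truncated
  times.\<close>

lemma first_event_past:
  assumes E: "decided E A" and A: "A \<subseteq> {..<2 * n}" and ab: "a \<in> A" "b \<in> A" "a \<noteq> b"
  shows "{\<omega>\<in>first_event E A a b. T \<omega> a b < q} \<in> sets (past M (2 * n) W q)"
proof -
  let ?F = "past M (2 * n) W q"
  have fin: "finite A" using A finite_subset by blast
  have Es: "E \<subseteq> space M" using E sets.sets_into_space by (auto simp: decided_def)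
  let ?R = "{\<omega>\<in>space ?F. min (T \<omega> a b) q \<le> t \<and>
    (\<forall>i\<in>A. \<forall>j\<in>A. i \<noteq> j \<longrightarrow> {i, j} \<noteq> {a, b} \<longrightarrow> min (T \<omega> a b) q < min (T \<omega> i j) q)}"
  have "Measurable.pred ?F (\<lambda>\<omega>. min (T \<omega> a b) q \<le> t \<and>
    (\<forall>i\<in>A. \<forall>j\<in>A. i \<noteq> j \<longrightarrow> {i, j} \<noteq> {a, b} \<longrightarrow> min (T \<omega> a b) q < min (T \<omega> i j) q))"
    using ab A fin by (intro pred_intros_logic(2-4) pred_intros_finite pred_intros_imp' borel_measurable_pred_less
        pred_le_real trunc_measurable borel_measurable_const) auto
  then have R: "?R \<in> sets ?F" by (simp only: pred_def)
  have "{\<omega>\<in>first_event E A a b. T \<omega> a b < q} = before_first E A a b q \<inter> ?R"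
  proof (intro set_eqI iffI)
    fix \<omega> assume \<omega>: "\<omega> \<in> {\<omega>\<in>first_event E A a b. T \<omega> a b < q}"
    then have f: "\<omega> \<in> E" "first_pair (paths \<omega>) t A a b" "T \<omega> a b < q" by (auto simp: first_event_def)
    have "T \<omega> a b \<le> T \<omega> i j" if "i \<in> A" "j \<in> A" "i \<noteq> j" for i j
    proof (cases "{i, j} = {a, b}")
      case True
      then show ?thesis by (auto simp: doubleton_eq_iff first_meet_sym)
    next
      case False
      then show ?thesis using f(2) that by (simp add: first_pair_def less_imp_le)
    qed
    moreover have "T \<omega> a b \<le> t" "\<forall>i\<in>A. \<forall>j\<in>A. i \<noteq> j \<longrightarrow> {i, j} \<noteq> {a, b} \<longrightarrow> T \<omega> a b < T \<omega> i j"
      using f(2) unfolding first_pair_def by blast+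
    moreover have "\<omega> \<in> space M" using f(1) Es by blast
    ultimately show "\<omega> \<in> before_first E A a b q \<inter> ?R"
      using f(1,3) unfolding before_first_def by (simp add: trunc_simps(3,4))
  next
    fix \<omega> assume \<omega>: "\<omega> \<in> before_first E A a b q \<inter> ?R"
    then have q: "T \<omega> a b < q" and "\<omega> \<in> E" by (simp_all add: before_first_def)
    moreover have "min (T \<omega> a b) q \<le> t"
      "\<forall>i\<in>A. \<forall>j\<in>A. i \<noteq> j \<longrightarrow> {i, j} \<noteq> {a, b} \<longrightarrow> min (T \<omega> a b) q < min (T \<omega> i j) q"
      using \<omega> by blast+
    ultimately show "\<omega> \<in> {\<omega>\<in>first_event E A a b. T \<omega> a b < q}"
      unfolding first_event_def first_pair_def trunc_simps(3,4)[OF q] by blast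
  qed
  then show ?thesis using E ab R by (auto simp: decided_def)
qed

lemma first_event_events:
  assumes E: "E \<in> events" and A: "A \<subseteq> {..<2 * n}" and ab: "a \<in> A" "b \<in> A"
  shows "first_event E A a b \<in> events"
proof -
  have "first_event E A a b = E \<inter> {\<omega>\<in>space M. first_pair (paths \<omega>) t A a b}"
    using sets.sets_into_space[OF E] by (auto simp: first_event_def)
  then show ?thesis using pred_first_pair[OF A ab] E by (auto simp: pred_def)
qed

lemma quiet_event_events:
  assumes E: "E \<in> events" and A: "A \<subseteq> {..<2 * n}"
  shows "quiet_event E A \<in> events"
proof -
  have "quiet_event E A = E \<inter> {\<omega>\<in>space M. no_pair (paths \<omega>) t A}"
    using sets.sets_into_space[OF E] by (auto simp: quiet_event_def)
  then show ?thesis using pred_no_pair[OF A] E by (auto simp: pred_def)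
qed

text \<open>On the event that \<open>a\<close> and \<open>b\<close> meet first, every remaining pair
  meets later. So when a remaining pair has met before \<open>q\<close>, then so have
  \<open>a\<close> and \<open>b\<close>, and the extended history belongs to the past at
  \<open>q\<close>.\<close>

lemma decided_first_event:
  assumes E: "decided E A" and A: "A \<subseteq> {..<2 * n}" and ab: "a \<in> A" "b \<in> A" "a \<noteq> b"
  shows "decided (first_event E A a b) (A - {a, b})"
  unfolding decided_def
proof (intro conjI ballI allI impI)
  show "first_event E A a b \<in> events"
    using E by (intro first_event_events[OF _ A ab(1,2)]) (simp add: decided_def)
  fix c d q assume cd: "c \<in> A - {a, b}" "d \<in> A - {a, b}" "c \<noteq> d"
  let ?A = "A - {a, b}" and ?F = "past M (2 * n) W q"
  have fin: "finite ?A" using A finite_subset by blast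
  let ?R = "{\<omega>\<in>space ?F. min (T \<omega> c d) q < q \<and>
    (\<forall>i\<in>?A. \<forall>j\<in>?A. i \<noteq> j \<longrightarrow> min (T \<omega> c d) q \<le> min (T \<omega> i j) q)}"
  have "Measurable.pred ?F (\<lambda>\<omega>. min (T \<omega> c d) q < q \<and>
    (\<forall>i\<in>?A. \<forall>j\<in>?A. i \<noteq> j \<longrightarrow> min (T \<omega> c d) q \<le> min (T \<omega> i j) q))"
    using cd A fin by (intro pred_intros_logic pred_intros_finite pred_intros_imp' borel_measurable_pred_less
        pred_le_real trunc_measurable borel_measurable_const) auto
  then have R: "?R \<in> sets ?F" by (simp only: pred_def)
  have "before_first (first_event E A a b) ?A c d q = {\<omega>\<in>first_event E A a b. T \<omega> a b < q} \<inter> ?R"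
  proof (intro set_eqI iffI)
    fix \<omega> assume \<omega>: "\<omega> \<in> before_first (first_event E A a b) ?A c d q"
    then have f: "\<omega> \<in> first_event E A a b" "T \<omega> c d < q"
      and le: "\<And>i j. i \<in> ?A \<Longrightarrow> j \<in> ?A \<Longrightarrow> i \<noteq> j \<Longrightarrow> T \<omega> c d \<le> T \<omega> i j"
      by (auto simp: before_first_def)
    have "T \<omega> a b < T \<omega> c d"
      using f(1) cd by (auto simp: first_event_def first_pair_def doubleton_eq_iff)
    moreover have "\<omega> \<in> space M"
      using f(1) E sets.sets_into_space by (auto simp: first_event_def decided_def)
    ultimately show "\<omega> \<in> {\<omega>\<in>first_event E A a b. T \<omega> a b < q} \<inter> ?R"
      using f le by (simp add: trunc_simps(2))
  next
    fix \<omega> assume \<omega>: "\<omega> \<in> {\<omega>\<in>first_event E A a b. T \<omega> a b < q} \<inter> ?R"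
    then have 1: "\<omega> \<in> first_event E A a b" "T \<omega> c d < q"
      by (simp_all add: trunc_simps(1))
    have 2: "min (T \<omega> c d) q \<le> min (T \<omega> i j) q" if "i \<in> ?A" "j \<in> ?A" "i \<noteq> j" for i j
      using \<omega> that by blast
    have "T \<omega> c d \<le> T \<omega> i j" if "i \<in> ?A" "j \<in> ?A" "i \<noteq> j" for i j
      using 2[OF that] by (simp only: trunc_simps(2)[OF 1(2)])
    then show "\<omega> \<in> before_first (first_event E A a b) ?A c d q"
      using 1 by (simp add: before_first_def)
  qed
  then show "before_first (first_event E A a b) ?A c d q \<in> sets ?F"
    using first_event_past[OF E A ab, of q] R by auto
qed

text \<open>Exchanging the particles \<open>a\<close> and \<open>b\<close> after they meet preserves the law of the system and
  reverses the sign of every matching that does not pair them.\<close>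

lemma integral_unpaired_zero:
  assumes E: "decided E A" and A: "A = {..<2 * n} - \<Union>H" and ab: "a \<in> A" "b \<in> A" "a < b"
  shows "(\<integral>\<omega>. indicator (first_event E A a b) \<omega> *
    (\<Sum>p\<in>matching_perms n H - matching_perms n (insert {a, b} H). pf_term n (pv \<omega>) p) \<partial>M) = 0"
proof -
  let ?D = "matching_perms n H - matching_perms n (insert {a, b} H)"
  let ?E = "first_event E A a b" and ?\<sigma> = "Transposition.transpose a b"
  \<comment> \<open>The unpaired sum as a functional on trajectories, where the laws with and
    without exchange are compared.\<close>
  define F where "F z = (\<Sum>p\<in>?D. pf_term n (traj_value g t z) p)" for z
  have Asub: "A \<subseteq> {..<2 * n}" using A by auto
  have ab2: "a < 2 * n" "b < 2 * n" using ab Asub by auto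
  have Ee: "?E \<in> events" using E by (intro first_event_events[OF _ Asub ab(1,2)]) (simp add: decided_def)
  have Es: "?E \<subseteq> space M" using Ee sets.sets_into_space by blast
  have perm: "p permutes {..<2 * n}" if "p \<in> ?D" for p using that by (simp add: matching_perms_def)
  have Fm: "F \<in> borel_measurable (traj_space (2 * n))"
    unfolding F_def by (intro borel_measurable_sum pf_term_traj_measurable[OF g perm t0])
  have Fw: "F (traj (2 * n) w) = (\<Sum>p\<in>?D. pf_term n (pair_value g t w) p)"
    if "\<And>i. i < 2 * n \<Longrightarrow> continuous_on {0..} (w i)" for w
    unfolding F_def using perm that by (intro sum.cong refl pf_term_paths)
  have \<sigma>: "?\<sigma> i < 2 * n" if "i < 2 * n" for i using that ab2 by (simp add: Transposition.transpose_def)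
  have swap: "F (traj (2 * n) (swap_after ?\<sigma> (T \<omega> a b) (paths \<omega>))) = - F (traj (2 * n) (paths \<omega>))"
    if \<omega>: "\<omega> \<in> ?E" for \<omega>
  proof -
    have sp: "\<omega> \<in> space M" and f: "first_pair (paths \<omega>) t A a b"
      using \<omega> Es by (auto simp: first_event_def)
    have c: "continuous_on {0..} (paths \<omega> i)" if "i < 2 * n" for i
      by (rule W_continuous[OF sp that])
    have cA: "continuous_on {0..} (paths \<omega> i)" if "i \<in> A" for i
      using c that Asub by auto
    have eq: "paths \<omega> a (T \<omega> a b) = paths \<omega> b (T \<omega> a b)"
      by (rule first_meet_attained'[OF t0 cA ab(1,2) f])
    let ?Y = "swap_after ?\<sigma> (T \<omega> a b) (paths \<omega>)"
    have cY: "continuous_on {0..} (?Y i)" if "i < 2 * n" for i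
      by (rule continuous_swap_at_first_meet[where w="paths \<omega>", OF eq first_meet_bounds(1)[OF t0] c[OF that] c[OF \<sigma>[OF that]]])
    have "(\<Sum>p\<in>?D. pf_term n (pair_value g t ?Y) p) = - (\<Sum>p\<in>?D. pf_term n (pv \<omega>) p)"
    proof (rule pf_swap_cancel)
      show "a < b" "b < 2 * n" "a \<notin> \<Union>H" "b \<notin> \<Union>H" using ab A ab2 by auto
      \<comment> \<open>Adjacency of the meeting pair leaves only annihilated labels between
        them.\<close>
      show "c \<in> \<Union>H" if "a < c" "c < b" for c
        using first_pair_adjacent[OF t0 cA _ ab(1,2) f that] W_order[OF sp] Asub that ab2 A by fastforce
      show "pv \<omega> i j = pv \<omega> j i" "pair_value g t ?Y i j = pair_value g t ?Y j i" for i j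
        by (rule pair_value_sym)+
      show "pair_value g t ?Y i j = pv \<omega> (?\<sigma> i) (?\<sigma> j)"
        if "i < 2 * n" "j < 2 * n" "i \<noteq> j" "i \<notin> \<Union>H" "j \<notin> \<Union>H" "{i, j} \<noteq> {a, b}" for i j
        using that ab A by (intro pair_value_swap[OF t0 cA _ _ _ f]) auto
      show "pair_value g t ?Y i j = pv \<omega> i j" if "{i, j} \<in> H" for i j
      proof -
        have "a \<notin> {i, j}" "b \<notin> {i, j}" using that ab(1,2) A by blast+
        then show ?thesis by (intro pair_value_swap_fixed) auto
      qed
    qed
    then show ?thesis using Fw[of ?Y, OF cY] Fw[of "paths \<omega>", OF c] by simp
  qed
  \<comment> \<open>The integral is unchanged by the exchange although the integrand changes sign,
    so it vanishes.\<close>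
  have "(\<integral>\<omega>. indicator ?E \<omega> * F (traj (2 * n) (swap_after ?\<sigma> (T \<omega> a b) (paths \<omega>))) \<partial>M) =
      (\<integral>\<omega>. indicator ?E \<omega> * F (traj (2 * n) (paths \<omega>)) \<partial>M)"
    using ab2 first_meet_bounds[OF t0]
    by (intro strong_markov_swap[OF ibm N \<sigma> _ T_measurable _ _ Es first_event_past[OF E Asub ab(1,2)] Fm])
       (use ab in auto)
  moreover have "indicator ?E \<omega> * F (traj (2 * n) (swap_after ?\<sigma> (T \<omega> a b) (paths \<omega>))) =
      - (indicator ?E \<omega> * F (traj (2 * n) (paths \<omega>)))" for \<omega>
    using swap by (cases "\<omega> \<in> ?E") auto
  ultimately have "(\<integral>\<omega>. indicator ?E \<omega> * F (traj (2 * n) (paths \<omega>)) \<partial>M) = 0" by simp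
  moreover have "indicator ?E \<omega> * F (traj (2 * n) (paths \<omega>)) = indicator ?E \<omega> * (\<Sum>p\<in>?D. pf_term n (pv \<omega>) p)"
    if "\<omega> \<in> space M" for \<omega>
    using Fw[of "paths \<omega>", OF W_continuous[OF that]] by simp
  ultimately show ?thesis by (simp cong: Bochner_Integration.integral_cong)
qed

text \<open>Absence of simultaneous meetings makes the first pair exist and be unique unless nothing
  meets; \<open>a < b\<close> counts it once. Real-valued indicators allow multiplication by an
  integrand.\<close>

lemma AE_partition:
  assumes A: "A \<subseteq> {..<2 * n}"
  shows "AE \<omega> in M. indicator E \<omega> = (indicator (quiet_event E A) \<omega> +
    (\<Sum>p\<in>{(a, b). a \<in> A \<and> b \<in> A \<and> a < b}. indicator (first_event E A (fst p) (snd p)) \<omega>) :: real)"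
  using AE_no_simultaneous_meeting[OF ibm strict_sorted_iff[THEN iffD1, OF sorted, THEN conjunct2]] AE_space
proof eventually_elim
  case (elim \<omega>)
  let ?P = "{(a, b). a \<in> A \<and> b \<in> A \<and> a < b}"
  have finA: "finite A" using A finite_subset by blast
  have fin: "finite ?P" by (rule finite_subset[of _ "A \<times> A"]) (use finA in auto)
  have c: "continuous_on {0..} (paths \<omega> i)" if "i \<in> A" for i
    using W_continuous[OF elim(2)] that A by auto
  show ?case
  proof (cases "\<omega> \<in> E")
    case False
    then show ?thesis by (simp add: quiet_event_def first_event_def)
  next
    case True
    show ?thesis
    proof (cases "no_pair (paths \<omega>) t A")
      case np: True
      then have "\<not> first_pair (paths \<omega>) t A a b" if "a \<in> A" "b \<in> A" "a < b" for a b
        using that by (force simp: no_pair_def first_pair_def)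
      then have "(\<Sum>p\<in>?P. indicator (first_event E A (fst p) (snd p)) \<omega>) = (0 :: real)"
        by (intro sum.neutral) (auto simp: first_event_def indicator_def)
      then show ?thesis using True np by (simp add: quiet_event_def)
    next
      case np: False
      have simple: "{a, b} = {c, d}" if "a \<in> A" "b \<in> A" "c \<in> A" "d \<in> A" "0 \<le> s" "a \<noteq> b" "c \<noteq> d"
        "paths \<omega> a s = paths \<omega> b s" "paths \<omega> c s = paths \<omega> d s" for a b c d s
      proof -
        have "a < length xs" "b < length xs" "c < length xs" "d < length xs" using that(1-4) A len by auto
        then show ?thesis using elim(1) that(5-9) by blast
      qed
      have "\<exists>a\<in>A. \<exists>b\<in>A. a < b \<and> first_pair (paths \<omega>) t A a b"
        by (rule first_pair_exists[OF t0 finA c simple np])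
      then obtain a b where ab: "a \<in> A" "b \<in> A" "a < b" "first_pair (paths \<omega>) t A a b" by blast
      have other: "\<not> first_pair (paths \<omega>) t A x y"
        if xy: "x \<in> A" "y \<in> A" "x < y" "(x, y) \<noteq> (a, b)" for x y
      proof
        assume f: "first_pair (paths \<omega>) t A x y"
        have ne: "{x, y} \<noteq> {a, b}" "x \<noteq> y" "a \<noteq> b" using xy ab(3) by (auto simp: doubleton_eq_iff)
        have "T \<omega> a b < T \<omega> x y" using ab(4) xy(1,2) ne unfolding first_pair_def by blast
        moreover have "T \<omega> x y < T \<omega> a b" using f ab(1,2) ne unfolding first_pair_def by metis
        ultimately show False by simp
      qed
      have "indicator (first_event E A (fst p) (snd p)) \<omega> = (if p = (a, b) then 1 else 0 :: real)"
        if "p \<in> ?P" for p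
      proof (cases "p = (a, b)")
        case 1: True
        then have "\<omega> \<in> first_event E A (fst p) (snd p)" using ab(4) True by (simp add: first_event_def)
        then show ?thesis using 1 by simp
      next
        case 2: False
        have "\<not> first_pair (paths \<omega>) t A (fst p) (snd p)" using that 2 by (intro other) auto
        then have "\<omega> \<notin> first_event E A (fst p) (snd p)" by (simp add: first_event_def)
        then show ?thesis using 2 by simp
      qed
      then have "(\<Sum>p\<in>?P. indicator (first_event E A (fst p) (snd p)) \<omega>) =
          (\<Sum>p\<in>?P. if p = (a, b) then 1 else 0 :: real)"
        by (rule sum.cong[OF refl])
      also have "\<dots> = 1" using ab fin by simp
      finally show ?thesis using True np by (simp add: quiet_event_def)
    qed
  qed
qed

lemma integral_partition:
  assumes A: "A \<subseteq> {..<2 * n}" and E: "E \<in> events"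
    and f: "\<And>E. E \<in> events \<Longrightarrow> integrable M (\<lambda>\<omega>. indicator E \<omega> * f \<omega> :: real)"
  shows "(\<integral>\<omega>. indicator E \<omega> * f \<omega> \<partial>M) = (\<integral>\<omega>. indicator (quiet_event E A) \<omega> * f \<omega> \<partial>M) +
    (\<Sum>p\<in>{(a, b). a \<in> A \<and> b \<in> A \<and> a < b}. \<integral>\<omega>. indicator (first_event E A (fst p) (snd p)) \<omega> * f \<omega> \<partial>M)"
proof -
  let ?P = "{(a, b). a \<in> A \<and> b \<in> A \<and> a < b}"
  have fe: "first_event E A (fst p) (snd p) \<in> events" if "p \<in> ?P" for p
    using that by (intro first_event_events[OF E A]) auto
  have i1: "integrable M (\<lambda>\<omega>. indicator (quiet_event E A) \<omega> * f \<omega>)" by (intro f quiet_event_events E A)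
  have i2: "integrable M (\<lambda>\<omega>. \<Sum>p\<in>?P. indicator (first_event E A (fst p) (snd p)) \<omega> * f \<omega>)"
    by (intro Bochner_Integration.integrable_sum f fe)
  have "(\<integral>\<omega>. indicator E \<omega> * f \<omega> \<partial>M) = (\<integral>\<omega>. indicator (quiet_event E A) \<omega> * f \<omega> +
      (\<Sum>p\<in>?P. indicator (first_event E A (fst p) (snd p)) \<omega> * f \<omega>) \<partial>M)"
  proof (rule integral_cong_AE)
    show "(\<lambda>\<omega>. indicator E \<omega> * f \<omega>) \<in> borel_measurable M" using f[OF E] by simp
    show "(\<lambda>\<omega>. indicator (quiet_event E A) \<omega> * f \<omega> +
        (\<Sum>p\<in>?P. indicator (first_event E A (fst p) (snd p)) \<omega> * f \<omega>)) \<in> borel_measurable M"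
      using Bochner_Integration.integrable_add[OF i1 i2] by simp
    show "AE \<omega> in M. indicator E \<omega> * f \<omega> = indicator (quiet_event E A) \<omega> * f \<omega> +
        (\<Sum>p\<in>?P. indicator (first_event E A (fst p) (snd p)) \<omega> * f \<omega>)"
      using AE_partition[OF A, of E]
      by eventually_elim (simp only: distrib_right sum_distrib_right)
  qed
  also have "\<dots> = (\<integral>\<omega>. indicator (quiet_event E A) \<omega> * f \<omega> \<partial>M) +
      (\<integral>\<omega>. (\<Sum>p\<in>?P. indicator (first_event E A (fst p) (snd p)) \<omega> * f \<omega>) \<partial>M)"
    by (rule Bochner_Integration.integral_add[OF i1 i2])
  also have "(\<integral>\<omega>. (\<Sum>p\<in>?P. indicator (first_event E A (fst p) (snd p)) \<omega> * f \<omega>) \<partial>M) =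
      (\<Sum>p\<in>?P. \<integral>\<omega>. indicator (first_event E A (fst p) (snd p)) \<omega> * f \<omega> \<partial>M)"
    by (intro Bochner_Integration.integral_sum f fe)
  finally show ?thesis .
qed

text \<open>\<open>H\<close> is the set of pairs annihilated so far, \<open>A\<close> the set of living particles and \<open>E\<close> the event
  that this is the history of the system.\<close>

lemma integral_pf_sum_history:
  assumes "decided E A" and "A = {..<2 * n} - \<Union>H" and "pf_sum n H (\<lambda>_ _. 1) = 2 ^ n * fact n"
    and "\<And>\<omega> i j. \<omega> \<in> E \<Longrightarrow> {i, j} \<in> H \<Longrightarrow> pv \<omega> i j = 1" and "card A \<le> m"
  shows "(\<integral>\<omega>. indicator E \<omega> * pf_sum n H (pv \<omega>) \<partial>M) =
    2 ^ n * fact n * (\<integral>\<omega>. indicator E \<omega> * surv_prod m A \<omega> \<partial>M)"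
  using assms
proof (induction m arbitrary: E A H)
  \<comment> \<open>When no pair of \<open>A\<close> meets, further rounds change nothing, so the
    number \<open>m\<close> of rounds is arbitrary here.\<close>
  have quiet: "(\<integral>\<omega>. indicator (quiet_event E A) \<omega> * pf_sum n H (pv \<omega>) \<partial>M) =
      2 ^ n * fact n * (\<integral>\<omega>. indicator (quiet_event E A) \<omega> * surv_prod m A \<omega> \<partial>M)"
    if E: "decided E A" and A: "A = {..<2 * n} - \<Union>H" and H: "pf_sum n H (\<lambda>_ _. 1) = 2 ^ n * fact n"
      and one: "\<And>\<omega> i j. \<omega> \<in> E \<Longrightarrow> {i, j} \<in> H \<Longrightarrow> pv \<omega> i j = 1" for E A H m
  proof -
    have Es: "E \<subseteq> space M" using E sets.sets_into_space by (auto simp: decided_def)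
    have "indicator (quiet_event E A) \<omega> * pf_sum n H (pv \<omega>) =
        2 ^ n * fact n * (indicator (quiet_event E A) \<omega> * surv_prod m A \<omega>)" for \<omega>
    proof (cases "\<omega> \<in> quiet_event E A")
      case True
      then have \<omega>: "\<omega> \<in> E" "\<omega> \<in> space M" and np: "no_pair (paths \<omega>) t A"
        using Es by (auto simp: quiet_event_def)
      have c: "continuous_on {0..} (paths \<omega> i)" if "i \<in> A" for i
        using W_continuous[OF \<omega>(2)] that A by auto
      have "no_pair (paths \<omega>) t A \<longleftrightarrow> meet_times (paths \<omega>) t A = {}"
        by (rule no_pair_iff[where w="paths \<omega>", OF t0 c])
      then have mt: "meet_times (paths \<omega>) t A = {}" using np by simp
      have "pv \<omega> i j = g (W i t \<omega>) * g (W j t \<omega>)" if "i \<in> A" "j \<in> A" "i \<noteq> j" for i j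
      proof -
        have "\<not> (\<exists>s\<in>{0..t}. paths \<omega> i s = paths \<omega> j s)"
          using that mt unfolding meet_times_def by blast
        then show ?thesis by (simp add: pair_value_def)
      qed
      then have "pf_sum n H (pv \<omega>) = pf_sum n H (\<lambda>_ _. 1) * (\<Prod>i\<in>A. g (W i t \<omega>))"
        by (intro pf_sum_no_pair[OF A one[OF \<omega>(1)]])
      moreover have "surv_prod m A \<omega> = (\<Prod>i\<in>A. g (W i t \<omega>))"
        using annihilate_no_pair[where w="paths \<omega>", OF t0 c np, of m] by (simp add: surv_prod_def)
      ultimately show ?thesis using H by simp
    qed simp
    then show ?thesis by (simp only: integral_mult_right_zero)
  qed
  {
    case 0
    then have "A = {}" using finite_subset[of A "{..<2 * n}"] by auto
    then have "quiet_event E A = E" by (simp add: quiet_event_def no_pair_def)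
    then show ?case using quiet[OF 0(1-4), of 0] by simp
  next
    case (Suc m)
    note E = Suc.prems(1) and A = Suc.prems(2) and H = Suc.prems(3) and one = Suc.prems(4)
    let ?P = "{(a, b). a \<in> A \<and> b \<in> A \<and> a < b}"
    have Ee: "E \<in> events" using E by (simp add: decided_def)
    have Es: "E \<subseteq> space M" using Ee sets.sets_into_space by blast
    have Asub: "A \<subseteq> {..<2 * n}" using A by auto
    have finA: "finite A" using Asub finite_subset by blast
    have int: "integrable M (\<lambda>\<omega>. indicator E' \<omega> * pf_sum n H' (pv \<omega>))" if "E' \<in> events" for E' H'
      unfolding pf_sum_def by (rule sum_pf_term_integrable[OF that order_refl])
    have step: "(\<integral>\<omega>. indicator (first_event E A a b) \<omega> * pf_sum n H (pv \<omega>) \<partial>M) =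
        2 ^ n * fact n * (\<integral>\<omega>. indicator (first_event E A a b) \<omega> * surv_prod (Suc m) A \<omega> \<partial>M)"
      if ab: "a \<in> A" "b \<in> A" "a < b" for a b
    proof (cases "first_event E A a b = {}")
      case True
      then show ?thesis by simp
    next
      case False
      let ?E = "first_event E A a b" and ?H = "insert {a, b} H" and ?A = "A - {a, b}"
      have abn: "a \<noteq> b" "b < 2 * n" "a \<notin> \<Union>H" "b \<notin> \<Union>H" using ab A by auto
      have fe: "?E \<in> events" by (rule first_event_events[OF Ee Asub ab(1,2)])
      have c: "continuous_on {0..} (paths \<omega> i)" if "\<omega> \<in> ?E" "i \<in> A" for \<omega> i
        using W_continuous[of \<omega> i] that Asub Es by (auto simp: first_event_def)
      have f: "first_pair (paths \<omega>) t A a b" if "\<omega> \<in> ?E" for \<omega> using that by (simp add: first_event_def)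
      \<comment> \<open>That only annihilated labels lie between \<open>a\<close> and
        \<open>b\<close> is a statement about labels, so a single outcome in the event establishes
        it.\<close>
      obtain \<omega>0 where \<omega>0: "\<omega>0 \<in> ?E" using False by blast
      then have sp0: "\<omega>0 \<in> space M" using Es by (auto simp: first_event_def)
      have adj: "k \<in> \<Union>H" if k: "a < k" "k < b" for k
      proof -
        have "k \<notin> A"
          by (rule first_pair_adjacent[OF t0 c[OF \<omega>0] _ ab(1,2) f[OF \<omega>0] k])
             (use W_order[OF sp0] Asub in auto)
        then show ?thesis using A k abn by auto
      qed
      have split: "indicator ?E \<omega> * pf_sum n H (pv \<omega>) =
          indicator ?E \<omega> * (\<Sum>p\<in>matching_perms n H - matching_perms n ?H. pf_term n (pv \<omega>) p) +
          indicator ?E \<omega> * pf_sum n ?H (pv \<omega>)" for \<omega>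
        unfolding pf_sum_def
        using sum.subset_diff[OF matching_perms_insert[of n "{a, b}" H] finite_matching_perms, of "pf_term n (pv \<omega>)"]
        by (simp only: distrib_left)
      have "(\<integral>\<omega>. indicator ?E \<omega> * pf_sum n H (pv \<omega>) \<partial>M) =
          (\<integral>\<omega>. indicator ?E \<omega> * (\<Sum>p\<in>matching_perms n H - matching_perms n ?H. pf_term n (pv \<omega>) p) \<partial>M) +
          (\<integral>\<omega>. indicator ?E \<omega> * pf_sum n ?H (pv \<omega>) \<partial>M)"
        unfolding split by (intro Bochner_Integration.integral_add int[OF fe] sum_pf_term_integrable[OF fe]) auto
      also have "\<dots> = (\<integral>\<omega>. indicator ?E \<omega> * pf_sum n ?H (pv \<omega>) \<partial>M)"
        using integral_unpaired_zero[OF E A ab] by simp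
      also have "\<dots> = 2 ^ n * fact n * (\<integral>\<omega>. indicator ?E \<omega> * surv_prod m ?A \<omega> \<partial>M)"
      proof (rule Suc.IH)
        show "decided ?E ?A" by (rule decided_first_event[OF E Asub ab(1,2) abn(1)])
        show "?A = {..<2 * n} - \<Union>?H" using A by auto
        show "pf_sum n ?H (\<lambda>_ _. 1) = 2 ^ n * fact n"
          using pf_sum_insert_one[OF ab(3) abn(2-4) adj] H by simp
        \<comment> \<open>A loss of one particle per round is enough for the induction and fits the
          number of rounds in \<open>survivors\<close>.\<close>
        show "card ?A \<le> m"
        proof -
          have "card ?A < card A" using finA ab(1) by (intro psubset_card_mono) auto
          then show ?thesis using Suc.prems(5) by simp
        qed
        fix \<omega> i j assume \<omega>: "\<omega> \<in> ?E" and ij: "{i, j} \<in> ?H"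
        show "pv \<omega> i j = 1"
        proof (cases "{i, j} \<in> H")
          case True
          then show ?thesis using one[of \<omega> i j] \<omega> by (simp add: first_event_def)
        next
          case False
          have "paths \<omega> a (T \<omega> a b) = paths \<omega> b (T \<omega> a b)"
            by (rule first_meet_attained'[OF t0 c[OF \<omega>] ab(1,2) f[OF \<omega>]])
          moreover have "T \<omega> a b \<in> {0..t}"
            using first_meet_bounds(1)[OF t0] f[OF \<omega>] by (auto simp: first_pair_def)
          ultimately have "pv \<omega> a b = 1" unfolding pair_value_def by auto
          then show ?thesis using False ij pair_value_sym[of g t "paths \<omega>" a b] by (auto simp: doubleton_eq_iff)
        qed
      qed
      \<comment> \<open>One of the \<open>Suc m\<close> rounds is spent on removing \<open>a\<close>
        and \<open>b\<close>.\<close>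
      also have "(\<integral>\<omega>. indicator ?E \<omega> * surv_prod m ?A \<omega> \<partial>M) =
          (\<integral>\<omega>. indicator ?E \<omega> * surv_prod (Suc m) A \<omega> \<partial>M)"
      proof (rule Bochner_Integration.integral_cong[OF refl])
        fix \<omega>
        show "indicator ?E \<omega> * surv_prod m ?A \<omega> = indicator ?E \<omega> * surv_prod (Suc m) A \<omega>"
        proof (cases "\<omega> \<in> ?E")
          case True
          have "annihilate (paths \<omega>) t A = ?A"
            by (rule annihilate_first_pair[OF t0 c[OF True] ab(1,2) abn(1) f[OF True]])
          then show ?thesis by (simp add: surv_prod_def funpow_Suc_right del: funpow.simps)
        qed simp
      qed
      finally show ?thesis .
    qed
    have "(\<integral>\<omega>. indicator E \<omega> * pf_sum n H (pv \<omega>) \<partial>M) =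
        (\<integral>\<omega>. indicator (quiet_event E A) \<omega> * pf_sum n H (pv \<omega>) \<partial>M) +
        (\<Sum>p\<in>?P. \<integral>\<omega>. indicator (first_event E A (fst p) (snd p)) \<omega> * pf_sum n H (pv \<omega>) \<partial>M)"
      by (rule integral_partition[OF Asub Ee int])
    also have "\<dots> = 2 ^ n * fact n * ((\<integral>\<omega>. indicator (quiet_event E A) \<omega> * surv_prod (Suc m) A \<omega> \<partial>M) +
        (\<Sum>p\<in>?P. \<integral>\<omega>. indicator (first_event E A (fst p) (snd p)) \<omega> * surv_prod (Suc m) A \<omega> \<partial>M))"
      unfolding distrib_left sum_distrib_left
      by (intro arg_cong2[where f="(+)"] quiet[OF E A H one] sum.cong refl step) auto
    also have "\<dots> = 2 ^ n * fact n * (\<integral>\<omega>. indicator E \<omega> * surv_prod (Suc m) A \<omega> \<partial>M)"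
      using integral_partition[OF Asub Ee surv_prod_integrable[OF _ Asub], of "Suc m"] by simp
    finally show ?case .
  }
qed

lemma integral_pf_sum:
  "(\<integral>\<omega>. pf_sum n {} (pv \<omega>) \<partial>M) = 2 ^ n * fact n * (\<integral>\<omega>. (\<Prod>i\<in>survivors (paths \<omega>) (2 * n) t. g (W i t \<omega>)) \<partial>M)"
proof -
  have "(\<integral>\<omega>. indicator (space M) \<omega> * pf_sum n {} (pv \<omega>) \<partial>M) =
      2 ^ n * fact n * (\<integral>\<omega>. indicator (space M) \<omega> * surv_prod (2 * n) {..<2 * n} \<omega> \<partial>M)"
    by (rule integral_pf_sum_history[OF decided_space]) (simp_all add: pf_sum_one)
  then show ?thesis by (simp add: surv_prod_def survivors_def cong: Bochner_Integration.integral_cong)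
qed

text \<open>Particles \<open>i, j\<close> of the large system and the separate two-particle system
  have the same law on trajectories, and both sides are expectations of one measurable functional of
  these.\<close>

lemma expectation_pair_value:
  assumes M': "independent_brownian_motions M' [xs ! i, xs ! j] W'" and ij: "i < 2 * n" "j < 2 * n" "i \<noteq> j"
  shows "(\<integral>\<omega>. pv \<omega> i j \<partial>M) = (\<integral>\<omega>. (\<Prod>k\<in>survivors (\<lambda>k s. W' k s \<omega>) 2 t. g (W' k t \<omega>)) \<partial>M')"
proof -
  let ?V = "\<lambda>k. W (if k = 0 then i else j)"
  have ij': "i < length xs" "j < length xs" using ij len by auto
  note V = ibm_subsystem[OF ibm ij' ij(3)]
  let ?f = "\<lambda>z. traj_value g t z 0 1"
  have f: "?f \<in> borel_measurable (traj_space 2)" by (rule traj_value_measurable[OF g _ _ t0]) auto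
  have m1: "(\<lambda>\<omega>. traj 2 (\<lambda>k s. ?V k s \<omega>)) \<in> measurable M (traj_space 2)"
    by (rule measurable_traj) (use ij W_measurable in auto)
  have m2: "(\<lambda>\<omega>. traj 2 (\<lambda>k s. W' k s \<omega>)) \<in> measurable M' (traj_space 2)"
    by (rule measurable_traj) (use ibm_measurable[OF M'] in auto)
  have law: "distr M (traj_space 2) (\<lambda>\<omega>. traj 2 (\<lambda>k s. ?V k s \<omega>)) = distr M' (traj_space 2) (\<lambda>\<omega>. traj 2 (\<lambda>k s. W' k s \<omega>))"
    using ibm_law_unique[OF V M'] by (simp add: numeral_2_eq_2)
  have "(\<integral>\<omega>. pv \<omega> i j \<partial>M) = (\<integral>\<omega>. ?f (traj 2 (\<lambda>k s. ?V k s \<omega>)) \<partial>M)"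
  proof (rule Bochner_Integration.integral_cong[OF refl])
    fix \<omega> assume "\<omega> \<in> space M"
    then have "?f (traj 2 (\<lambda>k s. ?V k s \<omega>)) = pair_value g t (\<lambda>k s. ?V k s \<omega>) 0 1"
      using W_continuous[of \<omega>] ij by (intro traj_value_eq t0) auto
    then show "pv \<omega> i j = ?f (traj 2 (\<lambda>k s. ?V k s \<omega>))" by (simp add: pair_value_def)
  qed
  also have "\<dots> = (\<integral>\<omega>. ?f (traj 2 (\<lambda>k s. W' k s \<omega>)) \<partial>M')"
    using integral_distr[OF m1 f] integral_distr[OF m2 f] law by simp
  also have "\<dots> = (\<integral>\<omega>. (\<Prod>k\<in>survivors (\<lambda>k s. W' k s \<omega>) 2 t. g (W' k t \<omega>)) \<partial>M')"
  proof (rule Bochner_Integration.integral_cong[OF refl])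
    fix \<omega> assume "\<omega> \<in> space M'"
    then have c: "continuous_on {0..} (\<lambda>s. W' k s \<omega>)" if "k < 2" for k
      using ibm_continuous[OF M'] that by auto
    show "?f (traj 2 (\<lambda>k s. W' k s \<omega>)) = (\<Prod>k\<in>survivors (\<lambda>k s. W' k s \<omega>) 2 t. g (W' k t \<omega>))"
      using survivors_two[where w="\<lambda>k s. W' k s \<omega>", OF t0 c, of g]
        traj_value_eq[where w="\<lambda>k s. W' k s \<omega>" and N=2 and i=0 and j=1, OF _ _ t0 c c, of g] by simp
  qed
  finally show ?thesis .
qed

text \<open>The blocks of a permutation are disjoint, so the factors are functions of disjoint
  groups of independent processes.\<close>

lemma expectation_block_product:
  assumes p: "p permutes {..<2 * n}"
  shows "(\<integral>\<omega>. (\<Prod>k<n. pv \<omega> (p (2 * k)) (p (2 * k + 1))) \<partial>M) =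
    (\<Prod>k<n. \<integral>\<omega>. pv \<omega> (p (2 * k)) (p (2 * k + 1)) \<partial>M)"
proof -
  let ?P = "\<Pi>\<^sub>M s\<in>{0::real..}. (borel :: real measure)"
  let ?K = "\<lambda>k. {p (2 * k), p (2 * k + 1)}"
  \<comment> \<open>The rational-time version of \<open>pair_value\<close>, written for families of
    paths because independence is stated for these.\<close>
  let ?h = "\<lambda>k f. if \<forall>l::nat. \<exists>s\<in>\<rat> \<inter> {0..t}. \<bar>f (p (2 * k)) s - f (p (2 * k + 1)) s\<bar> < 1 / real (Suc l) then 1
      else g (f (p (2 * k)) t) * g (f (p (2 * k + 1)) t)"
  have plt: "p x < 2 * n" if "x < 2 * n" for x using permutes_in_image[OF p, of x] that by simp
  have ind: "indep_vars (\<lambda>_. ?P) (\<lambda>i \<omega>. \<lambda>s\<in>{0..}. W i s \<omega>) {..<2 * n}"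
    using ibm len by (simp add: independent_brownian_motions_def)
  have "indep_vars (\<lambda>k. \<Pi>\<^sub>M _\<in>?K k. ?P) (\<lambda>k \<omega>. \<lambda>i\<in>?K k. \<lambda>s\<in>{0..}. W i s \<omega>) {..<n}"
  proof (rule indep_vars_restrict[OF ind])
    show "?K k \<subseteq> {..<2 * n}" if "k \<in> {..<n}" for k using that plt by auto
    show "disjoint_family_on ?K {..<n}"
      using perm_block_unique[OF p] unfolding disjoint_family_on_def by blast
  qed
  then have iv: "indep_vars (\<lambda>_. borel) (\<lambda>k \<omega>. ?h k (\<lambda>i\<in>?K k. \<lambda>s\<in>{0..}. W i s \<omega>)) {..<n}"
  proof (rule indep_vars_compose2)
    fix k
    have "(\<lambda>f. f i s) \<in> borel_measurable (\<Pi>\<^sub>M _\<in>?K k. ?P)" if "i \<in> ?K k" "0 \<le> s" for i s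
      using that by (intro measurable_compose[OF measurable_component_singleton[of i]] measurable_component_singleton) auto
    then show "?h k \<in> borel_measurable (\<Pi>\<^sub>M _\<in>?K k. ?P)"
      by (intro indicator_meet_measurable[OF g t0]) auto
  qed
  have h: "?h k (\<lambda>i\<in>?K k. \<lambda>s\<in>{0..}. W i s \<omega>) = pv \<omega> (p (2 * k)) (p (2 * k + 1))"
    if "k < n" "\<omega> \<in> space M" for k \<omega>
  proof -
    have lt: "p (2 * k) < 2 * n" "p (2 * k + 1) < 2 * n" using that plt by auto
    define u where "u = (\<lambda>i\<in>?K k. \<lambda>s\<in>{0::real..}. W i s \<omega>)"
    define z where "z = traj (2 * n) (paths \<omega>)"
    have u: "u (p (2 * k)) s = z (p (2 * k), s)" "u (p (2 * k + 1)) s = z (p (2 * k + 1), s)" if "0 \<le> s" for s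
      using that lt by (simp_all add: u_def z_def)
    have ex: "(\<exists>s\<in>\<rat> \<inter> {0..t}. \<bar>u (p (2 * k)) s - u (p (2 * k + 1)) s\<bar> < e) \<longleftrightarrow>
        (\<exists>s\<in>\<rat> \<inter> {0..t}. \<bar>z (p (2 * k), s) - z (p (2 * k + 1), s)\<bar> < e)" for e
      by (intro bex_cong) (simp_all only: u Int_iff atLeastAtMost_iff)
    have "?h k u = traj_value g t z (p (2 * k)) (p (2 * k + 1))"
      unfolding traj_value_def by (simp only: ex u[OF t0])
    also have "\<dots> = pv \<omega> (p (2 * k)) (p (2 * k + 1))"
      unfolding z_def
      by (rule traj_value_eq[OF lt t0 W_continuous[OF that(2) lt(1)] W_continuous[OF that(2) lt(2)]])
    finally show ?thesis unfolding u_def .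
  qed
  have bounded: "\<bar>pv \<omega> i j\<bar> \<le> C * C" for \<omega> i j by (rule pair_value_bounded[OF gC C])
  have "(\<integral>\<omega>. (\<Prod>k<n. ?h k (\<lambda>i\<in>?K k. \<lambda>s\<in>{0..}. W i s \<omega>)) \<partial>M) =
      (\<Prod>k<n. \<integral>\<omega>. ?h k (\<lambda>i\<in>?K k. \<lambda>s\<in>{0..}. W i s \<omega>) \<partial>M)"
  proof (rule indep_vars_lebesgue_integral[OF _ iv])
    fix k assume k: "k \<in> {..<n}"
    show "integrable M (\<lambda>\<omega>. ?h k (\<lambda>i\<in>?K k. \<lambda>s\<in>{0..}. W i s \<omega>))"
    proof (rule integrable_const_bound[where B="C * C"])
      show "(\<lambda>\<omega>. ?h k (\<lambda>i\<in>?K k. \<lambda>s\<in>{0..}. W i s \<omega>)) \<in> borel_measurable M"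
        using iv k unfolding indep_vars_def by blast
      show "AE \<omega> in M. norm (?h k (\<lambda>i\<in>?K k. \<lambda>s\<in>{0..}. W i s \<omega>)) \<le> C * C"
      proof (rule AE_I2)
        fix \<omega> assume "\<omega> \<in> space M"
        then show "norm (?h k (\<lambda>i\<in>?K k. \<lambda>s\<in>{0..}. W i s \<omega>)) \<le> C * C"
          using k bounded by (subst h) auto
      qed
    qed
  qed simp
  moreover have "(\<integral>\<omega>. (\<Prod>k<n. ?h k (\<lambda>i\<in>?K k. \<lambda>s\<in>{0..}. W i s \<omega>)) \<partial>M) =
      (\<integral>\<omega>. (\<Prod>k<n. pv \<omega> (p (2 * k)) (p (2 * k + 1))) \<partial>M)"
    by (intro Bochner_Integration.integral_cong refl prod.cong h) auto
  moreover have "(\<Prod>k<n. \<integral>\<omega>. ?h k (\<lambda>i\<in>?K k. \<lambda>s\<in>{0..}. W i s \<omega>) \<partial>M) =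
      (\<Prod>k<n. \<integral>\<omega>. pv \<omega> (p (2 * k)) (p (2 * k + 1)) \<partial>M)"
    by (intro prod.cong refl Bochner_Integration.integral_cong h) auto
  ultimately show ?thesis by simp
qed

text \<open>Signs and values are separated: a skew entry is a fixed sign times the symmetric value,
  so linearity and independence of the blocks apply to each permutation.\<close>

lemma expectation_pf_sum:
  assumes m: "\<And>i j. i < j \<Longrightarrow> j < 2 * n \<Longrightarrow> (\<integral>\<omega>. pv \<omega> i j \<partial>M) = m2 i j"
  shows "(\<integral>\<omega>. pf_sum n {} (pv \<omega>) \<partial>M) = pf_sum n {} m2"
proof -
  define s where "s i j = skew_matrix (\<lambda>_ _. 1) i j" for i j
  define c where "c p = of_int (sign p) * (\<Prod>k<n. s (p (2 * k)) (p (2 * k + 1)))" for p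
  have perm: "p permutes {..<2 * n}" if "p \<in> matching_perms n {}" for p using that by (simp add: matching_perms_def)
  have term1: "pf_term n (pv \<omega>) p = c p * (\<Prod>k<n. pv \<omega> (p (2 * k)) (p (2 * k + 1)))" for \<omega> p
  proof -
    have "skew_matrix (pv \<omega>) i j = s i j * pv \<omega> i j" for i j
      by (simp add: s_def skew_matrix_def pair_value_sym[of g t "paths \<omega>" j i])
    then show ?thesis by (simp add: pf_term_def c_def prod.distrib)
  qed
  have term2: "pf_term n m2 p = c p * (\<Prod>k<n. \<integral>\<omega>. pv \<omega> (p (2 * k)) (p (2 * k + 1)) \<partial>M)" if p: "p permutes {..<2 * n}" for p
  proof -
    have "skew_matrix m2 i j = s i j * (\<integral>\<omega>. pv \<omega> i j \<partial>M)" if "i < 2 * n" "j < 2 * n" for i j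
      using m[of i j] m[of j i] that
      by (simp add: s_def skew_matrix_def pair_value_sym[of g t _ j i])
    moreover have "p x < 2 * n" if "x < 2 * n" for x using permutes_in_image[OF p, of x] that by simp
    ultimately have "(\<Prod>k<n. skew_matrix m2 (p (2 * k)) (p (2 * k + 1))) =
        (\<Prod>k<n. s (p (2 * k)) (p (2 * k + 1)) * (\<integral>\<omega>. pv \<omega> (p (2 * k)) (p (2 * k + 1)) \<partial>M))"
      by (intro prod.cong) auto
    then show ?thesis by (simp add: pf_term_def c_def prod.distrib)
  qed
  have "(\<integral>\<omega>. pf_sum n {} (pv \<omega>) \<partial>M) = (\<Sum>p\<in>matching_perms n {}. \<integral>\<omega>. pf_term n (pv \<omega>) p \<partial>M)"
    unfolding pf_sum_def
  proof (rule Bochner_Integration.integral_sum)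
    fix p assume "p \<in> matching_perms n {}"
    then have "integrable M (\<lambda>\<omega>. indicator (space M) \<omega> * pf_term n (pv \<omega>) p)"
      by (intro pf_term_integrable perm) auto
    then show "integrable M (\<lambda>\<omega>. pf_term n (pv \<omega>) p)"
      by (simp cong: Bochner_Integration.integrable_cong)
  qed
  also have "\<dots> = (\<Sum>p\<in>matching_perms n {}. pf_term n m2 p)"
  proof (rule sum.cong[OF refl])
    fix p assume "p \<in> matching_perms n {}"
    note p = perm[OF this]
    show "(\<integral>\<omega>. pf_term n (pv \<omega>) p \<partial>M) = pf_term n m2 p"
      unfolding term1 term2[OF p] integral_mult_right_zero expectation_block_product[OF p] ..
  qed
  finally show ?thesis by (simp add: pf_sum_def)
qed

end

theorem theorem3:
  fixes M :: "real list \<Rightarrow> 'a measure"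
    and B :: "real list \<Rightarrow> nat \<Rightarrow> real \<Rightarrow> 'a \<Rightarrow> real"
    and g :: "real \<Rightarrow> real" and t :: real and n :: nat and xs :: "real list"
  assumes "\<And>ys. distinct ys \<Longrightarrow> independent_brownian_motions (M ys) ys (B ys)"
    and "g \<in> borel_measurable borel" and "bounded (range g)"
    and "t > 0"
    and "n \<ge> 1" and "length xs = 2 * n" and "sorted_wrt (<) xs"
  shows "product_moment M B g t xs =
    pfaffian n (skew_matrix (\<lambda>i j. product_moment M B g t [xs ! i, xs ! j]))"
proof -
  obtain C0 where C0: "\<And>x. \<bar>g x\<bar> \<le> C0" using assms(3) unfolding bounded_iff by auto
  have dist: "distinct xs" using assms(7) by (simp add: strict_sorted_iff)
  interpret annihilating "M xs" xs "B xs" n t g "max 1 C0"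
    using assms dist C0 by unfold_locales (auto intro: order_trans[OF C0])
  have m2: "(\<integral>\<omega>. pv \<omega> i j \<partial>M xs) = product_moment M B g t [xs ! i, xs ! j]" if "i < j" "j < 2 * n" for i j
  proof -
    have "distinct [xs ! i, xs ! j]" using dist that assms(6) by (simp add: nth_eq_iff_index_eq)
    from expectation_pair_value[OF assms(1)[OF this]] that show ?thesis
      by (simp add: product_moment_def numeral_2_eq_2)
  qed
  \<comment> \<open>The count \<open>2 ^ n * fact n\<close> of permutations per matching cancels
    against the denominator in \<open>pfaffian\<close>.\<close>
  show ?thesis
    using integral_pf_sum expectation_pf_sum[of "\<lambda>i j. product_moment M B g t [xs ! i, xs ! j]", OF m2]
    unfolding pfaffian_eq_pf_sum by (simp add: product_moment_def assms(6) field_simps)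
qed

end
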